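(* Let $0<\alpha<\frac12$, let $c_1\in A(\mathbb T,\frac32)$ be strictly positive on $\mathbb T$, and let $\varphi_\alpha(e^{i\theta})=|1-e^{i\theta}|^{2\alpha}c_1(e^{i\theta})$. Let $\lambda_{min,\alpha,N}$ be the minimal eigenvalue of $T_N(\varphi_\alpha)$. Then, as $N\to+\infty$, $$\lambda_{min,\alpha,N}=N^{-2\alpha}\,\Vert\tilde G_\alpha\Vert^{-1}c_1(1)+o(N^{-2\alpha}),$$ where $\tilde G_\alpha$ is the integral operator on $L^2(0,1)$ with kernel $G_\alpha$ and $\Vert\cdot\Vert$ is the operator norm.
   Context: $\mathbb T$ is the unit circle. For $f\in L^1(\mathbb T)$, $\hat f(j)=\frac1{2\pi}\int_0^{2\pi}f(e^{i\theta})e^{-ij\theta}d\theta$. The Toeplitz matrix of order $N$ with symbol $f$ is the $(N+1)\times(N+1)$ matrix $T_N(f)$ with $(T_N(f))_{k+1,l+1}=\hat f(l-k)$ for $0\le k,l\le N$. For $r\ge1$, $A(\mathbb T,r)$ is the set of $h\in L^2(\mathbb T)$ with $\sum_{n\in\mathbb Z}|n+1|^r|\hat h(n)|<\infty$. For $0<\alpha\le\frac12$ and $(x,y)\in[0,1]^2$ with $x\ne y$, $$G_\alpha(x,y)=\frac{1}{\Gamma^2(\alpha)}x^\alpha y^\alpha\int_{\max(x,y)}^1\frac{(t-x)^{\alpha-1}(t-y)^{\alpha-1}}{t^{2\alpha}}\,dt .$$ *)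

theory Defs
  imports
    "HOL-Analysis.Analysis"
    "HOL-Library.Landau_Symbols"
    "Jordan_Normal_Form.Char_Poly"
begin

text \<open>Square integrable functions on a set of reals, as functions rather than as classes modulo
  null sets. Using Borel representatives loses nothing, since each class contains one.\<close>

definition L2_on :: "real set \<Rightarrow> (real \<Rightarrow> complex) set" where
  "L2_on S = {f. set_borel_measurable lborel S f \<and>
                 set_integrable lborel S (\<lambda>x. (cmod (f x))\<^sup>2)}"

definition L2_norm_on :: "real set \<Rightarrow> (real \<Rightarrow> complex) \<Rightarrow> real" where
  "L2_norm_on S f = sqrt (LINT x:S|lborel. (cmod (f x))\<^sup>2)"

text \<open>\<^const>\<open>onorm\<close> needs a normed space type, so the supremum over the unit ball is spelled out.\<close>

definition L2_opnorm_on :: "real set \<Rightarrow> ((real \<Rightarrow> complex) \<Rightarrow> (real \<Rightarrow> complex)) \<Rightarrow> real" where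
  "L2_opnorm_on S T = (SUP f \<in> {f \<in> L2_on S. L2_norm_on S f \<le> 1}. L2_norm_on S (T f))"

text \<open>Functions on the unit circle are functions on the complex plane of which only the values
  on \<^term>\<open>sphere 0 1 :: complex set\<close> matter.\<close>

definition fourier_coeff :: "(complex \<Rightarrow> complex) \<Rightarrow> int \<Rightarrow> complex" where
  "fourier_coeff f j =
     (LINT \<theta>:{0..2*pi}|lborel. f (exp (\<i> * of_real \<theta>)) * exp (- \<i> * of_int j * of_real \<theta>))
       / (2 * of_real pi)"

definition A_circle :: "real \<Rightarrow> (complex \<Rightarrow> complex) set" where
  "A_circle r = {h. (\<lambda>\<theta>. h (exp (\<i> * of_real \<theta>))) \<in> L2_on {0..2*pi} \<and>
     (\<lambda>n::int. \<bar>of_int (n + 1)\<bar> powr r * cmod (fourier_coeff h n)) summable_on UNIV}"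

text \<open>Order \<open>N\<close> means size \<open>N + 1\<close>; indices of \<^const>\<open>mat\<close> start at \<open>0\<close>.\<close>

definition toeplitz :: "nat \<Rightarrow> (complex \<Rightarrow> complex) \<Rightarrow> complex mat" where
  "toeplitz N f = mat (N + 1) (N + 1) (\<lambda>(k, l). fourier_coeff f (int l - int k))"

text \<open>Meant for Hermitian matrices, all of whose eigenvalues are real.\<close>

definition min_eigenvalue :: "complex mat \<Rightarrow> real" where
  "min_eigenvalue A = Min {x::real. eigenvalue A (of_real x)}"

text \<open>On the diagonal, a null set, the value is irrelevant.\<close>

definition G_kernel :: "real \<Rightarrow> real \<Rightarrow> real \<Rightarrow> real" where
  "G_kernel \<alpha> x y = 1 / (Gamma \<alpha>)\<^sup>2 * x powr \<alpha> * y powr \<alpha> *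
     (LINT t:{max x y..1}|lborel.
        (t - x) powr (\<alpha> - 1) * (t - y) powr (\<alpha> - 1) / t powr (2 * \<alpha>))"

definition G_operator :: "real \<Rightarrow> (real \<Rightarrow> complex) \<Rightarrow> (real \<Rightarrow> complex)" where
  "G_operator \<alpha> f = (\<lambda>x. LINT y:{0<..<1}|lborel. of_real (G_kernel \<alpha> x y) * f y)"

definition phi_symbol :: "real \<Rightarrow> (complex \<Rightarrow> real) \<Rightarrow> complex \<Rightarrow> complex" where
  "phi_symbol \<alpha> c z = of_real (cmod (1 - z) powr (2 * \<alpha>) * c z)"

end

theory Submission
  imports Defs
begin

text \<open>For the pure symbol \<open>|1 - z|\<^sup>2\<^sup>\<alpha>\<close> the orthogonal polynomials are explicit, which factors
  the inverse Toeplitz matrix of size \<open>n\<close> as \<open>A A\<^sup>T\<close> with a triangular matrix \<open>A\<close> of products of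
  binomial coefficients. Scaled, \<open>A\<close> converges to the kernel
  \<open>K(x,s) = x\<^sup>\<alpha> (s - x)\<^sub>+\<^sup>\<alpha>\<^sup>-\<^sup>1 s\<^sup>-\<^sup>\<alpha> / \<Gamma>(\<alpha>)\<close> in operator norm: near the diagonal both kernels
  are dominated by a multiple of \<open>|s - x|\<^sup>\<alpha>\<^sup>-\<^sup>1\<close> (Schur test), off the diagonal dominated convergence
  gives Hilbert--Schmidt convergence. As \<open>G\<^sub>\<alpha> = K K\<^sup>T\<close>, the least eigenvalue is asymptotically
  \<open>n\<^sup>-\<^sup>2\<^sup>\<alpha> / \<parallel>G\<^sub>\<alpha>\<parallel>\<close>.

  For a general \<open>c\<^sub>1\<close>, multiply an extremal polynomial of either symbol by \<open>(1 + z + \<dots> + z\<^sup>m\<^sup>-\<^sup>1) / m\<close>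
  with \<open>m = \<epsilon> n\<close>. This changes the norm by \<open>O(\<epsilon>\<^sup>2\<^sup>\<alpha>)\<close> and suppresses the energy away from \<open>z = 1\<close>
  by the factor \<open>O(m\<^sup>-\<^sup>2)\<close>, so only \<open>c\<^sub>1(1)\<close> enters the limit.\<close>

section \<open>Rayleigh quotients of Hermitian matrices\<close>

text \<open>The least eigenvalue enters as an inverse norm: if A^T T A = 1, the substitution u = A w
  turns the Rayleigh quotient of T into |w|^2 / |A w|^2, whose minimum is 1 / |A|^2. For \<alpha> <
  1/2 the kernel K is not square integrable at the diagonal, so Hilbert--Schmidt convergence alone
  cannot work; the strip around the diagonal needs a bound that is uniform in n and small with its
  width. All kernels compared are nonnegative, so their norms are taken in \<open>ennreal\<close>,
  free of integrability conditions.

  The averaging multiplier replaces regularity of the extremal polynomials, of which only the energy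
  is known. It raises the size from n to n + m, which costs a factor (1 + \<epsilon>)^(-2\<alpha>)
  by the scaling n^(-2\<alpha>). Its loss of norm is pointwise at most a multiple of m^(2\<alpha>)
  |1 - z|^(2\<alpha>), that is, of the pure weight itself, so the energy pays for it; this uses
  2\<alpha> \<le> 1. Both errors vanish when n tends to infinity first and \<epsilon> to 0
  afterwards.\<close>

definition qform :: "nat \<Rightarrow> (nat \<Rightarrow> nat \<Rightarrow> complex) \<Rightarrow> (nat \<Rightarrow> complex) \<Rightarrow> real" where
  "qform n a u = Re (\<Sum>i<n. \<Sum>j<n. cnj (u i) * a i j * u j)"

definition sqnorm :: "nat \<Rightarrow> (nat \<Rightarrow> complex) \<Rightarrow> real" where
  "sqnorm n u = (\<Sum>i<n. (cmod (u i))\<^sup>2)"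

lemma sqnorm_nonneg: "0 \<le> sqnorm n u"
  by (simp add: sqnorm_def sum_nonneg)

lemma sqnorm_eq_0_iff: "sqnorm n u = 0 \<longleftrightarrow> (\<forall>i<n. u i = 0)"
  by (auto simp: sqnorm_def sum_nonneg_eq_0_iff)

lemma cmod_le_sqrt_sqnorm: "i < n \<Longrightarrow> cmod (u i) \<le> sqrt (sqnorm n u)"
  unfolding sqnorm_def by (intro real_le_rsqrt member_le_sum) auto

lemma sqnorm_scale: "sqnorm n (\<lambda>i. c * u i) = (cmod c)\<^sup>2 * sqnorm n u"
  by (simp add: sqnorm_def norm_mult power_mult_distrib sum_distrib_left)

lemma qform_scale: "qform n a (\<lambda>i. of_real c * u i) = c\<^sup>2 * qform n a u"
proof -
  have "(\<Sum>i<n. \<Sum>j<n. cnj (of_real c * u i) * a i j * (of_real c * u j))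
      = of_real (c\<^sup>2) * (\<Sum>i<n. \<Sum>j<n. cnj (u i) * a i j * u j)"
    by (simp add: sum_distrib_left power2_eq_square mult_ac)
  then show ?thesis by (simp add: qform_def)
qed

lemma matvec_sqnorm_le:
  "sqnorm n (\<lambda>i. \<Sum>j<n. a i j * u j) \<le> (\<Sum>i<n. (\<Sum>j<n. cmod (a i j))\<^sup>2) * sqnorm n u"
proof -
  have "(cmod (\<Sum>j<n. a i j * u j))\<^sup>2 \<le> (\<Sum>j<n. cmod (a i j))\<^sup>2 * sqnorm n u" for i
  proof -
    have "cmod (\<Sum>j<n. a i j * u j) \<le> (\<Sum>j<n. cmod (a i j) * sqrt (sqnorm n u))"
      by (intro order.trans[OF norm_sum] sum_mono)
        (auto simp: norm_mult intro!: mult_left_mono cmod_le_sqrt_sqnorm)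
    then have "cmod (\<Sum>j<n. a i j * u j) \<le> (\<Sum>j<n. cmod (a i j)) * sqrt (sqnorm n u)"
      by (simp add: sum_distrib_right)
    then have "(cmod (\<Sum>j<n. a i j * u j))\<^sup>2 \<le> ((\<Sum>j<n. cmod (a i j)) * sqrt (sqnorm n u))\<^sup>2"
      by (intro power_mono) auto
    then show ?thesis by (simp add: power_mult_distrib sqnorm_nonneg)
  qed
  then show ?thesis unfolding sqnorm_def[of n "\<lambda>i. \<Sum>j<n. a i j * u j"] sum_distrib_right
    by (intro sum_mono)
qed

lemma abs_qform_le: "\<bar>qform n a u\<bar> \<le> (\<Sum>i<n. \<Sum>j<n. cmod (a i j)) * sqnorm n u"
proof -
  have "\<bar>qform n a u\<bar> \<le> cmod (\<Sum>i<n. \<Sum>j<n. cnj (u i) * a i j * u j)"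
    unfolding qform_def by (rule abs_Re_le_cmod)
  also have "\<dots> \<le> (\<Sum>i<n. \<Sum>j<n. cmod (a i j) * sqnorm n u)"
  proof (intro order.trans[OF norm_sum] sum_mono)
    fix i j assume "i \<in> {..<n}" "j \<in> {..<n}"
    then have "cmod (u i) * cmod (u j) \<le> sqrt (sqnorm n u) * sqrt (sqnorm n u)"
      by (intro mult_mono cmod_le_sqrt_sqnorm) (auto simp: sqnorm_nonneg)
    then have "cmod (a i j) * (cmod (u i) * cmod (u j)) \<le> cmod (a i j) * sqnorm n u"
      by (intro mult_left_mono) (auto simp: sqnorm_nonneg)
    then show "cmod (cnj (u i) * a i j * u j) \<le> cmod (a i j) * sqnorm n u"
      by (simp add: norm_mult mult_ac)
  qed
  finally show ?thesis by (simp add: sum_distrib_right)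
qed

text \<open>Minimising \<open>t \<mapsto> q(v - t B v)\<close> over real \<open>t\<close>.\<close>

lemma psd_matvec_sqnorm_le:
  assumes herm: "\<And>i j. i < n \<Longrightarrow> j < n \<Longrightarrow> b j i = cnj (b i j)"
    and psd: "\<And>u. 0 \<le> qform n b u"
    and C: "0 < C" "\<And>u. qform n b u \<le> C * sqnorm n u"
  shows "sqnorm n (\<lambda>i. \<Sum>j<n. b i j * v j) \<le> C * qform n b v"
proof -
  define w where "w i = (\<Sum>j<n. b i j * v j)" for i
  \<comment> \<open>With q(w) \<le> C |w|^2, the resulting upper bound q(v) - 2 t |w|^2 + t^2 C
    |w|^2 is least at this t.\<close>
  define t where "t = 1 / C"
  have S: "(\<Sum>i<n. cnj (w i) * w i) = of_real (sqnorm n w)"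
    unfolding sqnorm_def of_real_sum
    by (intro sum.cong refl) (simp add: complex_norm_square mult.commute del: of_real_power)
  have wv: "(\<Sum>i<n. \<Sum>j<n. cnj (w i) * b i j * v j) = of_real (sqnorm n w)"
  proof -
    have "(\<Sum>i<n. \<Sum>j<n. cnj (w i) * b i j * v j) = (\<Sum>i<n. cnj (w i) * (\<Sum>j<n. b i j * v j))"
      by (simp add: sum_distrib_left mult_ac)
    then show ?thesis using S by (simp add: w_def)
  qed
  have vw: "(\<Sum>i<n. \<Sum>j<n. cnj (v i) * b i j * w j) = of_real (sqnorm n w)"
  proof -
    have "(\<Sum>i<n. \<Sum>j<n. cnj (v i) * b i j * w j) = (\<Sum>j<n. \<Sum>i<n. cnj (v i) * b i j * w j)"
      by (rule sum.swap)
    also have "\<dots> = (\<Sum>j<n. \<Sum>i<n. cnj (b j i * v i) * w j)"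
    proof (intro sum.cong refl)
      fix i j assume "j \<in> {..<n}" "i \<in> {..<n}"
      then have "b j i = cnj (b i j)" by (intro herm) auto
      then show "cnj (v i) * b i j * w j = cnj (b j i * v i) * w j" by simp
    qed
    also have "\<dots> = (\<Sum>j<n. cnj (w j) * w j)"
      by (simp add: w_def sum_distrib_right)
    finally show ?thesis using S by simp
  qed
  have "(\<Sum>i<n. \<Sum>j<n. cnj (v i - of_real t * w i) * b i j * (v j - of_real t * w j))
     = (\<Sum>i<n. \<Sum>j<n. cnj (v i) * b i j * v j)
       - of_real t * (\<Sum>i<n. \<Sum>j<n. cnj (w i) * b i j * v j)
       - of_real t * (\<Sum>i<n. \<Sum>j<n. cnj (v i) * b i j * w j)
       + of_real (t\<^sup>2) * (\<Sum>i<n. \<Sum>j<n. cnj (w i) * b i j * w j)"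
    unfolding sum_distrib_left sum_subtractf[symmetric] sum.distrib[symmetric]
    by (intro sum.cong refl) (simp add: algebra_simps power2_eq_square)
  then have "qform n b (\<lambda>i. v i - of_real t * w i)
     = qform n b v - 2 * t * sqnorm n w + t\<^sup>2 * qform n b w"
    unfolding qform_def wv vw by simp
  then have "0 \<le> qform n b v - 2 * t * sqnorm n w + t\<^sup>2 * qform n b w"
    using psd by metis
  also have "t\<^sup>2 * qform n b w \<le> t\<^sup>2 * (C * sqnorm n w)"
    using C by (intro mult_left_mono) auto
  finally have "0 \<le> C * (qform n b v - 2 * t * sqnorm n w + t\<^sup>2 * (C * sqnorm n w))"
    using C by simp
  also have "\<dots> = C * qform n b v - sqnorm n w"
    using C by (simp add: t_def field_simps power2_eq_square)
  finally show ?thesis unfolding w_def by simp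
qed

text \<open>Invertibility gives M with M B = 1, and u = M (B u) is then bounded through the row sums
  of M. Only the existence of some K matters later.\<close>

lemma nonsingular_lower_bound:
  fixes b :: "nat \<Rightarrow> nat \<Rightarrow> complex"
  assumes ns: "\<And>u. \<forall>i<n. (\<Sum>j<n. b i j * u j) = 0 \<Longrightarrow> \<forall>i<n. u i = 0"
  shows "\<exists>K>0. \<forall>u. sqnorm n u \<le> K * sqnorm n (\<lambda>i. \<Sum>j<n. b i j * u j)"
proof -
  define B where "B = mat n n (\<lambda>(i,j). b i j)"
  have B: "B \<in> carrier_mat n n" by (simp add: B_def)
  have "det B \<noteq> 0"
  proof
    assume "det B = 0"
    then obtain v where v: "v \<in> carrier_vec n" "v \<noteq> 0\<^sub>v n" "B *\<^sub>v v = 0\<^sub>v n"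
      using det_0_iff_vec_prod_zero_field[OF B] by blast
    have "(\<Sum>j<n. b i j * v $ j) = 0" if "i < n" for i
    proof -
      have "(B *\<^sub>v v) $ i = (\<Sum>j<n. b i j * v $ j)"
        using that v(1) by (simp add: B_def scalar_prod_def lessThan_atLeast0)
      then show ?thesis using v(3) that by simp
    qed
    then have "\<forall>i<n. v $ i = 0" using ns by blast
    then have "v = 0\<^sub>v n" using v(1) by (intro eq_vecI) auto
    with v show False by simp
  qed
  from det_non_zero_imp_unit[OF B this, of "()"]
  obtain M where M: "M \<in> carrier_mat n n" "M * B = 1\<^sub>m n"
    by (auto simp: ring_mat_def Units_def)
  define m where "m i j = M $$ (i,j)" for i j
  have mb: "(\<Sum>k<n. m i k * b k j) = (if i = j then 1 else 0)" if "i < n" "j < n" for i j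
  proof -
    have "(M * B) $$ (i,j) = (\<Sum>k<n. m i k * b k j)"
      using that M(1) by (simp add: B_def scalar_prod_def lessThan_atLeast0 m_def)
    then show ?thesis unfolding M(2) using that by simp
  qed
  define K where "K = (\<Sum>i<n. (\<Sum>j<n. cmod (m i j))\<^sup>2) + 1"
  have "sqnorm n u \<le> K * sqnorm n (\<lambda>i. \<Sum>j<n. b i j * u j)" for u
  proof -
    have "(\<Sum>k<n. m i k * (\<Sum>j<n. b k j * u j)) = u i" if "i < n" for i
    proof -
      have "(\<Sum>k<n. m i k * (\<Sum>j<n. b k j * u j)) = (\<Sum>k<n. \<Sum>j<n. m i k * b k j * u j)"
        by (simp add: sum_distrib_left mult_ac)
      also have "\<dots> = (\<Sum>j<n. (\<Sum>k<n. m i k * b k j) * u j)"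
        by (subst sum.swap) (simp add: sum_distrib_right)
      also have "\<dots> = (\<Sum>j<n. (if i = j then 1 else 0) * u j)"
        using that mb by (intro sum.cong) auto
      also have "\<dots> = (\<Sum>j<n. if i = j then u j else 0)"
        by (intro sum.cong) auto
      also have "\<dots> = u i" using that by (simp add: sum.delta)
      finally show ?thesis .
    qed
    then have "sqnorm n u = sqnorm n (\<lambda>i. \<Sum>k<n. m i k * (\<Sum>j<n. b k j * u j))"
      by (simp add: sqnorm_def)
    also have "\<dots> \<le> (K - 1) * sqnorm n (\<lambda>i. \<Sum>j<n. b i j * u j)"
      unfolding K_def using matvec_sqnorm_le[of n m] by simp
    also have "\<dots> \<le> K * sqnorm n (\<lambda>i. \<Sum>j<n. b i j * u j)"
      by (intro mult_right_mono) (auto simp: sqnorm_nonneg)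
    finally show ?thesis .
  qed
  moreover have "K > 0" unfolding K_def by (intro add_nonneg_pos sum_nonneg) auto
  ultimately show ?thesis by blast
qed

text \<open>The infimum \<open>\<rho>\<close> of the Rayleigh quotient is an eigenvalue: otherwise \<open>A - \<rho>\<close> would be
  invertible, and a positive semidefinite invertible form is bounded below.\<close>

lemma hermitian_min_rayleigh:
  fixes a :: "nat \<Rightarrow> nat \<Rightarrow> complex"
  assumes n: "0 < n" and herm: "\<And>i j. i < n \<Longrightarrow> j < n \<Longrightarrow> a j i = cnj (a i j)"
  shows "\<exists>\<rho>. (\<forall>u. \<rho> * sqnorm n u \<le> qform n a u) \<and>
    (\<exists>u. (\<exists>i<n. u i \<noteq> 0) \<and> (\<forall>i<n. (\<Sum>j<n. a i j * u j) = of_real \<rho> * u i))"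
proof -
  define R where "R = {qform n a u | u. sqnorm n u = 1}"
  define C0 where "C0 = (\<Sum>i<n. \<Sum>j<n. cmod (a i j))"
  define \<rho> where "\<rho> = Inf R"
  have bdd: "bdd_below R"
  proof (rule bdd_belowI)
    fix x assume "x \<in> R"
    then obtain u where "x = qform n a u" "sqnorm n u = 1" by (auto simp: R_def)
    with abs_qform_le[of n a u] show "- C0 \<le> x" by (simp add: C0_def)
  qed
  have "sqnorm n (\<lambda>i. if i = 0 then 1 else 0) = (\<Sum>i<n. if i = 0 then 1 else 0)"
    unfolding sqnorm_def by (intro sum.cong) auto
  then have "sqnorm n (\<lambda>i. if i = 0 then 1 else 0) = 1" using n by simp
  then have ne: "R \<noteq> {}" unfolding R_def by blast
  have lower: "x * sqnorm n u \<le> qform n a u" if x: "\<And>r. r \<in> R \<Longrightarrow> x \<le> r" for x u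
  proof (cases "sqnorm n u = 0")
    case True
    then have "qform n a u = 0" using abs_qform_le[of n a u] by simp
    with True show ?thesis by simp
  next
    case False
    then have pos: "sqnorm n u > 0" using sqnorm_nonneg[of n u] by simp
    define c where "c = 1 / sqrt (sqnorm n u)"
    have c2: "c\<^sup>2 = 1 / sqnorm n u" using pos by (simp add: c_def power_divide)
    have "sqnorm n (\<lambda>i. of_real c * u i) = 1"
      unfolding sqnorm_scale using c2 pos by simp
    then have "qform n a (\<lambda>i. of_real c * u i) \<in> R" unfolding R_def by blast
    from x[OF this] have "x \<le> qform n a u / sqnorm n u" by (simp add: qform_scale c2)
    then show ?thesis using pos by (simp add: field_simps)
  qed
  have lower\<rho>: "\<rho> * sqnorm n u \<le> qform n a u" for u
    by (rule lower) (auto simp: \<rho>_def intro: cInf_lower bdd)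
  define b where "b i j = a i j - (if i = j then of_real \<rho> else 0)" for i j
  have bsum: "(\<Sum>j<n. b i j * u j) = (\<Sum>j<n. a i j * u j) - of_real \<rho> * u i" if "i < n" for i u
  proof -
    have "(\<Sum>j<n. b i j * u j) = (\<Sum>j<n. a i j * u j) - (\<Sum>j<n. if i = j then of_real \<rho> * u j else 0)"
      unfolding b_def sum_subtractf[symmetric] by (intro sum.cong) (auto simp: algebra_simps)
    then show ?thesis using that by (simp add: sum.delta)
  qed
  have qb: "qform n b u = qform n a u - \<rho> * sqnorm n u" for u
  proof -
    have "(\<Sum>i<n. \<Sum>j<n. cnj (u i) * b i j * u j) = (\<Sum>i<n. cnj (u i) * (\<Sum>j<n. b i j * u j))"
      by (simp add: sum_distrib_left mult_ac)
    also have "\<dots> = (\<Sum>i<n. cnj (u i) * ((\<Sum>j<n. a i j * u j) - of_real \<rho> * u i))"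
      by (intro sum.cong) (auto simp: bsum)
    also have "\<dots> = (\<Sum>i<n. \<Sum>j<n. cnj (u i) * a i j * u j) - (\<Sum>i<n. of_real (\<rho> * (cmod (u i))\<^sup>2))"
      by (simp add: algebra_simps sum_subtractf sum_distrib_left complex_norm_square del: of_real_power)
    finally show ?thesis by (simp add: qform_def sqnorm_def sum_distrib_left)
  qed
  have "\<exists>u. (\<forall>i<n. (\<Sum>j<n. b i j * u j) = 0) \<and> \<not> (\<forall>i<n. u i = 0)"
  proof (rule ccontr)
    assume "\<not> ?thesis"
    then obtain K where K: "K > 0" "\<And>u. sqnorm n u \<le> K * sqnorm n (\<lambda>i. \<Sum>j<n. b i j * u j)"
      using nonsingular_lower_bound[of n b] by blast
    define C where "C = (\<Sum>i<n. \<Sum>j<n. cmod (b i j)) + 1"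
    have C: "C > 0" unfolding C_def by (intro add_nonneg_pos sum_nonneg) auto
    have Cb: "qform n b u \<le> C * sqnorm n u" for u
    proof -
      have "qform n b u \<le> (C - 1) * sqnorm n u" using abs_qform_le[of n b u] by (simp add: C_def)
      also have "\<dots> \<le> C * sqnorm n u" by (intro mult_right_mono) (auto simp: sqnorm_nonneg)
      finally show ?thesis .
    qed
    \<comment> \<open>On the unit sphere 1 \<le> K |B u|^2 \<le> K C (q(u) - \<rho>), so no value in
      R comes closer to \<rho> than 1 / (K C), against the choice of \<rho> as infimum.\<close>
    have low: "1 / (K * C) + \<rho> \<le> r" if "r \<in> R" for r
    proof -
      obtain u where u: "r = qform n a u" "sqnorm n u = 1"
        using \<open>r \<in> R\<close> by (auto simp: R_def)
      have "1 \<le> K * sqnorm n (\<lambda>i. \<Sum>j<n. b i j * u j)" using K(2)[of u] u by simp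
      also have "\<dots> \<le> K * (C * qform n b u)"
      proof (intro mult_left_mono psd_matvec_sqnorm_le C Cb)
        show "b j i = cnj (b i j)" if ij: "i < n" "j < n" for i j
          using herm[OF ij] by (simp add: b_def)
        show "0 \<le> qform n b u" for u using lower\<rho>[of u] by (simp add: qb)
      qed (use K in auto)
      finally show ?thesis using K C u by (simp add: qb field_simps)
    qed
    then have "1 / (K * C) + \<rho> \<le> \<rho>" unfolding \<rho>_def using ne by (intro cInf_greatest) (auto simp: \<rho>_def)
    with K C show False by (simp add: field_simps)
  qed
  then obtain u where u: "\<forall>i<n. (\<Sum>j<n. b i j * u j) = 0" "\<exists>i<n. u i \<noteq> 0" by blast
  with lower\<rho> show ?thesis using bsum by (intro exI[of _ \<rho>]) auto
qed

text \<open>\<open>min_eigenvalue\<close> is a \<open>Min\<close> and says nothing unless the set of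
  real eigenvalues is finite and nonempty. Finiteness comes from the roots of the characteristic
  polynomial, nonemptiness from the attained infimum \<rho> of the Rayleigh quotient; every real
  eigenvalue is itself a Rayleigh quotient, hence at least \<rho>.\<close>

lemma min_eigenvalue_rayleigh:
  fixes a :: "nat \<Rightarrow> nat \<Rightarrow> complex"
  assumes n: "0 < n" and herm: "\<And>i j. i < n \<Longrightarrow> j < n \<Longrightarrow> a j i = cnj (a i j)"
  defines "\<mu> \<equiv> min_eigenvalue (mat n n (\<lambda>(i,j). a i j))"
  shows "\<mu> * sqnorm n u \<le> qform n a u"
    and "\<exists>u. sqnorm n u = 1 \<and> qform n a u = \<mu>"
proof -
  define A where "A = mat n n (\<lambda>(i,j). a i j)"
  have A: "A \<in> carrier_mat n n" by (simp add: A_def)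
  have mv: "(A *\<^sub>v v) $ i = (\<Sum>j<n. a i j * v $ j)" if "i < n" "v \<in> carrier_vec n" for i v
    using that by (simp add: A_def scalar_prod_def lessThan_atLeast0)
  have eig: "eigenvalue A x \<longleftrightarrow> (\<exists>u. (\<exists>i<n. u i \<noteq> 0) \<and> (\<forall>i<n. (\<Sum>j<n. a i j * u j) = x * u i))" for x
  proof
    assume "eigenvalue A x"
    then obtain v where v: "v \<in> carrier_vec n" "v \<noteq> 0\<^sub>v n" "A *\<^sub>v v = x \<cdot>\<^sub>v v"
      using A by (auto simp: eigenvalue_def eigenvector_def)
    have "\<exists>i<n. v $ i \<noteq> 0" using v(1,2) by (metis carrier_vecD eq_vecI index_zero_vec)
    moreover have "(\<Sum>j<n. a i j * v $ j) = x * v $ i" if "i < n" for i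
      using mv[OF that v(1)] v that by simp
    ultimately show "\<exists>u. (\<exists>i<n. u i \<noteq> 0) \<and> (\<forall>i<n. (\<Sum>j<n. a i j * u j) = x * u i)"
      by (intro exI[of _ "\<lambda>i. v $ i"]) auto
  next
    assume "\<exists>u. (\<exists>i<n. u i \<noteq> 0) \<and> (\<forall>i<n. (\<Sum>j<n. a i j * u j) = x * u i)"
    then obtain u where u: "\<exists>i<n. u i \<noteq> 0" "\<And>i. i < n \<Longrightarrow> (\<Sum>j<n. a i j * u j) = x * u i" by blast
    define v where "v = vec n u"
    have v: "v \<in> carrier_vec n" by (simp add: v_def)
    have "v \<noteq> 0\<^sub>v n" using u(1) by (auto simp: v_def vec_eq_iff)
    moreover have "A *\<^sub>v v = x \<cdot>\<^sub>v v"
    proof (rule eq_vecI)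
      show "(A *\<^sub>v v) $ i = (x \<cdot>\<^sub>v v) $ i" if "i < dim_vec (x \<cdot>\<^sub>v v)" for i
        using that mv[OF _ v, of i] u(2)[of i] by (simp add: v_def)
    qed (use A v in auto)
    ultimately show "eigenvalue A x" using A v by (auto simp: eigenvalue_def eigenvector_def)
  qed
  have qeig: "qform n a u = x * sqnorm n u"
    if "\<forall>i<n. (\<Sum>j<n. a i j * u j) = of_real x * u i" for u x
  proof -
    have "(\<Sum>i<n. \<Sum>j<n. cnj (u i) * a i j * u j) = (\<Sum>i<n. cnj (u i) * (\<Sum>j<n. a i j * u j))"
      by (simp add: sum_distrib_left mult_ac)
    also have "\<dots> = (\<Sum>i<n. of_real (x * (cmod (u i))\<^sup>2))"
      using that by (intro sum.cong) (auto simp: complex_norm_square mult_ac simp del: of_real_power)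
    finally show ?thesis by (simp add: qform_def sqnorm_def sum_distrib_left)
  qed
  from hermitian_min_rayleigh[of n a, OF n herm] obtain \<rho> w where
    \<rho>: "\<And>u. \<rho> * sqnorm n u \<le> qform n a u" and w: "\<exists>i<n. w i \<noteq> 0"
      "\<forall>i<n. (\<Sum>j<n. a i j * w j) = of_real \<rho> * w i" by blast
  define E where "E = {x::real. eigenvalue A (of_real x)}"
  have "finite {x. poly (char_poly A) x = 0}"
    using degree_monic_char_poly[OF A] by (intro poly_roots_finite) auto
  then have "finite E" unfolding E_def eigenvalue_root_char_poly[OF A]
    using finite_vimageI[of "{x. poly (char_poly A) x = 0}" "of_real :: real \<Rightarrow> complex"]
    by (simp add: vimage_def inj_on_def)
  moreover have "\<rho> \<in> E" using w by (auto simp: E_def eig)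
  moreover have "\<rho> \<le> x" if "x \<in> E" for x
  proof -
    obtain u where u: "\<exists>i<n. u i \<noteq> 0" "\<forall>i<n. (\<Sum>j<n. a i j * u j) = of_real x * u i"
      using \<open>x \<in> E\<close> by (auto simp: E_def eig)
    have "sqnorm n u > 0" using u(1) sqnorm_eq_0_iff[of n u] sqnorm_nonneg[of n u] by force
    with \<rho>[of u] qeig[OF u(2)] show ?thesis by simp
  qed
  ultimately have \<mu>: "\<mu> = \<rho>" unfolding \<mu>_def min_eigenvalue_def A_def[symmetric] E_def[symmetric]
    by (intro Min_eqI) auto
  show "\<mu> * sqnorm n u \<le> qform n a u" using \<rho> \<mu> by simp
  have pos: "sqnorm n w > 0" using w(1) sqnorm_eq_0_iff[of n w] sqnorm_nonneg[of n w] by force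
  define c where "c = 1 / sqrt (sqnorm n w)"
  have c2: "c\<^sup>2 = 1 / sqnorm n w" using pos by (simp add: c_def power_divide)
  have "sqnorm n (\<lambda>i. of_real c * w i) = 1" "qform n a (\<lambda>i. of_real c * w i) = \<mu>"
    unfolding sqnorm_scale qform_scale qeig[OF w(2)] using c2 pos \<mu> by auto
  then show "\<exists>u. sqnorm n u = 1 \<and> qform n a u = \<mu>" by blast
qed

section \<open>Fourier coefficients of the pure symbol\<close>

lemma norm_one_minus_exp: "cmod (1 - exp (\<i> * of_real t)) = 2 * \<bar>sin (t / 2)\<bar>"
proof (rule power2_eq_imp_eq)
  have "cos t = 1 - 2 * (sin (t / 2))\<^sup>2" using cos_double_sin[of "t / 2"] by simp
  moreover have "(cmod (1 - exp (\<i> * of_real t)))\<^sup>2 = (1 - cos t)\<^sup>2 + (sin t)\<^sup>2"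
    unfolding cis_conv_exp[symmetric] by (simp add: cmod_power2)
  moreover have "(1 - cos t)\<^sup>2 + (sin t)\<^sup>2 = 2 - 2 * cos t"
    using sin_cos_squared_add[of t] by (simp add: power2_diff)
  ultimately show "(cmod (1 - exp (\<i> * of_real t)))\<^sup>2 = (2 * \<bar>sin (t / 2)\<bar>)\<^sup>2"
    by (simp add: power_mult_distrib)
qed auto

lemma norm_one_minus_exp_powr:
  assumes "t \<in> {0..2*pi}"
  shows "cmod (1 - exp (\<i> * of_real t)) powr b = (2 * sin (t / 2)) powr b"
proof -
  have "0 \<le> sin (t / 2)" using assms by (intro sin_ge_zero) auto
  then show ?thesis by (simp add: norm_one_minus_exp)
qed

definition pure_moment :: "real \<Rightarrow> int \<Rightarrow> complex" where
  "pure_moment \<alpha> n =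
     (LINT t:{0..2*pi}|lborel. of_real ((2 * sin (t / 2)) powr (2 * \<alpha>)) * exp (\<i> * of_int n * of_real t))"

lemma fourier_coeff_pure:
  "fourier_coeff (phi_symbol \<alpha> (\<lambda>_. 1)) n = pure_moment \<alpha> (- n) / (2 * of_real pi)"
  unfolding fourier_coeff_def pure_moment_def phi_symbol_def
  by (intro arg_cong2[where f = "(/)"] set_lebesgue_integral_cong)
    (auto simp: norm_one_minus_exp_powr)

lemma continuous_on_sin_powr:
  "0 < \<alpha> \<Longrightarrow> continuous_on {0..2*pi} (\<lambda>t. (2 * sin (t / 2)) powr (2 * \<alpha>))"
  by (intro continuous_on_powr' continuous_intros) (auto intro!: sin_ge_zero)

lemma pure_moment_integrable:
  assumes "0 < \<alpha>"
  shows "set_integrable lborel {0..2*pi}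
    (\<lambda>t. of_real ((2 * sin (t / 2)) powr (2 * \<alpha>)) * exp (\<i> * of_int n * of_real t))"
  by (intro borel_integrable_atLeastAtMost' continuous_intros continuous_on_sin_powr assms)

text \<open>The function W(t) (e^(int) - e^(i(n+1)t)) vanishes at both ends, so its derivative has
  integral 0. Differentiating W brings in the factor \<alpha> cot(t/2), whose pole is removed by 1 -
  e^(it), because (1 - e^(it)) cot(t/2) = -i (1 + e^(it)).\<close>

lemma pure_moment_rec:
  assumes \<alpha>: "0 < \<alpha>"
  shows "of_real (of_int n + 1 + \<alpha>) * pure_moment \<alpha> (n + 1) = of_real (of_int n - \<alpha>) * pure_moment \<alpha> n"
proof -
  define W where "W t = (2 * sin (t / 2)) powr (2 * \<alpha>)" for t
  define e where "e k t = exp (\<i> * of_int k * of_real t)" for k :: int and t :: real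
  define g where "g t = of_real (W t) * (e n t - e (n + 1) t)" for t
  define g' where "g' t = \<i> * (of_real (of_int n - \<alpha>) * (of_real (W t) * e n t)
      - of_real (of_int n + 1 + \<alpha>) * (of_real (W t) * e (n + 1) t))" for t
  have e: "(e k has_vector_derivative \<i> * of_int k * e k t) (at t)" for k t
    unfolding e_def by (auto intro!: derivative_eq_intros has_vector_derivative_real_field)
  have W: "continuous_on {0..2*pi} W" unfolding W_def using continuous_on_sin_powr[OF \<alpha>] .
  have dW: "(W has_real_derivative W t * \<alpha> * cos (t / 2) / sin (t / 2)) (at t)" if "t \<in> {0<..<2*pi}" for t
  proof -
    have s: "sin (t / 2) > 0" using that by (intro sin_gt_zero) auto
    have "((\<lambda>t. 2 * sin (t / 2)) has_real_derivative cos (t / 2)) (at t)"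
      by (auto intro!: derivative_eq_intros)
    from DERIV_chain2[OF has_real_derivative_powr this, of "2 * \<alpha>"] s
    show ?thesis unfolding W_def by (simp add: powr_diff mult_ac)
  qed
  \<comment> \<open>Derivatives are needed in the open interval only; at the ends \<open>W\<close>
    is merely continuous when 2\<alpha> < 1.\<close>
  have "(g' has_integral (g (2*pi) - g 0)) {0..2*pi}"
  proof (rule fundamental_theorem_of_calculus_interior_strong[of "{}"])
    show "continuous_on {0..2*pi} g" unfolding g_def e_def by (intro continuous_intros W)
    fix t assume "t \<in> {0<..<2*pi} - {}"
    then have t: "t \<in> {0<..<2*pi}" by simp
    have s: "sin (t / 2) > 0" using t by (intro sin_gt_zero) auto
    define h where "h = exp (\<i> * of_real (t / 2))"
    have e1: "e (n + 1) t = e n t * h\<^sup>2"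
      unfolding e_def h_def by (simp add: exp_add[symmetric] exp_double[symmetric] algebra_simps)
    have cs: "of_real (cos (t/2)) * (1 - h\<^sup>2) = - \<i> * of_real (sin (t/2)) * (1 + h\<^sup>2)"
    proof -
      have h: "h = of_real (cos (t/2)) + \<i> * of_real (sin (t/2))"
        unfolding h_def cis_conv_exp[symmetric] by (simp add: complex_eq_iff)
      have c: "(of_real (cos (t/2)))\<^sup>2 + (of_real (sin (t/2)))\<^sup>2 = (1::complex)"
        by (metis of_real_1 of_real_add of_real_power sin_cos_squared_add2)
      define C S where "C = complex_of_real (cos (t/2))" and "S = complex_of_real (sin (t/2))"
      have c: "1 = C\<^sup>2 + S\<^sup>2" using c by (simp add: C_def S_def)
      have "h\<^sup>2 = C\<^sup>2 - S\<^sup>2 + 2 * \<i> * C * S"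
        unfolding h C_def[symmetric] S_def[symmetric] by (simp add: power2_eq_square algebra_simps)
      then have D: "1 - h\<^sup>2 = 2 * S * (S - \<i> * C)" and E: "1 + h\<^sup>2 = 2 * C * (C + \<i> * S)"
        by (simp_all only: c) (simp_all add: power2_eq_square algebra_simps)
      show ?thesis unfolding C_def[symmetric] S_def[symmetric] D E by (simp add: algebra_simps)
    qed
    have "of_real (\<alpha> * cos (t/2) / sin (t/2)) * (1 - h\<^sup>2) = - \<i> * of_real \<alpha> * (1 + h\<^sup>2)"
    proof -
      have "of_real (\<alpha> * cos (t/2) / sin (t/2)) * (1 - h\<^sup>2)
          = of_real (\<alpha> / sin (t/2)) * (of_real (cos (t/2)) * (1 - h\<^sup>2))"
        by (simp add: field_simps)
      also have "\<dots> = - \<i> * of_real \<alpha> * (1 + h\<^sup>2)"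
        unfolding cs using s by (simp add: field_simps)
      finally show ?thesis .
    qed
    then have eq: "of_real (\<alpha> * cos (t/2) / sin (t/2)) * (e n t - e (n + 1) t)
        = - \<i> * of_real \<alpha> * (e n t + e (n + 1) t)"
    proof -
      assume *: "of_real (\<alpha> * cos (t/2) / sin (t/2)) * (1 - h\<^sup>2) = - \<i> * of_real \<alpha> * (1 + h\<^sup>2)"
      have "of_real (\<alpha> * cos (t/2) / sin (t/2)) * (e n t - e n t * h\<^sup>2)
          = e n t * (of_real (\<alpha> * cos (t/2) / sin (t/2)) * (1 - h\<^sup>2))"
        by (simp add: algebra_simps)
      also have "\<dots> = - \<i> * of_real \<alpha> * (e n t + e n t * h\<^sup>2)"
        unfolding * by (simp add: algebra_simps)
      finally show ?thesis unfolding e1 .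
    qed
    have "(g has_vector_derivative
        (W t * \<alpha> * cos (t / 2) / sin (t / 2)) *\<^sub>R (e n t - e (n + 1) t)
        + W t *\<^sub>R (\<i> * of_int n * e n t - \<i> * of_int (n + 1) * e (n + 1) t)) (at t)"
      unfolding g_def scaleR_conv_of_real[symmetric]
      by (rule has_vector_derivative_eq_rhs[OF has_vector_derivative_scaleR[OF dW[OF t] has_vector_derivative_diff[OF e e]]])
        simp
    moreover have "(W t * \<alpha> * cos (t / 2) / sin (t / 2)) *\<^sub>R (e n t - e (n + 1) t)
        = of_real (W t) * (of_real (\<alpha> * cos (t/2) / sin (t/2)) * (e n t - e (n + 1) t))"
      by (simp add: scaleR_conv_of_real)
    moreover have "of_real (W t) * (- \<i> * of_real \<alpha> * (e n t + e (n + 1) t))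
        + W t *\<^sub>R (\<i> * of_int n * e n t - \<i> * of_int (n + 1) * e (n + 1) t) = g' t"
      by (simp add: g'_def scaleR_conv_of_real algebra_simps)
    ultimately show "(g has_vector_derivative g' t) (at t)"
      by (simp only: eq)
  qed auto
  moreover have "g (2*pi) = 0" "g 0 = 0" by (simp_all add: g_def W_def)
  ultimately have "(g' has_integral 0) {0..2*pi}" by simp
  then have i0: "integral {0..2*pi} g' = 0" by (rule integral_unique)
  have "continuous_on {0..2*pi} g'" unfolding g'_def e_def by (intro continuous_intros W)
  then have "set_integrable lborel {0..2*pi} g'" by (rule borel_integrable_atLeastAtMost')
  then have "(LINT t:{0..2*pi}|lborel. g' t) = 0" using set_borel_integral_eq_integral(2) i0 by metis
  moreover have "(LINT t:{0..2*pi}|lborel. g' t) =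
     \<i> * (of_real (of_int n - \<alpha>) * pure_moment \<alpha> n - of_real (of_int n + 1 + \<alpha>) * pure_moment \<alpha> (n + 1))"
    unfolding g'_def pure_moment_def W_def e_def
    using pure_moment_integrable[OF \<alpha>, of n] pure_moment_integrable[OF \<alpha>, of "n + 1"]
    by (simp add: set_integral_diff)
  ultimately show ?thesis by simp
qed

text \<open>A Beta integral in disguise: the substitution s = sin^2(t/4) turns s^(\<alpha>-1/2)
  (1-s)^(\<alpha>-1/2) ds into a constant multiple of W(t) dt, and Legendre's duplication formula
  removes \<Gamma>(\<alpha> + 1/2).\<close>

lemma pure_moment_0:
  assumes \<alpha>: "0 < \<alpha>"
  shows "pure_moment \<alpha> 0 = of_real (2 * pi * Gamma (1 + 2 * \<alpha>) / (Gamma (1 + \<alpha>))\<^sup>2)"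
proof -
  define f where "f t = t powr (\<alpha> + 1/2 - 1) * (1 - t) powr (\<alpha> + 1/2 - 1)" for t :: real
  \<comment> \<open>This is sin^2(t/4), so that g (1 - g) = (sin(t/2) / 2)^2 and g' = sin(t/2) /
    4.\<close>
  define g where "g t = (1 - cos (t / 2)) / 2" for t :: real
  have ends: "g 0 = 0" "g (2*pi) = 1" by (simp_all add: g_def)
  have int: "set_integrable lborel {0..1} f" unfolding f_def
    by (rule integrable_Beta) (use \<alpha> in auto)
  have B: "(LINT t:{0..1}|lborel. f t) = Beta (\<alpha> + 1/2) (\<alpha> + 1/2)"
  proof -
    have "(f has_integral Beta (\<alpha> + 1/2) (\<alpha> + 1/2)) {0..1}"
      unfolding f_def by (rule has_integral_Beta_real) (use \<alpha> in auto)
    then show ?thesis using set_borel_integral_eq_integral(2)[OF int] by (simp add: integral_unique)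
  qed
  have "(LINT x|lborel. f x * indicator {g 0..g (2*pi)} x)
      = (LINT x|lborel. f (g x) * (sin (x / 2) / 4) * indicator {0..2*pi} x)"
    by (rule integral_substitution(2))
      (use int in \<open>auto simp: ends g_def intro!: derivative_eq_intros continuous_intros sin_ge_zero\<close>)
  then have sub: "Beta (\<alpha> + 1/2) (\<alpha> + 1/2) = (LINT x:{0..2*pi}|lborel. f (g x) * (sin (x / 2) / 4))"
    using B unfolding ends set_lebesgue_integral_def by (simp only: mult.commute real_scaleR_def)
  have pt: "(2 * sin (x / 2)) powr (2 * \<alpha>) = 2 * 16 powr \<alpha> * (f (g x) * (sin (x / 2) / 4))"
    if "x \<in> {0..2*pi}" for x
  proof (cases "sin (x / 2) = 0")
    case True
    then show ?thesis by simp
  next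
    case False
    moreover have "0 \<le> sin (x / 2)" using that by (intro sin_ge_zero) auto
    ultimately have s: "0 < sin (x / 2)" by simp
    have "g x * (1 - g x) = (sin (x / 2) / 2)\<^sup>2"
    proof -
      have "g x * (1 - g x) = (1 - (cos (x / 2))\<^sup>2) / 4"
        by (simp add: g_def field_simps power2_eq_square)
      then show ?thesis by (simp add: sin_squared_eq power_divide)
    qed
    moreover have "0 \<le> g x" "0 \<le> 1 - g x" by (simp_all add: g_def)
    ultimately have "f (g x) = ((sin (x / 2) / 2)\<^sup>2) powr (\<alpha> - 1/2)"
      unfolding f_def using powr_mult[of "g x" "1 - g x" "\<alpha> - 1/2"] by simp
    also have "\<dots> = (sin (x / 2) / 2) powr (2 * \<alpha> - 1)"
    proof -
      have "(sin (x / 2) / 2)\<^sup>2 = (sin (x / 2) / 2) powr 2" using s by simp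
      then show ?thesis by (simp only: powr_powr) (simp add: algebra_simps)
    qed
    also have "\<dots> = (sin (x / 2) / 2) powr (2 * \<alpha>) / (sin (x / 2) / 2)"
      using s by (simp add: powr_diff)
    also have "(sin (x / 2) / 2) powr (2 * \<alpha>) = (2 * sin (x / 2)) powr (2 * \<alpha>) / 16 powr \<alpha>"
    proof -
      have "(4::real) powr (2 * \<alpha>) = (4 powr 2) powr \<alpha>" by (simp only: powr_powr)
      then have "(16::real) powr \<alpha> = 4 powr (2 * \<alpha>)" by simp
      moreover have "2 * sin (x / 2) = 4 * (sin (x / 2) / 2)" by simp
      then have "(2 * sin (x / 2)) powr (2 * \<alpha>) = 4 powr (2 * \<alpha>) * (sin (x / 2) / 2) powr (2 * \<alpha>)"
        using s powr_mult[of 4 "sin (x / 2) / 2" "2 * \<alpha>"] by simp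
      ultimately show ?thesis by simp
    qed
    finally have "f (g x) = (2 * sin (x / 2)) powr (2 * \<alpha>) / 16 powr \<alpha> / (sin (x / 2) / 2)" .
    then show ?thesis using s by (simp add: field_simps)
  qed
  have "pure_moment \<alpha> 0 = of_real (LINT x:{0..2*pi}|lborel. (2 * sin (x / 2)) powr (2 * \<alpha>))"
    by (simp add: pure_moment_def set_integral_complex_of_real)
  also have "(LINT x:{0..2*pi}|lborel. (2 * sin (x / 2)) powr (2 * \<alpha>))
      = (LINT x:{0..2*pi}|lborel. 2 * 16 powr \<alpha> * (f (g x) * (sin (x / 2) / 4)))"
    by (intro set_lebesgue_integral_cong) (auto simp: pt)
  also have "\<dots> = 2 * 16 powr \<alpha> * Beta (\<alpha> + 1/2) (\<alpha> + 1/2)"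
    unfolding sub by (simp only: set_integral_mult_right)
  also have "\<dots> = 2 * pi * Gamma (1 + 2 * \<alpha>) / (Gamma (1 + \<alpha>))\<^sup>2"
  proof -
    define G1 G2 G3 where "G1 = Gamma (\<alpha> + 1/2)" and "G2 = Gamma (1 + \<alpha>)" and "G3 = Gamma (1 + 2 * \<alpha>)"
    have pos: "G1 > 0" "G2 > 0" "G3 > 0" using \<alpha> by (simp_all add: G1_def G2_def G3_def)
    have np: "complex_of_real x \<notin> \<int>\<^sub>\<le>\<^sub>0" if "x > 0" for x
      using that by (auto elim!: nonpos_Ints_cases simp: complex_eq_iff)
    have dup: "Gamma (of_real (\<alpha> + 1/2)) * Gamma (of_real (\<alpha> + 1/2) + 1/2) =
        exp ((1 - 2 * of_real (\<alpha> + 1/2)) * of_real (ln 2)) * of_real (sqrt pi) * Gamma (2 * complex_of_real (\<alpha> + 1/2))"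
      by (rule Gamma_legendre_duplication) (use np[of "\<alpha> + 1/2"] np[of "\<alpha> + 1"] \<alpha> in \<open>simp_all add: add.assoc\<close>)
    have "of_real (\<alpha> + 1/2) + 1/2 = complex_of_real (1 + \<alpha>)"
      "2 * complex_of_real (\<alpha> + 1/2) = of_real (1 + 2 * \<alpha>)"
      "(1 - of_real (1 + 2 * \<alpha>)) * of_real (ln 2) = complex_of_real (- 2 * \<alpha> * ln 2)"
      by simp_all
    from dup[unfolded this(1,2) this(3) Gamma_complex_of_real exp_of_real]
    have "complex_of_real (G1 * G2) = of_real (exp (- 2 * \<alpha> * ln 2) * sqrt pi * G3)"
      unfolding G1_def G2_def G3_def by (simp only: of_real_mult)
    then have d: "G1 * G2 = 2 powr (- 2 * \<alpha>) * sqrt pi * G3"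
      unfolding of_real_eq_iff by (simp add: powr_def)
    have p: "(16::real) powr \<alpha> * (2 powr (- 2 * \<alpha>))\<^sup>2 = 1"
    proof -
      have "(2::real) powr (4 * \<alpha>) = (2 powr 4) powr \<alpha>" by (simp only: powr_powr)
      then have "(16::real) powr \<alpha> = 2 powr (4 * \<alpha>)" by simp
      then show ?thesis by (simp add: power2_eq_square powr_add[symmetric])
    qed
    have "2 * 16 powr \<alpha> * Beta (\<alpha> + 1/2) (\<alpha> + 1/2) = 2 * 16 powr \<alpha> * G1\<^sup>2 / G3"
      by (simp add: Beta_def G1_def G3_def power2_eq_square algebra_simps)
    also have "\<dots> = 2 * 16 powr \<alpha> * (G1 * G2)\<^sup>2 / (G3 * G2\<^sup>2)"
      using pos by (simp add: field_simps power_mult_distrib)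
    also have "\<dots> = 2 * (16 powr \<alpha> * (2 powr (- 2 * \<alpha>))\<^sup>2) * pi * G3\<^sup>2 / (G3 * G2\<^sup>2)"
      unfolding d by (simp add: power_mult_distrib)
    also have "\<dots> = 2 * pi * G3 / G2\<^sup>2"
      unfolding p using pos by (simp add: power2_eq_square)
    finally show ?thesis by (simp add: G2_def G3_def)
  qed
  finally show ?thesis .
qed

section \<open>Orthogonal polynomials and the Cholesky factor of the inverse\<close>

text \<open>Equal to (-1)^j \<Gamma>(1+2\<alpha>) / (\<Gamma>(1+\<alpha>-j) \<Gamma>(1+\<alpha>+j))
  for 0 < \<alpha> < 1; in Pochhammer form the symmetry in j and the two-term recurrence can be read
  off.\<close>

definition pure_coeff :: "real \<Rightarrow> int \<Rightarrow> real" where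
  "pure_coeff \<alpha> j = Gamma (1 + 2 * \<alpha>) / (Gamma (1 + \<alpha>))\<^sup>2 *
     pochhammer (- \<alpha>) (nat \<bar>j\<bar>) / pochhammer (1 + \<alpha>) (nat \<bar>j\<bar>)"

lemma pure_coeff_uminus [simp]: "pure_coeff \<alpha> (- j) = pure_coeff \<alpha> j"
  by (simp add: pure_coeff_def)

lemma pure_coeff_Suc:
  assumes "0 < \<alpha>"
  shows "(real k + 1 + \<alpha>) * pure_coeff \<alpha> (int (Suc k)) = (real k - \<alpha>) * pure_coeff \<alpha> (int k)"
proof -
  have "1 + \<alpha> + real k \<noteq> 0" using assms by simp
  moreover have "nat \<bar>int (Suc k)\<bar> = Suc k" by simp
  ultimately show ?thesis
    unfolding pure_coeff_def by (simp only: pochhammer_Suc) (simp add: add_ac mult_ac)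
qed

text \<open>For n = -(k+1) the recurrence is the one for k with its sides exchanged and the signs
  changed.\<close>

lemma pure_coeff_rec:
  assumes "0 < \<alpha>"
  shows "(of_int n + 1 + \<alpha>) * pure_coeff \<alpha> (n + 1) = (of_int n - \<alpha>) * pure_coeff \<alpha> n"
proof (cases "n \<ge> 0")
  case True
  then obtain k where "n = int k" by (metis nonneg_int_cases)
  then show ?thesis using pure_coeff_Suc[OF assms, of k] by (simp add: add.commute)
next
  case False
  then obtain k where n: "n = - int (Suc k)" by (metis int_cases not_less zero_le_imp_eq_int negD linorder_not_le)
  then have "pure_coeff \<alpha> (n + 1) = pure_coeff \<alpha> (int k)" "pure_coeff \<alpha> n = pure_coeff \<alpha> (int (Suc k))"
    using pure_coeff_uminus[of \<alpha> "int k"] pure_coeff_uminus[of \<alpha> "int (Suc k)"] by auto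
  moreover have "real_of_int n = - (real k + 1)" by (simp add: n)
  ultimately show ?thesis using pure_coeff_Suc[OF assms, of k] by (simp only:) (simp add: algebra_simps)
qed

text \<open>Both sides satisfy the same recurrence and agree at 0. Neither n + 1 + \<alpha> for n
  \<ge> 0 nor n - \<alpha> for n < 0 vanishes, so the recurrence determines the values in both
  directions.\<close>

lemma pure_moment_eq:
  assumes \<alpha>: "0 < \<alpha>"
  shows "pure_moment \<alpha> n = of_real (2 * pi * pure_coeff \<alpha> n)"
proof -
  have rec: "(of_int m + 1 + \<alpha>) * (2 * pi * pure_coeff \<alpha> (m + 1)) = (of_int m - \<alpha>) * (2 * pi * pure_coeff \<alpha> m)" for m
    using arg_cong[OF pure_coeff_rec[OF \<alpha>, of m], of "\<lambda>x. 2 * pi * x"] by (simp only: mult_ac)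
  have "pure_moment \<alpha> (int k) = of_real (2 * pi * pure_coeff \<alpha> (int k))
      \<and> pure_moment \<alpha> (- int k) = of_real (2 * pi * pure_coeff \<alpha> (- int k))" for k
  proof (induction k)
    case 0
    then show ?case by (simp add: pure_moment_0[OF \<alpha>] pure_coeff_def)
  next
    case (Suc k)
    have a: "complex_of_real (of_int (int k) + 1 + \<alpha>) \<noteq> 0" "complex_of_real (of_int (- int (Suc k)) - \<alpha>) \<noteq> 0"
      using \<alpha> unfolding of_real_eq_0_iff by auto
    have "complex_of_real (of_int (int k) + 1 + \<alpha>) * pure_moment \<alpha> (int k + 1)
        = of_real (of_int (int k) + 1 + \<alpha>) * of_real (2 * pi * pure_coeff \<alpha> (int k + 1))"
      unfolding pure_moment_rec[OF \<alpha>] Suc[THEN conjunct1] of_real_mult[symmetric] rec ..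
    then have 1: "pure_moment \<alpha> (int k + 1) = of_real (2 * pi * pure_coeff \<alpha> (int k + 1))"
      using a(1) by (simp only: mult_cancel_left) simp
    have k: "- int k = - int (Suc k) + 1" by simp
    have "complex_of_real (of_int (- int (Suc k)) - \<alpha>) * pure_moment \<alpha> (- int (Suc k))
        = of_real (of_int (- int (Suc k)) - \<alpha>) * of_real (2 * pi * pure_coeff \<alpha> (- int (Suc k)))"
      unfolding pure_moment_rec[OF \<alpha>, symmetric] of_real_mult[symmetric] rec[symmetric] k[symmetric]
        Suc[THEN conjunct2] ..
    then have 2: "pure_moment \<alpha> (- int (Suc k)) = of_real (2 * pi * pure_coeff \<alpha> (- int (Suc k)))"
      using a(2) by (simp only: mult_cancel_left) simp
    show ?case using 1 2 by (simp add: add.commute)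
  qed
  then show ?thesis by (cases n rule: int_cases2) auto
qed

lemma fourier_coeff_pure_eq:
  "0 < \<alpha> \<Longrightarrow> fourier_coeff (phi_symbol \<alpha> (\<lambda>_. 1)) n = of_real (pure_coeff \<alpha> n)"
  by (simp add: fourier_coeff_pure pure_moment_eq)

text \<open>The Taylor coefficients of (1 - z)^(-\<beta>); all factors of the orthogonal polynomials
  and of their norms then share one recurrence and one asymptotic law.\<close>

definition binom_coeff :: "real \<Rightarrow> nat \<Rightarrow> real" where
  "binom_coeff \<beta> j = pochhammer \<beta> j / fact j"

lemma binom_coeff_pos: "0 < \<beta> \<Longrightarrow> 0 < binom_coeff \<beta> j"
  by (simp add: binom_coeff_def pochhammer_pos)

lemma binom_coeff_0 [simp]: "binom_coeff \<beta> 0 = 1"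
  by (simp add: binom_coeff_def)

lemma binom_coeff_Suc: "(real j + 1) * binom_coeff \<beta> (Suc j) = (\<beta> + real j) * binom_coeff \<beta> j"
proof -
  have "1 + real j \<noteq> 0" by linarith
  then show ?thesis by (simp add: binom_coeff_def pochhammer_Suc add_ac)
qed

text \<open>Coefficients of the orthogonal polynomials of the weight \<open>|1 - z|\<^sup>2\<^sup>\<alpha>\<close>, up to a factor.\<close>

definition opoly_coeff :: "real \<Rightarrow> nat \<Rightarrow> nat \<Rightarrow> real" where
  "opoly_coeff \<alpha> t k = (if k \<le> t then binom_coeff (1 + \<alpha>) k * binom_coeff \<alpha> (t - k) else 0)"

text \<open>A Wilf--Zeilberger certificate: the right-hand side is the telescoped sum.\<close>

lemma opoly_partial_sum:
  assumes \<alpha>: "0 < \<alpha>" and "K \<le> Suc t"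
  shows "(\<Sum>k<K. ((real t + 1) * (1 + \<alpha> - real l + real t) * opoly_coeff \<alpha> (Suc t) k
            - (real t - real l) * (1 + 2 * \<alpha> + real t) * opoly_coeff \<alpha> t k) * pure_coeff \<alpha> (int k - int l))
     = - real K * (real K - real l + \<alpha>) * binom_coeff (1 + \<alpha>) K * binom_coeff \<alpha> (Suc t - K)
         * pure_coeff \<alpha> (int K - int l)"
  using assms(2)
proof (induction K)
  case 0
  then show ?case by simp
next
  case (Suc K)
  define m m' where "m = binom_coeff (1 + \<alpha>) K" and "m' = binom_coeff (1 + \<alpha>) (Suc K)"
  define a a' where "a = binom_coeff \<alpha> (t - K)" and "a' = binom_coeff \<alpha> (Suc t - K)"
  define g g' where "g = pure_coeff \<alpha> (int K - int l)" and "g' = pure_coeff \<alpha> (int (Suc K) - int l)"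
  define k L T where "k = real K" and "L = real l" and "T = real t"
  from Suc.prems have le: "K \<le> t" by simp
  have m: "(k + 1) * m' = (1 + \<alpha> + k) * m"
    unfolding k_def m_def m'_def by (rule binom_coeff_Suc)
  have a: "(T - k + 1) * a' = (\<alpha> + T - k) * a"
    using binom_coeff_Suc[of "t - K" \<alpha>] le
    by (simp add: k_def T_def a_def a'_def Suc_diff_le of_nat_diff algebra_simps)
  have g: "(k + 1 - L + \<alpha>) * g' = (k - L - \<alpha>) * g"
    using pure_coeff_rec[OF \<alpha>, of "int K - int l"] by (simp add: g_def g'_def k_def L_def algebra_simps)
  \<comment> \<open>With the common factor \<open>m * g\<close> taken out and \<open>a'\<close>
    expressed through \<open>a\<close>, the certificate is a polynomial identity in k, L and
    T.\<close>
  have id: "(T + 1) * (1 + \<alpha> - L + T) * a' - (T - L) * (1 + 2 * \<alpha> + T) * a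
      = - (1 + \<alpha> + k) * (k - L - \<alpha>) * a + k * (k - L + \<alpha>) * a'"
  proof -
    have nz: "T - k + 1 \<noteq> 0" using le by (simp add: T_def k_def)
    have "(T - k + 1) * ((T + 1) * (1 + \<alpha> - L + T) * a' - (T - L) * (1 + 2 * \<alpha> + T) * a)
        = (T + 1) * (1 + \<alpha> - L + T) * ((T - k + 1) * a') - (T - k + 1) * (T - L) * (1 + 2 * \<alpha> + T) * a"
      by (simp add: algebra_simps)
    also have "\<dots> = - (T - k + 1) * (1 + \<alpha> + k) * (k - L - \<alpha>) * a + k * (k - L + \<alpha>) * ((T - k + 1) * a')"
      unfolding a by (simp add: algebra_simps)
    also have "\<dots> = (T - k + 1) * (- (1 + \<alpha> + k) * (k - L - \<alpha>) * a + k * (k - L + \<alpha>) * a')"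
      by (simp add: algebra_simps)
    finally show ?thesis using nz by simp
  qed
  have "(\<Sum>k<Suc K. ((real t + 1) * (1 + \<alpha> - real l + real t) * opoly_coeff \<alpha> (Suc t) k
            - (real t - real l) * (1 + 2 * \<alpha> + real t) * opoly_coeff \<alpha> t k) * pure_coeff \<alpha> (int k - int l))
     = - k * (k - L + \<alpha>) * m * a' * g
       + ((T + 1) * (1 + \<alpha> - L + T) * (m * a') - (T - L) * (1 + 2 * \<alpha> + T) * (m * a)) * g"
    unfolding sum.lessThan_Suc using Suc.IH le
    by (simp add: opoly_coeff_def k_def L_def T_def m_def a_def a'_def g_def)
  also have "\<dots> = - k * (k - L + \<alpha>) * m * a' * g
       + m * g * ((T + 1) * (1 + \<alpha> - L + T) * a' - (T - L) * (1 + 2 * \<alpha> + T) * a)"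
    by (simp add: algebra_simps)
  also have "\<dots> = - ((1 + \<alpha> + k) * m) * a * ((k - L - \<alpha>) * g)"
    unfolding id by (simp add: algebra_simps)
  also have "\<dots> = - ((k + 1) * m') * a * ((k + 1 - L + \<alpha>) * g')"
    unfolding m g ..
  finally show ?case
    using le by (simp add: k_def L_def m'_def a_def g'_def algebra_simps)
qed

text \<open>The inner product of the polynomial with z^l for the weight |1 - z|^(2\<alpha>).\<close>

definition opoly_moment :: "real \<Rightarrow> nat \<Rightarrow> nat \<Rightarrow> real" where
  "opoly_moment \<alpha> t l = (\<Sum>k\<le>t. opoly_coeff \<alpha> t k * pure_coeff \<alpha> (int k - int l))"

text \<open>The telescoped sum over k \<le> t is the negative of the one remaining term k = t + 1,
  to which only the polynomial of degree t + 1 contributes.\<close>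

lemma opoly_moment_rec:
  assumes \<alpha>: "0 < \<alpha>"
  shows "(real t + 1) * (1 + \<alpha> - real l + real t) * opoly_moment \<alpha> (Suc t) l
    = (real t - real l) * (1 + 2 * \<alpha> + real t) * opoly_moment \<alpha> t l"
proof -
  have "opoly_moment \<alpha> t l = (\<Sum>k<Suc (Suc t). opoly_coeff \<alpha> t k * pure_coeff \<alpha> (int k - int l))"
    unfolding opoly_moment_def lessThan_Suc_atMost by (simp add: opoly_coeff_def)
  then have "(real t + 1) * (1 + \<alpha> - real l + real t) * opoly_moment \<alpha> (Suc t) l
     - (real t - real l) * (1 + 2 * \<alpha> + real t) * opoly_moment \<alpha> t l
   = (\<Sum>k<Suc (Suc t). ((real t + 1) * (1 + \<alpha> - real l + real t) * opoly_coeff \<alpha> (Suc t) k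
            - (real t - real l) * (1 + 2 * \<alpha> + real t) * opoly_coeff \<alpha> t k) * pure_coeff \<alpha> (int k - int l))"
    by (simp only: opoly_moment_def lessThan_Suc_atMost[of "Suc t", symmetric] sum_distrib_left
      sum_subtractf[symmetric] left_diff_distrib mult.assoc)
  also have "\<dots> = 0"
    by (subst sum.lessThan_Suc, subst opoly_partial_sum[OF \<alpha>])
      (auto simp: opoly_coeff_def algebra_simps)
  finally show ?thesis by simp
qed

text \<open>The factor t - l of the recurrence vanishes at t = l, which kills the moment at t = l +
  1. The zero then propagates, as 1 + \<alpha> - l + t is positive for t \<ge> l.\<close>

lemma opoly_moment_orthogonal:
  assumes \<alpha>: "0 < \<alpha>" and "l < t"
  shows "opoly_moment \<alpha> t l = 0"
proof -
  from \<open>l < t\<close> have "Suc l \<le> t" by simp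
  then show ?thesis
  proof (induction t rule: dec_induct)
    case base
    have "(real l + 1) * (1 + \<alpha>) * opoly_moment \<alpha> (Suc l) l = 0"
      using opoly_moment_rec[OF \<alpha>, of l l] by simp
    moreover have "(real l + 1) * (1 + \<alpha>) \<noteq> 0" using \<alpha> by simp
    ultimately show ?case by (metis mult_eq_0_iff)
  next
    case (step t)
    have "(real t + 1) * (1 + \<alpha> - real l + real t) * opoly_moment \<alpha> (Suc t) l = 0"
      using opoly_moment_rec[OF \<alpha>, of t l] step by simp
    moreover have "(real t + 1) * (1 + \<alpha> - real l + real t) \<noteq> 0" using \<alpha> step by auto
    ultimately show ?case by (metis mult_eq_0_iff)
  qed
qed

text \<open>The squared norm, for the weight |1 - z|^(2\<alpha>), of the polynomial with
  coefficients \<open>opoly_coeff \<alpha> t\<close>; by orthogonality it is the leading coefficient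
  times the moment of order t.\<close>

definition opoly_norm :: "real \<Rightarrow> nat \<Rightarrow> real" where
  "opoly_norm \<alpha> t = Gamma (1 + 2 * \<alpha>) / (Gamma (1 + \<alpha>))\<^sup>2 * binom_coeff (1 + 2 * \<alpha>) t"

lemma opoly_norm_pos: "0 < \<alpha> \<Longrightarrow> 0 < opoly_norm \<alpha> t"
  unfolding opoly_norm_def by (intro mult_pos_pos divide_pos_pos binom_coeff_pos zero_less_power Gamma_real_pos) auto

text \<open>With l fixed, the recurrence is solved from t = 0, where the moment is a single Fourier
  coefficient, up to t = l. The solution \<open>S\<close> is stated without division; at t = l the
  factor \<open>pochhammer (- \<alpha>) l\<close> is cancelled, nonzero because \<alpha> is not an
  integer.\<close>

lemma opoly_moment_diag:
  assumes \<alpha>: "0 < \<alpha>" "\<alpha> < 1"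
  shows "binom_coeff (1 + \<alpha>) l * opoly_moment \<alpha> l l = opoly_norm \<alpha> l"
proof -
  have S: "opoly_moment \<alpha> t l * pochhammer (1 + \<alpha> - real l) t * fact t
      = pure_coeff \<alpha> (int l) * pochhammer (- real l) t * pochhammer (1 + 2 * \<alpha>) t" for t
  proof (induction t)
    case 0
    then show ?case using pure_coeff_uminus[of \<alpha> "int l"] by (simp add: opoly_moment_def opoly_coeff_def)
  next
    case (Suc t)
    have "opoly_moment \<alpha> (Suc t) l * pochhammer (1 + \<alpha> - real l) (Suc t) * fact (Suc t)
        = ((real t + 1) * (1 + \<alpha> - real l + real t) * opoly_moment \<alpha> (Suc t) l)
            * pochhammer (1 + \<alpha> - real l) t * fact t"
      by (simp add: pochhammer_Suc algebra_simps)
    also have "\<dots> = (real t - real l) * (1 + 2 * \<alpha> + real t)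
        * (opoly_moment \<alpha> t l * pochhammer (1 + \<alpha> - real l) t * fact t)"
      unfolding opoly_moment_rec[OF \<alpha>(1)] by (simp add: mult_ac)
    also have "\<dots> = pure_coeff \<alpha> (int l) * pochhammer (- real l) (Suc t) * pochhammer (1 + 2 * \<alpha>) (Suc t)"
      unfolding Suc by (simp add: pochhammer_Suc algebra_simps)
    finally show ?case .
  qed
  have p1: "pochhammer (1 + \<alpha> - real l) l = (- 1) ^ l * pochhammer (- \<alpha>) l"
    using pochhammer_minus[of \<alpha> l] by (simp add: algebra_simps)
  have p2: "pochhammer (- real l) l = (- 1) ^ l * fact l"
    by (simp add: pochhammer_same)
  have nz: "pochhammer (- \<alpha>) l \<noteq> 0"
  proof
    assume "pochhammer (- \<alpha>) l = 0"
    then obtain k where "- \<alpha> = - real k" using pochhammer_eq_0_iff[of "- \<alpha>" l] by auto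
    with \<alpha> show False by auto
  qed
  have p: "pochhammer (1 + \<alpha>) l > 0" using \<alpha> by (intro pochhammer_pos) auto
  have "(-1) ^ l * (opoly_moment \<alpha> l l * pochhammer (- \<alpha>) l * fact l)
      = (- 1) ^ l * (pure_coeff \<alpha> (int l) * fact l * pochhammer (1 + 2 * \<alpha>) l)"
    using S[of l] unfolding p1 p2 by (simp only: mult_ac)
  then have "opoly_moment \<alpha> l l * pochhammer (- \<alpha>) l = pure_coeff \<alpha> (int l) * pochhammer (1 + 2 * \<alpha>) l"
    by simp
  then have "opoly_moment \<alpha> l l * pochhammer (- \<alpha>) l
      = (Gamma (1 + 2 * \<alpha>) / (Gamma (1 + \<alpha>))\<^sup>2 * pochhammer (1 + 2 * \<alpha>) l / pochhammer (1 + \<alpha>) l)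
        * pochhammer (- \<alpha>) l"
    by (simp add: pure_coeff_def)
  then have "opoly_moment \<alpha> l l
      = Gamma (1 + 2 * \<alpha>) / (Gamma (1 + \<alpha>))\<^sup>2 * pochhammer (1 + 2 * \<alpha>) l / pochhammer (1 + \<alpha>) l"
    using nz by (simp only: mult_cancel_right) simp
  then show ?thesis using p by (simp add: opoly_norm_def binom_coeff_def)
qed

section \<open>Orthonormality and the factorisation of the inverse Toeplitz matrix\<close>

definition chol_factor :: "real \<Rightarrow> nat \<Rightarrow> nat \<Rightarrow> real" where
  "chol_factor \<alpha> k t = opoly_coeff \<alpha> t k / sqrt (opoly_norm \<alpha> t)"

text \<open>Column t of \<open>chol_factor\<close> holds the orthonormal polynomial of degree t, so
  this is A^T T A = 1. For t' \<le> t the sum over k is a moment against z^l, which vanishes for l <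
  t, while the other column vanishes for l > t'; only l = t = t' can survive. The case t < t'
  follows by symmetry of T.\<close>

lemma chol_factor_orthonormal:
  assumes \<alpha>: "0 < \<alpha>" "\<alpha> < 1" and "t < n" "t' < n"
  shows "(\<Sum>k<n. \<Sum>l<n. chol_factor \<alpha> k t * pure_coeff \<alpha> (int l - int k) * chol_factor \<alpha> l t')
    = (if t = t' then 1 else 0)"
proof -
  have *: "(\<Sum>k<n. \<Sum>l<n. chol_factor \<alpha> k t * pure_coeff \<alpha> (int l - int k) * chol_factor \<alpha> l t')
      = (if t = t' then 1 else 0)" if "t' \<le> t" "t < n" for t t'
  proof -
    have S: "(\<Sum>k<n. opoly_coeff \<alpha> t k * pure_coeff \<alpha> (int k - int l)) = opoly_moment \<alpha> t l" for l
      unfolding opoly_moment_def using \<open>t < n\<close>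
      by (intro sum.mono_neutral_right) (auto simp: opoly_coeff_def)
    have "(\<Sum>k<n. \<Sum>l<n. chol_factor \<alpha> k t * pure_coeff \<alpha> (int l - int k) * chol_factor \<alpha> l t')
        = (\<Sum>l<n. \<Sum>k<n. opoly_coeff \<alpha> t k * pure_coeff \<alpha> (int k - int l) * (chol_factor \<alpha> l t' / sqrt (opoly_norm \<alpha> t)))"
    proof (subst sum.swap, intro sum.cong refl)
      fix k l
      have "pure_coeff \<alpha> (int l - int k) = pure_coeff \<alpha> (int k - int l)"
        using pure_coeff_uminus[of \<alpha> "int k - int l"] by simp
      then show "chol_factor \<alpha> k t * pure_coeff \<alpha> (int l - int k) * chol_factor \<alpha> l t'
        = opoly_coeff \<alpha> t k * pure_coeff \<alpha> (int k - int l) * (chol_factor \<alpha> l t' / sqrt (opoly_norm \<alpha> t))"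
        by (simp add: chol_factor_def)
    qed
    also have "\<dots> = (\<Sum>l<n. opoly_moment \<alpha> t l * (chol_factor \<alpha> l t' / sqrt (opoly_norm \<alpha> t)))"
      unfolding sum_distrib_right[symmetric] S ..
    also have "\<dots> = (\<Sum>l\<in>{t}. opoly_moment \<alpha> t l * (chol_factor \<alpha> l t' / sqrt (opoly_norm \<alpha> t)))"
    proof (intro sum.mono_neutral_right ballI)
      fix l assume "l \<in> {..<n} - {t}"
      then have "l < t \<or> t' < l" using \<open>t' \<le> t\<close> by auto
      then consider "l < t" | "t' < l" by blast
      then show "opoly_moment \<alpha> t l * (chol_factor \<alpha> l t' / sqrt (opoly_norm \<alpha> t)) = 0"
        by cases (auto simp: opoly_moment_orthogonal[OF \<alpha>(1)] chol_factor_def opoly_coeff_def)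
    qed (use that in auto)
    also have "\<dots> = (if t = t' then 1 else 0)"
      using opoly_moment_diag[OF \<alpha>, of t] opoly_norm_pos[OF \<alpha>(1), of t] that
      by (auto simp: chol_factor_def opoly_coeff_def field_simps)
    finally show ?thesis .
  qed
  show ?thesis
  proof (cases "t' \<le> t")
    case True
    then show ?thesis using * assms by blast
  next
    case False
    have "(\<Sum>k<n. \<Sum>l<n. chol_factor \<alpha> k t * pure_coeff \<alpha> (int l - int k) * chol_factor \<alpha> l t')
      = (\<Sum>k<n. \<Sum>l<n. chol_factor \<alpha> k t' * pure_coeff \<alpha> (int l - int k) * chol_factor \<alpha> l t)"
    proof (subst sum.swap, intro sum.cong refl)
      fix k l
      have "pure_coeff \<alpha> (int l - int k) = pure_coeff \<alpha> (int k - int l)"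
        using pure_coeff_uminus[of \<alpha> "int k - int l"] by simp
      then show "chol_factor \<alpha> k t * pure_coeff \<alpha> (int l - int k) * chol_factor \<alpha> l t'
        = chol_factor \<alpha> l t' * pure_coeff \<alpha> (int k - int l) * chol_factor \<alpha> k t"
        by simp
    qed
    then show ?thesis using *[of t t'] False assms by auto
  qed
qed

text \<open>The substitution u = A w, through which every estimate of the least eigenvalue passes:
  the Rayleigh quotient becomes |w|^2 / |A w|^2.\<close>

lemma qform_pure_chol:
  assumes \<alpha>: "0 < \<alpha>" "\<alpha> < 1"
  shows "qform n (\<lambda>k l. of_real (pure_coeff \<alpha> (int l - int k))) (\<lambda>k. \<Sum>t<n. of_real (chol_factor \<alpha> k t) * w t)
    = sqnorm n w"
proof -
  let ?A = "\<lambda>k t. complex_of_real (chol_factor \<alpha> k t)"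
  let ?T = "\<lambda>k l. complex_of_real (pure_coeff \<alpha> (int l - int k))"
  have "(\<Sum>k<n. \<Sum>l<n. cnj (\<Sum>t<n. ?A k t * w t) * ?T k l * (\<Sum>t<n. ?A l t * w t))
     = (\<Sum>k<n. \<Sum>l<n. \<Sum>t<n. \<Sum>t'<n. cnj (w t) * w t' * (?A k t * ?T k l * ?A l t'))"
    by (simp add: sum_distrib_left sum_distrib_right mult_ac)
  also have "\<dots> = (\<Sum>k<n. \<Sum>t<n. \<Sum>l<n. \<Sum>t'<n. cnj (w t) * w t' * (?A k t * ?T k l * ?A l t'))"
    by (rule sum.cong[OF refl], rule sum.swap)
  also have "\<dots> = (\<Sum>k<n. \<Sum>t<n. \<Sum>t'<n. \<Sum>l<n. cnj (w t) * w t' * (?A k t * ?T k l * ?A l t'))"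
    by (rule sum.cong[OF refl], rule sum.cong[OF refl], rule sum.swap)
  also have "\<dots> = (\<Sum>t<n. \<Sum>k<n. \<Sum>t'<n. \<Sum>l<n. cnj (w t) * w t' * (?A k t * ?T k l * ?A l t'))"
    by (rule sum.swap)
  also have "\<dots> = (\<Sum>t<n. \<Sum>t'<n. \<Sum>k<n. \<Sum>l<n. cnj (w t) * w t' * (?A k t * ?T k l * ?A l t'))"
    by (rule sum.cong[OF refl], rule sum.swap)
  also have "\<dots> = (\<Sum>t<n. \<Sum>t'<n. cnj (w t) * w t' *
      of_real (\<Sum>k<n. \<Sum>l<n. chol_factor \<alpha> k t * pure_coeff \<alpha> (int l - int k) * chol_factor \<alpha> l t'))"
    by (simp add: sum_distrib_left)
  also have "\<dots> = (\<Sum>t<n. \<Sum>t'<n. cnj (w t) * w t' * (if t = t' then 1 else 0))"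
    by (intro sum.cong refl) (simp add: chol_factor_orthonormal[OF \<alpha>])
  also have "\<dots> = (\<Sum>t<n. \<Sum>t'<n. if t = t' then of_real ((cmod (w t))\<^sup>2) else 0)"
    by (intro sum.cong refl) (auto simp: complex_norm_square mult.commute simp del: of_real_power)
  also have "\<dots> = of_real (sqnorm n w)"
    by (simp add: sqnorm_def)
  finally show ?thesis unfolding qform_def by simp
qed

text \<open>Back substitution: the last unknown is fixed first and moved to the right-hand
  side.\<close>

lemma triangular_surj:
  fixes A :: "nat \<Rightarrow> nat \<Rightarrow> complex"
  assumes tri: "\<And>k t. t < k \<Longrightarrow> A k t = 0" and diag: "\<And>k. A k k \<noteq> 0"
  shows "\<exists>w. \<forall>k<n. (\<Sum>t<n. A k t * w t) = u k"
proof (induction n arbitrary: u)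
  case 0
  then show ?case by simp
next
  case (Suc n)
  define c where "c = u n / A n n"
  from Suc[of "\<lambda>k. u k - A k n * c"] obtain w where w: "\<And>k. k < n \<Longrightarrow> (\<Sum>t<n. A k t * w t) = u k - A k n * c"
    by blast
  have "(\<Sum>t<Suc n. A k t * (w(n := c)) t) = u k" if "k < Suc n" for k
  proof (cases "k = n")
    case True
    have "(\<Sum>t<n. A n t * (w(n := c)) t) = 0" by (intro sum.neutral) (auto simp: tri)
    then show ?thesis using True diag[of n] by (simp add: c_def)
  next
    case False
    then show ?thesis using w[of k] that by simp
  qed
  then show ?case by blast
qed

lemma chol_factor_surj:
  assumes "0 < \<alpha>"
  shows "\<exists>w. \<forall>k<n. (\<Sum>t<n. of_real (chol_factor \<alpha> k t) * w t) = (u k :: complex)"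
proof (rule triangular_surj)
  show "complex_of_real (chol_factor \<alpha> k k) \<noteq> 0" for k
    using binom_coeff_pos[of "1 + \<alpha>" k] opoly_norm_pos[of \<alpha> k] assms
    by (simp add: chol_factor_def opoly_coeff_def)
qed (simp add: chol_factor_def opoly_coeff_def)

section \<open>Asymptotics of the Cholesky factor\<close>

lemma binom_coeff_asymp:
  assumes "0 < \<beta>"
  shows "(\<lambda>n. binom_coeff \<beta> n / real n powr (\<beta> - 1)) \<longlonglongrightarrow> 1 / Gamma \<beta>"
proof -
  \<comment> \<open>\<open>rGamma_series\<close> has the additional Pochhammer factor \<beta> + n;
    the quotient n / (\<beta> + n) trades it for a factor n and tends to 1.\<close>
  have "(\<lambda>n. rGamma_series \<beta> n * (real n / (\<beta> + real n))) \<longlonglongrightarrow> rGamma \<beta> * 1"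
    by (intro tendsto_mult rGamma_series_LIMSEQ) real_asymp
  moreover have "\<forall>\<^sub>F n in sequentially. rGamma_series \<beta> n * (real n / (\<beta> + real n))
      = binom_coeff \<beta> n / real n powr (\<beta> - 1)"
    using eventually_gt_at_top[of 0]
  proof eventually_elim
    case (elim n)
    have "exp (\<beta> * ln (real n)) = real n powr \<beta>" using elim by (simp add: powr_def)
    moreover have "\<beta> + real n \<noteq> 0" using assms by simp
    ultimately show ?case using elim
      by (simp add: rGamma_series_def pochhammer_Suc binom_coeff_def powr_diff)
  qed
  ultimately show ?thesis
    by (simp add: tendsto_cong Gamma_def inverse_eq_divide)
qed

lemma binom_coeff_scaled_limit:
  fixes j :: "nat \<Rightarrow> nat"
  assumes \<beta>: "0 < \<beta>" and j: "(\<lambda>M. real (j M) / real M) \<longlonglongrightarrow> y" and y: "0 < y"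
  shows "(\<lambda>M. binom_coeff \<beta> (j M) / real M powr (\<beta> - 1)) \<longlonglongrightarrow> y powr (\<beta> - 1) / Gamma \<beta>"
proof -
  have "filterlim (\<lambda>M. real (j M)) at_top sequentially"
  proof -
    have "filterlim (\<lambda>M. (real (j M) / real M) * real M) at_top sequentially"
      by (rule filterlim_tendsto_pos_mult_at_top[OF j y filterlim_real_sequentially])
    moreover have "\<forall>\<^sub>F M in sequentially. (real (j M) / real M) * real M = real (j M)"
      using eventually_gt_at_top[of 0] by eventually_elim simp
    ultimately show ?thesis by (simp cong: filterlim_cong)
  qed
  then have jt: "filterlim j at_top sequentially"
    using filterlim_sequentially_iff_filterlim_real by blast
  have "(\<lambda>M. binom_coeff \<beta> (j M) / real (j M) powr (\<beta> - 1) * (real (j M) / real M) powr (\<beta> - 1))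
      \<longlonglongrightarrow> 1 / Gamma \<beta> * y powr (\<beta> - 1)"
    using y by (intro tendsto_mult tendsto_powr j tendsto_const
        filterlim_compose[OF binom_coeff_asymp[OF \<beta>] jt]) auto
  moreover have "\<forall>\<^sub>F M in sequentially. binom_coeff \<beta> (j M) / real (j M) powr (\<beta> - 1) *
      (real (j M) / real M) powr (\<beta> - 1) = binom_coeff \<beta> (j M) / real M powr (\<beta> - 1)"
    using filterlim_at_top_dense[THEN iffD1, OF \<open>filterlim (\<lambda>M. real (j M)) at_top sequentially\<close>, rule_format, of 0]
    by eventually_elim (simp add: powr_divide)
  ultimately show ?thesis by (simp add: tendsto_cong)
qed

text \<open>The quotient \<open>r\<close> is positive and has a positive limit, so \<open>r\<close>
  and its inverse are bounded. The shift from j to j + 1 keeps the comparison meaningful at j =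
  0.\<close>

lemma binom_coeff_bounds:
  assumes \<beta>: "0 < \<beta>"
  shows "\<exists>c C. 0 < c \<and> 0 < C \<and> (\<forall>j. c * (real j + 1) powr (\<beta> - 1) \<le> binom_coeff \<beta> j \<and>
    binom_coeff \<beta> j \<le> C * (real j + 1) powr (\<beta> - 1))"
proof -
  define r where "r j = binom_coeff \<beta> j / (real j + 1) powr (\<beta> - 1)" for j
  have r0: "r j > 0" for j using binom_coeff_pos[OF \<beta>] by (simp add: r_def)
  have "(\<lambda>j. binom_coeff \<beta> j / real j powr (\<beta> - 1) * (real j / (real j + 1)) powr (\<beta> - 1))
      \<longlonglongrightarrow> 1 / Gamma \<beta> * 1 powr (\<beta> - 1)"
    by (intro tendsto_mult binom_coeff_asymp[OF \<beta>] tendsto_powr tendsto_const) (real_asymp, simp)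
  moreover have "\<forall>\<^sub>F j in sequentially. binom_coeff \<beta> j / real j powr (\<beta> - 1) * (real j / (real j + 1)) powr (\<beta> - 1) = r j"
    using eventually_gt_at_top[of 0] by eventually_elim (simp add: r_def powr_divide)
  ultimately have r: "r \<longlonglongrightarrow> 1 / Gamma \<beta>" by (simp add: tendsto_cong)
  then have ri: "(\<lambda>j. inverse (r j)) \<longlonglongrightarrow> inverse (1 / Gamma \<beta>)"
    using Gamma_real_pos[OF \<beta>] by (intro tendsto_inverse) simp_all
  obtain C where C: "C > 0" "\<And>j. norm (r j) \<le> C"
    using convergent_imp_Bseq[OF convergentI[OF r]] unfolding Bseq_def by blast
  obtain D where D: "D > 0" "\<And>j. norm (inverse (r j)) \<le> D"
    using convergent_imp_Bseq[OF convergentI[OF ri]] unfolding Bseq_def by blast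
  have "1 / D \<le> r j" "r j \<le> C" for j
    using C(2)[of j] D(2)[of j] D(1) r0[of j] by (auto simp: field_simps)
  then have "1 / D * (real j + 1) powr (\<beta> - 1) \<le> binom_coeff \<beta> j \<and>
      binom_coeff \<beta> j \<le> C * (real j + 1) powr (\<beta> - 1)" for j
    unfolding r_def by (simp add: pos_le_divide_eq pos_divide_le_eq)
  then show ?thesis using C D by (intro exI[of _ "1 / D"] exI[of _ C]) auto
qed

text \<open>The first binomial coefficient is at most a multiple of (t + 1)^\<alpha>, which cancels
  against the square root of \<open>opoly_norm\<close>; what remains is the weakly singular power of
  the distance to the diagonal.\<close>

lemma chol_factor_bound:
  assumes \<alpha>: "0 < \<alpha>"
  shows "\<exists>C>0. \<forall>k t. k \<le> t \<longrightarrow> chol_factor \<alpha> k t \<le> C * (real t - real k + 1) powr (\<alpha> - 1)"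
proof -
  obtain c1 C1 where 1: "0 < C1" "\<And>j. binom_coeff (1 + \<alpha>) j \<le> C1 * (real j + 1) powr (1 + \<alpha> - 1)"
    using binom_coeff_bounds[of "1 + \<alpha>"] \<alpha> by auto
  obtain c2 C2 where 2: "0 < C2" "\<And>j. binom_coeff \<alpha> j \<le> C2 * (real j + 1) powr (\<alpha> - 1)"
    using binom_coeff_bounds[of "\<alpha>"] \<alpha> by auto
  obtain c3 C3 where 3: "0 < c3" "\<And>j. c3 * (real j + 1) powr (1 + 2 * \<alpha> - 1) \<le> binom_coeff (1 + 2 * \<alpha>) j"
    using binom_coeff_bounds[of "1 + 2 * \<alpha>"] \<alpha> by auto
  define d where "d = Gamma (1 + 2 * \<alpha>) / (Gamma (1 + \<alpha>))\<^sup>2 * c3"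
  have d: "d > 0" unfolding d_def
    by (intro mult_pos_pos divide_pos_pos zero_less_power Gamma_real_pos) (use \<alpha> 3 in auto)
  have D: "sqrt d * (real t + 1) powr \<alpha> \<le> sqrt (opoly_norm \<alpha> t)" for t
  proof (rule real_le_rsqrt)
    have "(real t + 1) powr (2 * \<alpha>) = ((real t + 1) powr \<alpha>)\<^sup>2"
      by (simp add: powr_add[symmetric] power2_eq_square)
    then have "(sqrt d * (real t + 1) powr \<alpha>)\<^sup>2 = Gamma (1 + 2 * \<alpha>) / (Gamma (1 + \<alpha>))\<^sup>2 * (c3 * (real t + 1) powr (1 + 2 * \<alpha> - 1))"
      using d by (simp add: power_mult_distrib) (simp add: d_def)
    also have "\<dots> \<le> opoly_norm \<alpha> t" unfolding opoly_norm_def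
      using \<alpha> by (intro mult_left_mono 3) (auto intro!: divide_nonneg_nonneg less_imp_le[OF Gamma_real_pos])
    finally show "(sqrt d * (real t + 1) powr \<alpha>)\<^sup>2 \<le> opoly_norm \<alpha> t" .
  qed
  define C where "C = C1 * C2 / sqrt d"
  have "chol_factor \<alpha> k t \<le> C * (real t - real k + 1) powr (\<alpha> - 1)" if "k \<le> t" for k t
  proof -
    have "chol_factor \<alpha> k t = binom_coeff (1 + \<alpha>) k * binom_coeff \<alpha> (t - k) / sqrt (opoly_norm \<alpha> t)"
      using that by (simp add: chol_factor_def opoly_coeff_def)
    also have "\<dots> \<le> (C1 * (real t + 1) powr \<alpha>) * (C2 * (real (t - k) + 1) powr (\<alpha> - 1)) / (sqrt d * (real t + 1) powr \<alpha>)"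
    proof (intro frac_le mult_mono)
      have "binom_coeff (1 + \<alpha>) k \<le> C1 * (real k + 1) powr \<alpha>" using 1(2)[of k] by simp
      also have "\<dots> \<le> C1 * (real t + 1) powr \<alpha>"
        using 1 that \<alpha> by (intro mult_left_mono powr_mono2) auto
      finally show "binom_coeff (1 + \<alpha>) k \<le> C1 * (real t + 1) powr \<alpha>" .
    qed (use 1 2 d D \<alpha> binom_coeff_pos[of "1 + \<alpha>"] binom_coeff_pos[of \<alpha>] in \<open>auto intro!: mult_nonneg_nonneg less_imp_le\<close>)
    also have "\<dots> = C * (real t - real k + 1) powr (\<alpha> - 1)"
    proof -
      have "(real t + 1) powr \<alpha> \<noteq> 0" by simp
      then show ?thesis using that by (simp add: C_def of_nat_diff)
    qed
    finally show ?thesis .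
  qed
  moreover have "C > 0" using 1 2 d by (simp add: C_def)
  ultimately show ?thesis by blast
qed

lemma chol_factor_nonneg: "0 < \<alpha> \<Longrightarrow> 0 \<le> chol_factor \<alpha> k t"
  unfolding chol_factor_def opoly_coeff_def
  using binom_coeff_pos[of "1 + \<alpha>"] binom_coeff_pos[of \<alpha>] opoly_norm_pos[of \<alpha> t]
  by (auto intro!: divide_nonneg_pos mult_nonneg_nonneg less_imp_le)

section \<open>The scaled factor as a step kernel, and its pointwise limit\<close>

definition cell :: "nat \<Rightarrow> real \<Rightarrow> nat" where
  "cell M x = nat \<lfloor>real M * x\<rfloor>"

text \<open>Entries at distinct indices proportional to M, above the diagonal, have size M^(\<alpha>
  - 1), which fixes the scaling. A vector spread over cells of length 1/M has its norm divided by
  sqrt M, so on the unit square this kernel has M^(-\<alpha>) times the operator norm of the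
  matrix.\<close>

definition chol_kernel :: "real \<Rightarrow> nat \<Rightarrow> real \<Rightarrow> real \<Rightarrow> real" where
  "chol_kernel \<alpha> M x s = real M powr (1 - \<alpha>) * chol_factor \<alpha> (cell M x) (cell M s)"

definition limit_kernel :: "real \<Rightarrow> real \<Rightarrow> real \<Rightarrow> real" where
  "limit_kernel \<alpha> x s = (if x < s then x powr \<alpha> * (s - x) powr (\<alpha> - 1) * s powr (- \<alpha>) / Gamma \<alpha> else 0)"

lemma limit_kernel_nonneg: "0 < \<alpha> \<Longrightarrow> 0 \<le> limit_kernel \<alpha> x s"
  by (auto simp: limit_kernel_def intro!: divide_nonneg_pos)

lemma limit_kernel_bound:
  assumes "0 < \<alpha>" "0 < x" "0 < s"
  shows "limit_kernel \<alpha> x s \<le> 1 / Gamma \<alpha> * \<bar>s - x\<bar> powr (\<alpha> - 1)"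
proof (cases "x < s")
  case True
  have "x powr \<alpha> * s powr (- \<alpha>) \<le> s powr \<alpha> * s powr (- \<alpha>)"
    using assms True by (intro mult_right_mono powr_mono2) auto
  also have "\<dots> = 1" using assms by (simp add: powr_add[symmetric])
  finally have "(x powr \<alpha> * s powr (- \<alpha>)) * ((s - x) powr (\<alpha> - 1) / Gamma \<alpha>) \<le> 1 * ((s - x) powr (\<alpha> - 1) / Gamma \<alpha>)"
    using assms by (intro mult_right_mono) auto
  then show ?thesis using True by (simp add: limit_kernel_def mult_ac)
next
  case False
  then show ?thesis using assms by (simp add: limit_kernel_def)
qed

lemma cell_bounds:
  assumes "0 \<le> x"
  shows "real (cell M x) \<le> real M * x" "real M * x < real (cell M x) + 1"
proof -
  have "0 \<le> \<lfloor>real M * x\<rfloor>" using assms by simp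
  then have "real (cell M x) = of_int \<lfloor>real M * x\<rfloor>" by (simp add: cell_def)
  then show "real (cell M x) \<le> real M * x" "real M * x < real (cell M x) + 1" by linarith+
qed

text \<open>Points whose cell indices differ by d - 1 are at most d / M apart, and the power
  \<alpha> - 1 is decreasing. The \<open>+ 1\<close> in \<open>chol_factor_bound\<close> covers
  points of the same cell. The diagonal is excluded since \<open>0 powr (\<alpha> - 1)\<close> is
  0.\<close>

lemma chol_kernel_bound:
  assumes \<alpha>: "0 < \<alpha>" "\<alpha> < 1"
  shows "\<exists>C>0. \<forall>M x s. 0 < M \<longrightarrow> 0 < x \<longrightarrow> 0 < s \<longrightarrow> x \<noteq> s \<longrightarrow>
    chol_kernel \<alpha> M x s \<le> C * \<bar>s - x\<bar> powr (\<alpha> - 1)"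
proof -
  obtain C where C: "C > 0" "\<And>k t. k \<le> t \<Longrightarrow> chol_factor \<alpha> k t \<le> C * (real t - real k + 1) powr (\<alpha> - 1)"
    using chol_factor_bound[OF \<alpha>(1)] by blast
  have "chol_kernel \<alpha> M x s \<le> C * \<bar>s - x\<bar> powr (\<alpha> - 1)"
    if M: "0 < M" and xs: "0 < x" "0 < s" "x \<noteq> s" for M x s
  proof (cases "cell M x \<le> cell M s")
    case False
    then show ?thesis using C by (simp add: chol_kernel_def chol_factor_def opoly_coeff_def)
  next
    case True
    define d where "d = real (cell M s) - real (cell M x) + 1"
    have d: "d \<ge> 1" using True by (simp add: d_def)
    have "real M * \<bar>s - x\<bar> \<le> d"
    proof (cases "x \<le> s")
      case le: True
      then show ?thesis using cell_bounds[of x M] cell_bounds[of s M] xs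
        by (simp add: d_def right_diff_distrib)
    next
      case le: False
      then show ?thesis using cell_bounds[of x M] cell_bounds[of s M] xs True
        by (simp add: d_def right_diff_distrib)
    qed
    then have le: "\<bar>s - x\<bar> \<le> d / real M" using M by (simp add: field_simps)
    have "chol_kernel \<alpha> M x s \<le> real M powr (1 - \<alpha>) * (C * d powr (\<alpha> - 1))"
      unfolding chol_kernel_def d_def using C(2)[OF True] by (intro mult_left_mono) auto
    also have "\<dots> = C * (d / real M) powr (\<alpha> - 1)"
    proof -
      have "real M powr (\<alpha> - 1) * real M powr (1 - \<alpha>) = 1" using M by (simp add: powr_add[symmetric])
      then have "real M powr (1 - \<alpha>) = 1 / real M powr (\<alpha> - 1)" using M by (simp add: field_simps)
      then show ?thesis using d M by (simp add: powr_divide)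
    qed
    also have "\<dots> \<le> C * \<bar>s - x\<bar> powr (\<alpha> - 1)"
      using C \<alpha> xs le by (intro mult_left_mono powr_mono2') auto
    finally show ?thesis .
  qed
  then show ?thesis using C(1) by blast
qed

lemma cell_limit:
  assumes "0 \<le> x"
  shows "(\<lambda>M. real (cell M x) / real M) \<longlonglongrightarrow> x"
proof (rule tendsto_sandwich)
  show "\<forall>\<^sub>F M in sequentially. x - 1 / real M \<le> real (cell M x) / real M"
    using eventually_gt_at_top[of 0]
  proof eventually_elim
    case (elim M)
    then have "x \<le> (real (cell M x) + 1) / real M"
      using cell_bounds(2)[OF assms, of M] by (simp add: pos_le_divide_eq mult.commute)
    then show ?case by (simp add: add_divide_distrib)
  qed
  show "\<forall>\<^sub>F M in sequentially. real (cell M x) / real M \<le> x"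
    using eventually_gt_at_top[of 0]
  proof eventually_elim
    case (elim M)
    then show ?case using cell_bounds(1)[OF assms, of M] by (simp add: field_simps)
  qed
  show "(\<lambda>M. x - 1 / real M) \<longlonglongrightarrow> x" by real_asymp
qed auto

text \<open>For x < s the three binomial coefficients scale as M^\<alpha>, M^(\<alpha>-1) and
  M^(2\<alpha>), the last under a root, which leaves M^(\<alpha>-1); the constants
  \<Gamma>(1+\<alpha>) and \<Gamma>(1+2\<alpha>) cancel. For s < x the two cells eventually separate
  and the entry is exactly 0.\<close>

lemma chol_kernel_limit:
  assumes \<alpha>: "0 < \<alpha>" and xs: "0 < x" "0 < s" "x \<noteq> s"
  shows "(\<lambda>M. chol_kernel \<alpha> M x s) \<longlonglongrightarrow> limit_kernel \<alpha> x s"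
proof (cases "x < s")
  case False
  then have "s < x" using xs by simp
  have "(\<lambda>M. real (cell M x) / real M - real (cell M s) / real M) \<longlonglongrightarrow> x - s"
    using xs by (intro tendsto_diff cell_limit) auto
  then have "\<forall>\<^sub>F M in sequentially. 0 < real (cell M x) / real M - real (cell M s) / real M"
    by (rule order_tendstoD) (use \<open>s < x\<close> in auto)
  then have "\<forall>\<^sub>F M in sequentially. chol_kernel \<alpha> M x s = 0"
    using eventually_gt_at_top[of 0]
    by eventually_elim (auto simp: chol_kernel_def chol_factor_def opoly_coeff_def field_simps)
  then show ?thesis using False by (simp add: limit_kernel_def tendsto_eventually)
next
  case True
  have cx: "(\<lambda>M. real (cell M x) / real M) \<longlonglongrightarrow> x" and cs: "(\<lambda>M. real (cell M s) / real M) \<longlonglongrightarrow> s"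
    using xs by (auto intro: cell_limit)
  have le: "cell M x \<le> cell M s" for M
    unfolding cell_def using True by (intro nat_mono floor_mono mult_left_mono) auto
  have cd: "(\<lambda>M. real (cell M s - cell M x) / real M) \<longlonglongrightarrow> s - x"
    using tendsto_diff[OF cs cx] le by (simp add: of_nat_diff diff_divide_distrib)
  define b1 where "b1 M = binom_coeff (1 + \<alpha>) (cell M x) / real M powr (1 + \<alpha> - 1)" for M
  define b2 where "b2 M = binom_coeff \<alpha> (cell M s - cell M x) / real M powr (\<alpha> - 1)" for M
  define b3 where "b3 M = binom_coeff (1 + 2 * \<alpha>) (cell M s) / real M powr (1 + 2 * \<alpha> - 1)" for M
  define c where "c = Gamma (1 + 2 * \<alpha>) / (Gamma (1 + \<alpha>))\<^sup>2"
  have G: "Gamma (1 + 2 * \<alpha>) > 0" "Gamma (1 + \<alpha>) > 0" using \<alpha> by auto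
  have l1: "b1 \<longlonglongrightarrow> x powr (1 + \<alpha> - 1) / Gamma (1 + \<alpha>)" unfolding b1_def
    using \<alpha> xs by (intro binom_coeff_scaled_limit cx) auto
  have l2: "b2 \<longlonglongrightarrow> (s - x) powr (\<alpha> - 1) / Gamma \<alpha>" unfolding b2_def
    using \<alpha> True by (intro binom_coeff_scaled_limit cd) auto
  have l3: "b3 \<longlonglongrightarrow> s powr (1 + 2 * \<alpha> - 1) / Gamma (1 + 2 * \<alpha>)" unfolding b3_def
    using \<alpha> xs by (intro binom_coeff_scaled_limit cs) auto
  have "(\<lambda>M. b1 M * b2 M / sqrt (c * b3 M)) \<longlonglongrightarrow> (x powr (1 + \<alpha> - 1) / Gamma (1 + \<alpha>)) *
      ((s - x) powr (\<alpha> - 1) / Gamma \<alpha>) / sqrt (c * (s powr (1 + 2 * \<alpha> - 1) / Gamma (1 + 2 * \<alpha>)))"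
    by (intro tendsto_divide tendsto_mult l1 l2 tendsto_real_sqrt tendsto_const l3)
      (use G xs in \<open>auto simp: c_def\<close>)
  also have "sqrt (c * (s powr (1 + 2 * \<alpha> - 1) / Gamma (1 + 2 * \<alpha>))) = s powr \<alpha> / Gamma (1 + \<alpha>)"
  proof -
    have "c * (s powr (1 + 2 * \<alpha> - 1) / Gamma (1 + 2 * \<alpha>)) = (s powr \<alpha> / Gamma (1 + \<alpha>))\<^sup>2"
      using G by (simp add: c_def power_divide power2_eq_square powr_add[symmetric])
    then show ?thesis using G by simp
  qed
  also have "(x powr (1 + \<alpha> - 1) / Gamma (1 + \<alpha>)) * ((s - x) powr (\<alpha> - 1) / Gamma \<alpha>) / (s powr \<alpha> / Gamma (1 + \<alpha>))
      = limit_kernel \<alpha> x s"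
    using True G by (simp add: limit_kernel_def powr_minus divide_inverse mult_ac)
  finally have "(\<lambda>M. b1 M * b2 M / sqrt (c * b3 M)) \<longlonglongrightarrow> limit_kernel \<alpha> x s" .
  moreover have "\<forall>\<^sub>F M in sequentially. b1 M * b2 M / sqrt (c * b3 M) = chol_kernel \<alpha> M x s"
    using eventually_gt_at_top[of 0]
  proof eventually_elim
    case (elim M)
    have m: "real M powr \<alpha> > 0" "real M powr (\<alpha> - 1) > 0" using elim by auto
    have "real M powr (2 * \<alpha>) = (real M powr \<alpha>)\<^sup>2"
      by (simp add: powr_add[symmetric] power2_eq_square)
    then have s: "sqrt (c * b3 M) = sqrt (opoly_norm \<alpha> (cell M s)) / real M powr \<alpha>"
      by (simp add: b3_def opoly_norm_def c_def real_sqrt_divide real_sqrt_mult)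
    have "real M powr (\<alpha> - 1) * real M powr (1 - \<alpha>) = 1" using elim by (simp add: powr_add[symmetric])
    then have e: "real M powr (1 - \<alpha>) = 1 / real M powr (\<alpha> - 1)" using m by (simp add: field_simps)
    show ?case
      unfolding s chol_kernel_def chol_factor_def e using m le[of M]
      by (simp add: opoly_coeff_def b1_def b2_def)
  qed
  ultimately show ?thesis by (simp add: tendsto_cong)
qed

section \<open>Norms of nonnegative kernels\<close>

context sigma_finite_measure
begin

text \<open>Test functions are nonnegative and may be infinite: for nonnegative kernels this yields
  the usual operator norm, while Tonelli and Cauchy--Schwarz hold without side conditions.\<close>

definition unit_ball :: "('a \<Rightarrow> ennreal) set" where
  "unit_ball = {f \<in> borel_measurable M. (\<integral>\<^sup>+x. (f x)\<^sup>2 \<partial>M) \<le> 1}"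

definition kbil :: "('a \<Rightarrow> 'a \<Rightarrow> ennreal) \<Rightarrow> ('a \<Rightarrow> ennreal) \<Rightarrow> ('a \<Rightarrow> ennreal) \<Rightarrow> ennreal" where
  "kbil k f g = (\<integral>\<^sup>+x. \<integral>\<^sup>+y. k x y * f x * g y \<partial>M \<partial>M)"

definition knorm :: "('a \<Rightarrow> 'a \<Rightarrow> ennreal) \<Rightarrow> ennreal" where
  "knorm k = (SUP p \<in> unit_ball \<times> unit_ball. kbil k (fst p) (snd p))"

lemma unit_ballD: "f \<in> unit_ball \<Longrightarrow> f \<in> borel_measurable M" "f \<in> unit_ball \<Longrightarrow> (\<integral>\<^sup>+x. (f x)\<^sup>2 \<partial>M) \<le> 1"
  by (auto simp: unit_ball_def)

lemma unit_ballI: "f \<in> borel_measurable M \<Longrightarrow> (\<integral>\<^sup>+x. (f x)\<^sup>2 \<partial>M) \<le> 1 \<Longrightarrow> f \<in> unit_ball"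
  by (auto simp: unit_ball_def)

lemma kbil_le_knorm: "f \<in> unit_ball \<Longrightarrow> g \<in> unit_ball \<Longrightarrow> kbil k f g \<le> knorm k"
  unfolding knorm_def by (rule SUP_upper2[of "(f, g)"]) auto

lemma knorm_least: "(\<And>f g. f \<in> unit_ball \<Longrightarrow> g \<in> unit_ball \<Longrightarrow> kbil k f g \<le> B) \<Longrightarrow> knorm k \<le> B"
  unfolding knorm_def by (rule SUP_least) auto

text \<open>Domination rather than equality is assumed, so that two kernels and the absolute value
  of their difference fit.\<close>

lemma knorm_triangle:
  assumes m[measurable]: "case_prod k1 \<in> borel_measurable (M \<Otimes>\<^sub>M M)" "case_prod k2 \<in> borel_measurable (M \<Otimes>\<^sub>M M)"
    and le: "\<And>x y. x \<in> space M \<Longrightarrow> y \<in> space M \<Longrightarrow> k x y \<le> k1 x y + k2 x y"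
  shows "knorm k \<le> knorm k1 + knorm k2"
proof (rule knorm_least)
  fix f g assume fg: "f \<in> unit_ball" "g \<in> unit_ball"
  note [measurable] = unit_ballD(1)[OF fg(1)] unit_ballD(1)[OF fg(2)]
  have "kbil k f g \<le> (\<integral>\<^sup>+x. \<integral>\<^sup>+y. k1 x y * f x * g y + k2 x y * f x * g y \<partial>M \<partial>M)"
    unfolding kbil_def distrib_right[symmetric]
    by (intro nn_integral_mono mult_right_mono le) auto
  also have "\<dots> = (\<integral>\<^sup>+x. (\<integral>\<^sup>+y. k1 x y * f x * g y \<partial>M) + (\<integral>\<^sup>+y. k2 x y * f x * g y \<partial>M) \<partial>M)"
    by (intro nn_integral_cong nn_integral_add) simp_all
  also have "\<dots> = kbil k1 f g + kbil k2 f g"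
    unfolding kbil_def by (intro nn_integral_add) simp_all
  also have "\<dots> \<le> knorm k1 + knorm k2" by (intro add_mono kbil_le_knorm fg)
  finally show "kbil k f g \<le> knorm k1 + knorm k2" .
qed

lemma nn_integral_swap:
  assumes "case_prod k \<in> borel_measurable (M \<Otimes>\<^sub>M M)"
  shows "(\<integral>\<^sup>+x. \<integral>\<^sup>+y. k x y \<partial>M \<partial>M) = (\<integral>\<^sup>+y. \<integral>\<^sup>+x. k x y \<partial>M \<partial>M)"
proof -
  interpret pair_sigma_finite M M by unfold_locales
  show ?thesis using Fubini'[OF assms] by simp
qed

lemma kbil_swap:
  assumes m[measurable]: "case_prod k \<in> borel_measurable (M \<Otimes>\<^sub>M M)"
    and [measurable]: "f \<in> borel_measurable M" "g \<in> borel_measurable M"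
  shows "kbil k f g = kbil (\<lambda>x y. k y x) g f"
  unfolding kbil_def by (subst nn_integral_swap) (simp_all add: mult_ac)

text \<open>Passing to the transpose is what lets \<open>adjoint_bound\<close>, a statement about
  K^T, be used for K as well.\<close>

lemma knorm_swap:
  assumes m[measurable]: "case_prod k \<in> borel_measurable (M \<Otimes>\<^sub>M M)"
  shows "knorm (\<lambda>x y. k y x) = knorm k"
proof (rule antisym)
  show "knorm (\<lambda>x y. k y x) \<le> knorm k"
    by (rule knorm_least, subst kbil_swap[symmetric]) (auto intro: kbil_le_knorm dest: unit_ballD)
  show "knorm k \<le> knorm (\<lambda>x y. k y x)"
    by (rule knorm_least, subst kbil_swap) (auto intro: kbil_le_knorm dest: unit_ballD)
qed

lemma ennreal_mult_le_squares: "(a::ennreal) * b \<le> a\<^sup>2 + b\<^sup>2"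
proof (cases "a \<le> b")
  case True
  then have "a * b \<le> b * b" by (rule mult_right_mono) simp
  then show ?thesis by (simp add: power2_eq_square add_increasing)
next
  case False
  then have "a * b \<le> a * a" by (intro mult_left_mono) auto
  then show ?thesis by (simp add: power2_eq_square add_increasing2)
qed

text \<open>The Schur test with constant weights. Bounding the product of the test functions by the
  sum of their squares doubles the constant, which is harmless where the bound can be made
  arbitrarily small.\<close>

lemma knorm_schur:
  assumes m[measurable]: "case_prod k \<in> borel_measurable (M \<Otimes>\<^sub>M M)"
    and 1: "\<And>x. x \<in> space M \<Longrightarrow> (\<integral>\<^sup>+y. k x y \<partial>M) \<le> B"
    and 2: "\<And>y. y \<in> space M \<Longrightarrow> (\<integral>\<^sup>+x. k x y \<partial>M) \<le> B"
  shows "knorm k \<le> B + B"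
proof (rule knorm_least)
  fix f g assume fg: "f \<in> unit_ball" "g \<in> unit_ball"
  note [measurable] = unit_ballD(1)[OF fg(1)] unit_ballD(1)[OF fg(2)]
  have a: "(\<integral>\<^sup>+x. \<integral>\<^sup>+y. k x y * (f x)\<^sup>2 \<partial>M \<partial>M) \<le> B"
  proof -
    have "(\<integral>\<^sup>+x. \<integral>\<^sup>+y. k x y * (f x)\<^sup>2 \<partial>M \<partial>M) = (\<integral>\<^sup>+x. (\<integral>\<^sup>+y. k x y \<partial>M) * (f x)\<^sup>2 \<partial>M)"
      by (intro nn_integral_cong nn_integral_multc) simp
    also have "\<dots> \<le> (\<integral>\<^sup>+x. B * (f x)\<^sup>2 \<partial>M)"
      by (intro nn_integral_mono mult_right_mono 1) auto
    also have "\<dots> = B * (\<integral>\<^sup>+x. (f x)\<^sup>2 \<partial>M)" by (rule nn_integral_cmult) simp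
    also have "\<dots> \<le> B * 1" using fg by (intro mult_left_mono unit_ballD) auto
    finally show ?thesis by simp
  qed
  have b: "(\<integral>\<^sup>+x. \<integral>\<^sup>+y. k x y * (g y)\<^sup>2 \<partial>M \<partial>M) \<le> B"
  proof -
    have "(\<integral>\<^sup>+x. \<integral>\<^sup>+y. k x y * (g y)\<^sup>2 \<partial>M \<partial>M) = (\<integral>\<^sup>+y. \<integral>\<^sup>+x. k x y * (g y)\<^sup>2 \<partial>M \<partial>M)"
      by (rule nn_integral_swap) simp
    also have "\<dots> = (\<integral>\<^sup>+y. (\<integral>\<^sup>+x. k x y \<partial>M) * (g y)\<^sup>2 \<partial>M)"
      by (intro nn_integral_cong nn_integral_multc) simp
    also have "\<dots> \<le> (\<integral>\<^sup>+x. B * (g x)\<^sup>2 \<partial>M)"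
      by (intro nn_integral_mono mult_right_mono 2) auto
    also have "\<dots> = B * (\<integral>\<^sup>+x. (g x)\<^sup>2 \<partial>M)" by (rule nn_integral_cmult) simp
    also have "\<dots> \<le> B * 1" using fg by (intro mult_left_mono unit_ballD) auto
    finally show ?thesis by simp
  qed
  have "kbil k f g \<le> (\<integral>\<^sup>+x. \<integral>\<^sup>+y. k x y * (f x)\<^sup>2 + k x y * (g y)\<^sup>2 \<partial>M \<partial>M)"
    unfolding kbil_def distrib_left[symmetric] mult.assoc
    by (intro nn_integral_mono mult_left_mono ennreal_mult_le_squares) auto
  also have "\<dots> = (\<integral>\<^sup>+x. (\<integral>\<^sup>+y. k x y * (f x)\<^sup>2 \<partial>M) + (\<integral>\<^sup>+y. k x y * (g y)\<^sup>2 \<partial>M) \<partial>M)"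
    by (intro nn_integral_cong nn_integral_add) simp_all
  also have "\<dots> = (\<integral>\<^sup>+x. \<integral>\<^sup>+y. k x y * (f x)\<^sup>2 \<partial>M \<partial>M) + (\<integral>\<^sup>+x. \<integral>\<^sup>+y. k x y * (g y)\<^sup>2 \<partial>M \<partial>M)"
    by (intro nn_integral_add) simp_all
  also have "\<dots> \<le> B + B" using a b by (rule add_mono)
  finally show "kbil k f g \<le> B + B" .
qed

text \<open>Cauchy--Schwarz on the product space, where (x, y) \<mapsto> \<open>f x * g y\<close>
  has norm at most 1.\<close>

lemma kbil_hilbert_schmidt:
  assumes m[measurable]: "case_prod k \<in> borel_measurable (M \<Otimes>\<^sub>M M)"
    and fg: "f \<in> unit_ball" "g \<in> unit_ball"
  shows "(kbil k f g)\<^sup>2 \<le> (\<integral>\<^sup>+p. (k (fst p) (snd p))\<^sup>2 \<partial>(M \<Otimes>\<^sub>M M))"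
proof -
  note [measurable] = unit_ballD(1)[OF fg(1)] unit_ballD(1)[OF fg(2)]
  have km[measurable]: "(\<lambda>p. k (fst p) (snd p)) \<in> borel_measurable (M \<Otimes>\<^sub>M M)"
    using m by (simp add: split_beta')
  have "kbil k f g = (\<integral>\<^sup>+p. k (fst p) (snd p) * (f (fst p) * g (snd p)) \<partial>(M \<Otimes>\<^sub>M M))"
    unfolding kbil_def by (subst nn_integral_fst[symmetric]) (simp_all add: mult_ac)
  then have le: "(kbil k f g)\<^sup>2 \<le> (\<integral>\<^sup>+p. (k (fst p) (snd p))\<^sup>2 \<partial>(M \<Otimes>\<^sub>M M))
      * (\<integral>\<^sup>+p. (f (fst p) * g (snd p))\<^sup>2 \<partial>(M \<Otimes>\<^sub>M M))"
    by (simp only:) (rule Cauchy_Schwarz_nn_integral; simp)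
  have "(\<integral>\<^sup>+p. (f (fst p) * g (snd p))\<^sup>2 \<partial>(M \<Otimes>\<^sub>M M))
      = (\<integral>\<^sup>+x. (f x)\<^sup>2 * (\<integral>\<^sup>+y. (g y)\<^sup>2 \<partial>M) \<partial>M)"
    by (subst nn_integral_fst[symmetric]) (simp_all add: power_mult_distrib nn_integral_cmult)
  also have "\<dots> \<le> (\<integral>\<^sup>+x. (f x)\<^sup>2 * 1 \<partial>M)"
    using fg by (intro nn_integral_mono mult_left_mono unit_ballD) auto
  also have "\<dots> \<le> 1" using unit_ballD(2)[OF fg(1)] by simp
  finally have "(\<integral>\<^sup>+p. (f (fst p) * g (snd p))\<^sup>2 \<partial>(M \<Otimes>\<^sub>M M)) \<le> 1" .
  from order_trans[OF le mult_left_mono[OF this]] show ?thesis by simp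
qed

end

lemma ennreal_power2_le_iff: "(a::ennreal)\<^sup>2 \<le> b\<^sup>2 \<longleftrightarrow> a \<le> b"
proof
  assume "a\<^sup>2 \<le> b\<^sup>2"
  then show "a \<le> b"
  proof (cases b)
    case b: (real s)
    show ?thesis
    proof (cases a)
      case (real r)
      with \<open>a\<^sup>2 \<le> b\<^sup>2\<close> b have "r\<^sup>2 \<le> s\<^sup>2" by (simp add: ennreal_power)
      with b have "r \<le> s" by (blast intro: power2_le_imp_le)
      with b real show ?thesis by (simp add: ennreal_leI)
    next
      case top
      with \<open>a\<^sup>2 \<le> b\<^sup>2\<close> b show ?thesis by (simp add: ennreal_power top_unique)
    qed
  qed simp
qed (auto intro: power_mono)

context sigma_finite_measure
begin

lemma knorm_hilbert_schmidt:
  assumes m: "case_prod k \<in> borel_measurable (M \<Otimes>\<^sub>M M)"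
    and "(\<integral>\<^sup>+p. (k (fst p) (snd p))\<^sup>2 \<partial>(M \<Otimes>\<^sub>M M)) \<le> B\<^sup>2"
  shows "knorm k \<le> B"
  by (rule knorm_least)
    (use kbil_hilbert_schmidt[OF m] assms(2) in \<open>blast intro: ennreal_power2_le_iff[THEN iffD1] order_trans\<close>)

lemma kbil_eq_adjoint:
  assumes m[measurable]: "case_prod k \<in> borel_measurable (M \<Otimes>\<^sub>M M)"
    and [measurable]: "f \<in> borel_measurable M" "g \<in> borel_measurable M"
  shows "kbil k f g = (\<integral>\<^sup>+y. (\<integral>\<^sup>+x. k x y * f x \<partial>M) * g y \<partial>M)"
  unfolding kbil_def
  by (subst nn_integral_swap) (auto intro!: nn_integral_cong nn_integral_multc)

lemma kbil_scale_right:
  assumes m[measurable]: "case_prod k \<in> borel_measurable (M \<Otimes>\<^sub>M M)"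
    and [measurable]: "f \<in> borel_measurable M" "g \<in> borel_measurable M"
  shows "kbil k f (\<lambda>y. c * g y) = c * kbil k f g"
proof -
  have "kbil k f (\<lambda>y. c * g y) = (\<integral>\<^sup>+y. c * ((\<integral>\<^sup>+x. k x y * f x \<partial>M) * g y) \<partial>M)"
    by (subst kbil_eq_adjoint) (simp_all add: mult_ac)
  also have "\<dots> = c * kbil k f g"
    by (subst kbil_eq_adjoint) (simp_all add: nn_integral_cmult)
  finally show ?thesis .
qed

lemma unit_ball_scale:
  assumes [measurable]: "g \<in> borel_measurable M" and "(\<integral>\<^sup>+x. (g x)\<^sup>2 \<partial>M) \<le> ennreal (c\<^sup>2)" "0 < c"
  shows "(\<lambda>x. ennreal (1 / c) * g x) \<in> unit_ball"
proof (rule unit_ballI)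
  have "(\<integral>\<^sup>+x. (ennreal (1 / c) * g x)\<^sup>2 \<partial>M) = (ennreal (1 / c))\<^sup>2 * (\<integral>\<^sup>+x. (g x)\<^sup>2 \<partial>M)"
    by (simp add: power_mult_distrib nn_integral_cmult)
  also have "\<dots> \<le> (ennreal (1 / c))\<^sup>2 * ennreal (c\<^sup>2)" using assms by (intro mult_left_mono) auto
  also have "\<dots> = 1" using assms by (simp add: ennreal_power ennreal_mult[symmetric] power_divide)
  finally show "(\<integral>\<^sup>+x. (ennreal (1 / c) * g x)\<^sup>2 \<partial>M) \<le> 1" .
qed simp

lemma kbil_le_scaled:
  assumes m[measurable]: "case_prod k \<in> borel_measurable (M \<Otimes>\<^sub>M M)"
    and f: "f \<in> unit_ball"
    and g[measurable]: "g \<in> borel_measurable M" and gc: "(\<integral>\<^sup>+x. (g x)\<^sup>2 \<partial>M) \<le> ennreal (c\<^sup>2)" and c: "0 < c"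
  shows "kbil k f g \<le> ennreal c * knorm k"
proof -
  note [measurable] = unit_ballD(1)[OF f]
  have "kbil k f g = ennreal c * (ennreal (1 / c) * kbil k f g)"
    using c by (simp add: mult.assoc[symmetric] ennreal_mult[symmetric])
  also have "ennreal (1 / c) * kbil k f g = kbil k f (\<lambda>x. ennreal (1 / c) * g x)"
    by (rule kbil_scale_right[symmetric]) auto
  also have "ennreal c * \<dots> \<le> ennreal c * knorm k"
    by (intro mult_left_mono kbil_le_knorm f unit_ball_scale[OF g gc c]) auto
  finally show ?thesis .
qed

end

text \<open>Testing against truncations of \<open>K\<^sup>T f\<close>, since \<open>K\<^sup>T f\<close> is not known to be square integrable.\<close>

lemma (in finite_measure) adjoint_bound:
  assumes m[measurable]: "case_prod k \<in> borel_measurable (M \<Otimes>\<^sub>M M)"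
    and f: "f \<in> unit_ball"
  shows "(\<integral>\<^sup>+y. (\<integral>\<^sup>+x. k x y * f x \<partial>M)\<^sup>2 \<partial>M) \<le> (knorm k)\<^sup>2"
proof -
  note [measurable] = unit_ballD(1)[OF f]
  define h where "h y = (\<integral>\<^sup>+x. k x y * f x \<partial>M)" for y
  have h[measurable]: "h \<in> borel_measurable M" unfolding h_def by simp
  have trunc: "(\<integral>\<^sup>+y. (min (h y) (of_nat n))\<^sup>2 \<partial>M) \<le> (knorm k)\<^sup>2" for n
  proof -
    define I where "I = (\<integral>\<^sup>+y. (min (h y) (of_nat n))\<^sup>2 \<partial>M)"
    \<comment> \<open>The truncation is bounded and the measure finite, so I is finite and its root
      can be divided out below.\<close>
    have "I \<le> (\<integral>\<^sup>+y. (of_nat n)\<^sup>2 \<partial>M)" unfolding I_def by (intro nn_integral_mono power_mono) auto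
    also have "\<dots> < \<infinity>"
      by (simp add: ennreal_mult_less_top emeasure_eq_measure power_less_top_ennreal ennreal_of_nat_eq_real_of_nat)
    finally obtain r where r: "I = ennreal r" "0 \<le> r" by (cases I) auto
    show ?thesis
    proof (cases "r = 0")
      case True
      then show ?thesis using r by (simp add: I_def)
    next
      case False
      define c where "c = sqrt r"
      have c: "c > 0" "r = c\<^sup>2" using r False by (auto simp: c_def)
      \<comment> \<open>With c^2 = I the truncation has norm c, so testing with it gives c^2 \<le> c
        * \<open>knorm k\<close>.\<close>
      have "I \<le> (\<integral>\<^sup>+y. h y * min (h y) (of_nat n) \<partial>M)"
        unfolding I_def power2_eq_square by (intro nn_integral_mono mult_right_mono) auto
      also have "\<dots> = kbil k f (\<lambda>y. min (h y) (of_nat n))"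
        by (subst kbil_eq_adjoint) (auto simp: h_def)
      also have "\<dots> \<le> ennreal c * knorm k"
        using r c by (intro kbil_le_scaled f) (auto simp: I_def)
      finally have "ennreal c * ennreal c \<le> ennreal c * knorm k"
        using r c by (simp add: power2_eq_square ennreal_mult)
      then have "ennreal (1 / c) * (ennreal c * ennreal c) \<le> ennreal (1 / c) * (ennreal c * knorm k)"
        by (rule mult_left_mono) simp
      then have "ennreal c \<le> knorm k"
        using c by (simp add: mult.assoc[symmetric] ennreal_mult[symmetric])
      then have "(ennreal c)\<^sup>2 \<le> (knorm k)\<^sup>2" by (rule power_mono) simp
      then show ?thesis using r c by (simp add: I_def ennreal_power)
    qed
  qed
  have "(SUP n. (min (h y) (of_nat n))\<^sup>2) = (h y)\<^sup>2" for y
  proof (rule antisym)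
    show "(SUP n. (min (h y) (of_nat n))\<^sup>2) \<le> (h y)\<^sup>2" by (intro SUP_least power_mono) auto
    show "(h y)\<^sup>2 \<le> (SUP n. (min (h y) (of_nat n))\<^sup>2)"
    proof (cases "h y")
      case (real r)
      obtain n where "r \<le> real n" using real_arch_simple by blast
      then have "h y \<le> of_nat n" by (simp add: real(2) ennreal_of_nat_eq_real_of_nat ennreal_leI)
      then have "min (h y) (of_nat n) = h y" by (rule min_absorb1)
      then show ?thesis by (intro SUP_upper2[of n]) simp_all
    next
      case top
      have "(of_nat n :: ennreal) \<le> (of_nat n)\<^sup>2" for n
        unfolding of_nat_power[symmetric] by (intro of_nat_mono) (simp add: power2_eq_square)
      then have "(SUP n. of_nat n :: ennreal) \<le> (SUP n. (of_nat n)\<^sup>2)" by (intro SUP_mono) auto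
      then show ?thesis using top by (simp add: ennreal_SUP_of_nat_eq_top top_unique)
    qed
  qed
  then have "(\<integral>\<^sup>+y. (h y)\<^sup>2 \<partial>M) = (\<integral>\<^sup>+y. (SUP n. (min (h y) (of_nat n))\<^sup>2) \<partial>M)" by simp
  also have "\<dots> = (SUP n. \<integral>\<^sup>+y. (min (h y) (of_nat n))\<^sup>2 \<partial>M)"
    by (intro nn_integral_monotone_convergence_SUP)
      (auto simp: incseq_def le_fun_def intro!: power_mono min.mono)
  also have "\<dots> \<le> (knorm k)\<^sup>2" by (intro SUP_least trunc)
  finally show ?thesis by (simp add: h_def)
qed

section \<open>Convergence of weakly singular kernels\<close>

definition unit_interval :: "real measure" where
  "unit_interval = restrict_space lborel {0<..<1}"

lemma space_unit_interval [simp]: "space unit_interval = {0<..<1}"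
  by (simp add: unit_interval_def space_restrict_space)

lemma emeasure_unit_interval: "A \<in> sets borel \<Longrightarrow> A \<subseteq> {0<..<1} \<Longrightarrow> emeasure unit_interval A = emeasure lborel A"
  by (simp add: unit_interval_def emeasure_restrict_space)

lemma measurable_unit_interval: "f \<in> borel_measurable borel \<Longrightarrow> f \<in> borel_measurable unit_interval"
  by (simp add: unit_interval_def measurable_restrict_space1)

lemma nn_integral_unit_interval:
  "(\<integral>\<^sup>+x. f x \<partial>unit_interval) = (\<integral>\<^sup>+x. f x * indicator {0<..<1} x \<partial>lborel)"
  by (simp add: unit_interval_def nn_integral_restrict_space)

interpretation unit_interval: finite_measure unit_interval
  by (rule finite_measureI) (simp add: emeasure_unit_interval)

lemma ident_measurable_unit_interval [measurable]: "(\<lambda>x. x) \<in> unit_interval \<rightarrow>\<^sub>M borel"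
  by (simp add: unit_interval_def measurable_restrict_space1)

lemma measurable_pair_unit_interval:
  assumes "case_prod k \<in> borel_measurable (borel \<Otimes>\<^sub>M borel)"
  shows "case_prod k \<in> borel_measurable (unit_interval \<Otimes>\<^sub>M unit_interval)"
proof -
  have "(\<lambda>p. (fst p, snd p)) \<in> (unit_interval \<Otimes>\<^sub>M unit_interval) \<rightarrow>\<^sub>M (borel \<Otimes>\<^sub>M borel)"
    by (intro measurable_Pair measurable_compose[OF measurable_fst ident_measurable_unit_interval]
        measurable_compose[OF measurable_snd ident_measurable_unit_interval])
  from measurable_compose[OF this assms] show ?thesis by simp
qed

lemma cell_measurable [measurable]: "cell n \<in> borel \<rightarrow>\<^sub>M count_space UNIV"
  unfolding cell_def by measurable

lemma cell_kernel_measurable: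
  fixes c :: "nat \<Rightarrow> nat \<Rightarrow> 'a::topological_space"
  shows "(\<lambda>(x, y). c (cell n x) (cell n y)) \<in> borel_measurable (borel \<Otimes>\<^sub>M borel)"
proof -
  have "(\<lambda>p. c i (cell n (snd p))) \<in> borel_measurable (borel \<Otimes>\<^sub>M borel)" for i
    by (rule measurable_compose[where N = "count_space UNIV" and f = "\<lambda>p. cell n (snd p)"]) auto
  then have "(\<lambda>p. c (cell n (fst p)) (cell n (snd p))) \<in> borel_measurable (borel \<Otimes>\<^sub>M borel)"
    by (rule measurable_compose_countable) measurable
  then show ?thesis by (simp add: split_beta')
qed

lemma chol_kernel_measurable:
  "(\<lambda>(x, y). chol_kernel \<alpha> n x y) \<in> borel_measurable (borel \<Otimes>\<^sub>M borel)"
  unfolding chol_kernel_def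
  using cell_kernel_measurable[of "\<lambda>k t. real n powr (1 - \<alpha>) * chol_factor \<alpha> k t" n] .

lemma limit_kernel_measurable:
  "(\<lambda>(x, y). limit_kernel \<alpha> x y) \<in> borel_measurable (borel \<Otimes>\<^sub>M borel)"
  unfolding limit_kernel_def by measurable

definition near_kernel :: "real \<Rightarrow> real \<Rightarrow> real \<Rightarrow> real \<Rightarrow> ennreal" where
  "near_kernel \<alpha> \<delta> x y = ennreal (\<bar>y - x\<bar> powr (\<alpha> - 1)) * indicator {u. \<bar>u\<bar> < \<delta>} (y - x)"

text \<open>Translation reduces to two copies of the integral of u^(\<alpha> - 1) from 0 to
  \<delta>. The bound does not depend on x, as the Schur test requires.\<close>

lemma nn_integral_near_kernel:
  assumes \<alpha>: "0 < \<alpha>" and \<delta>: "0 \<le> \<delta>"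
  shows "(\<integral>\<^sup>+y. near_kernel \<alpha> \<delta> x y \<partial>unit_interval) \<le> ennreal (2 * \<delta> powr \<alpha> / \<alpha>)"
proof -
  have I: "(\<integral>\<^sup>+u. ennreal (u powr (\<alpha> - 1)) * indicator {0..\<delta>} u \<partial>lborel) = ennreal (\<delta> powr \<alpha> / \<alpha>)"
    using nn_integral_has_integral_lebesgue'[OF _ has_integral_powr_from_0[of "\<alpha> - 1" \<delta>]] \<alpha> \<delta> by simp
  have "(\<integral>\<^sup>+y. near_kernel \<alpha> \<delta> x y \<partial>unit_interval) \<le> (\<integral>\<^sup>+y. near_kernel \<alpha> \<delta> x y \<partial>lborel)"
    unfolding nn_integral_unit_interval by (intro nn_integral_mono) (auto split: split_indicator)
  also have "\<dots> = (\<integral>\<^sup>+u. ennreal (\<bar>u\<bar> powr (\<alpha> - 1)) * indicator {u. \<bar>u\<bar> < \<delta>} u \<partial>lborel)"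
    unfolding near_kernel_def by (subst nn_integral_real_affine[where c = 1 and t = x]) simp_all
  also have "\<dots> \<le> (\<integral>\<^sup>+u. ennreal (u powr (\<alpha> - 1)) * indicator {0..\<delta>} u
      + ennreal ((- u) powr (\<alpha> - 1)) * indicator {0..\<delta>} (- u) \<partial>lborel)"
    by (intro nn_integral_mono) (auto split: split_indicator)
  also have "\<dots> = (\<integral>\<^sup>+u. ennreal (u powr (\<alpha> - 1)) * indicator {0..\<delta>} u \<partial>lborel)
      + (\<integral>\<^sup>+u. ennreal ((- u) powr (\<alpha> - 1)) * indicator {0..\<delta>} (- u) \<partial>lborel)"
    by (rule nn_integral_add) simp_all
  also have "(\<integral>\<^sup>+u. ennreal ((- u) powr (\<alpha> - 1)) * indicator {0..\<delta>} (- u) \<partial>lborel)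
      = (\<integral>\<^sup>+u. ennreal (u powr (\<alpha> - 1)) * indicator {0..\<delta>} u \<partial>lborel)"
    by (subst (2) nn_integral_real_affine[where c = "-1" and t = 0]) simp_all
  finally show ?thesis using \<alpha> unfolding I by (simp add: ennreal_plus[symmetric] del: ennreal_plus)
qed

lemma near_kernel_commute: "near_kernel \<alpha> \<delta> x y = near_kernel \<alpha> \<delta> y x"
proof -
  have "\<bar>y - x\<bar> = \<bar>x - y\<bar>" by (rule abs_minus_commute)
  then show ?thesis by (simp add: near_kernel_def indicator_def)
qed

lemma AE_unit_interval_neq: "AE y in unit_interval. y \<noteq> x"
proof -
  have "AE y in lborel. y \<noteq> x" by (rule AE_lborel_singleton)
  then show ?thesis unfolding unit_interval_def
    by (subst AE_restrict_space_iff) auto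
qed

lemma knorm_near_diagonal:
  assumes \<alpha>: "0 < \<alpha>" and \<delta>: "0 \<le> \<delta>" and C: "0 \<le> C"
    and m: "case_prod k \<in> borel_measurable (unit_interval \<Otimes>\<^sub>M unit_interval)"
    and le: "\<And>x y. x \<in> {0<..<1} \<Longrightarrow> y \<in> {0<..<1} \<Longrightarrow> x \<noteq> y \<Longrightarrow> k x y \<le> ennreal C * near_kernel \<alpha> \<delta> x y"
  shows "unit_interval.knorm k \<le> ennreal (4 * C * \<delta> powr \<alpha> / \<alpha>)"
proof -
  let ?B = "ennreal C * ennreal (2 * \<delta> powr \<alpha> / \<alpha>)"
  have nm: "(\<lambda>y. near_kernel \<alpha> \<delta> x y) \<in> borel_measurable unit_interval" for x
    unfolding near_kernel_def by measurable
  have bound: "(\<integral>\<^sup>+y. h y \<partial>unit_interval) \<le> ?B"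
    if "x \<in> {0<..<1}" and "\<And>y. y \<in> {0<..<1} \<Longrightarrow> y \<noteq> x \<Longrightarrow> h y \<le> ennreal C * near_kernel \<alpha> \<delta> x y" for x h
  proof -
    have "(\<integral>\<^sup>+y. h y \<partial>unit_interval) \<le> (\<integral>\<^sup>+y. ennreal C * near_kernel \<alpha> \<delta> x y \<partial>unit_interval)"
    proof (rule nn_integral_mono_AE)
      \<comment> \<open>At y = x the value of \<open>near_kernel\<close> is 0, because
        \<open>0 powr (\<alpha> - 1)\<close> is 0; the bound is available off this null set
        only.\<close>
      show "AE y in unit_interval. h y \<le> ennreal C * near_kernel \<alpha> \<delta> x y"
        using AE_unit_interval_neq[of x] AE_space by eventually_elim (use that in auto)
    qed
    also have "\<dots> \<le> ?B"
      by (subst nn_integral_cmult[OF nm]) (intro mult_left_mono nn_integral_near_kernel \<alpha> \<delta>, simp)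
    finally show ?thesis .
  qed
  have "unit_interval.knorm k \<le> ?B + ?B"
  proof (rule unit_interval.knorm_schur[OF m])
    show "(\<integral>\<^sup>+y. k x y \<partial>unit_interval) \<le> ?B" if "x \<in> space unit_interval" for x
      using that le by (intro bound[of x]) auto
    show "(\<integral>\<^sup>+x. k x y \<partial>unit_interval) \<le> ?B" if "y \<in> space unit_interval" for y
    proof (rule bound)
      show "y \<in> {0<..<1}" using that by simp
      show "k x y \<le> ennreal C * near_kernel \<alpha> \<delta> y x" if "x \<in> {0<..<1}" "x \<noteq> y" for x
        using le[of x y] that \<open>y \<in> space unit_interval\<close> near_kernel_commute[of \<alpha> \<delta> x y] by simp
    qed
  qed
  also have "?B + ?B = ennreal (4 * C * \<delta> powr \<alpha> / \<alpha>)"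
    using \<alpha> C by (simp add: ennreal_mult[symmetric] ennreal_plus[symmetric] del: ennreal_plus)
  finally show ?thesis .
qed

text \<open>The strip is estimated by the Schur test, uniformly in n. Outside it the kernels are
  bounded by C \<delta>^(\<alpha> - 1), a constant on a space of measure 1, so dominated convergence
  applies to their squares. The width \<delta> is fixed before n is taken large.\<close>

lemma knorm_weakly_singular_tendsto_0:
  fixes d :: "nat \<Rightarrow> real \<Rightarrow> real \<Rightarrow> real"
  assumes \<alpha>: "0 < \<alpha>" "\<alpha> < 1" and C: "0 \<le> C"
    and m: "\<And>n. case_prod (d n) \<in> borel_measurable (borel \<Otimes>\<^sub>M borel)"
    and nonneg: "\<And>n x y. 0 \<le> d n x y"
    and bound: "\<And>n x y. 0 < n \<Longrightarrow> x \<in> {0<..<1} \<Longrightarrow> y \<in> {0<..<1} \<Longrightarrow> x \<noteq> y \<Longrightarrow> d n x y \<le> C * \<bar>y - x\<bar> powr (\<alpha> - 1)"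
    and lim: "\<And>x y. x \<in> {0<..<1} \<Longrightarrow> y \<in> {0<..<1} \<Longrightarrow> x \<noteq> y \<Longrightarrow> (\<lambda>n. d n x y) \<longlonglongrightarrow> 0"
    and \<epsilon>: "0 < \<epsilon>"
  shows "\<forall>\<^sub>F n in sequentially. unit_interval.knorm (\<lambda>x y. ennreal (d n x y)) \<le> ennreal \<epsilon>"
proof -
  \<comment> \<open>Solves 4 (C + 1) \<delta>^\<alpha> / \<alpha> = \<epsilon> / 2; C + 1 avoids a
    division by 0 when C = 0.\<close>
  define \<delta> where "\<delta> = (\<epsilon> * \<alpha> / (8 * (C + 1))) powr (1 / \<alpha>)"
  have \<delta>: "0 < \<delta>" using \<epsilon> \<alpha> C by (simp add: \<delta>_def)
  have "\<delta> powr \<alpha> = \<epsilon> * \<alpha> / (8 * (C + 1))" using \<epsilon> \<alpha> C by (simp add: \<delta>_def powr_powr)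
  then have "4 * (C + 1) * \<delta> powr \<alpha> / \<alpha> = \<epsilon> / 2"
    using \<alpha> C by (simp add: nonzero_divide_eq_eq nonzero_eq_divide_eq algebra_simps)
  moreover have "4 * C * \<delta> powr \<alpha> / \<alpha> \<le> 4 * (C + 1) * \<delta> powr \<alpha> / \<alpha>"
    using \<alpha> C by (intro divide_right_mono mult_right_mono) auto
  ultimately have \<delta>\<epsilon>: "4 * C * \<delta> powr \<alpha> / \<alpha> \<le> \<epsilon> / 2" by simp
  define I where "I x y = (indicator {u. \<bar>u\<bar> < \<delta>} (y - x) :: ennreal)" for x y :: real
  define J where "J x y = (indicator {u. \<delta> \<le> \<bar>u\<bar>} (y - x) :: ennreal)" for x y :: real
  define k1 where "k1 n x y = ennreal (d n x y) * I x y" for n x y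
  define k2 where "k2 n x y = ennreal (d n x y) * J x y" for n x y
  have [measurable]: "(\<lambda>p. d n (fst p) (snd p)) \<in> borel_measurable (borel \<Otimes>\<^sub>M borel)" for n
    using m[of n] by (simp add: split_beta')
  have m1: "case_prod (k1 n) \<in> borel_measurable (unit_interval \<Otimes>\<^sub>M unit_interval)" for n
    by (rule measurable_pair_unit_interval) (simp add: k1_def I_def split_beta')
  have m2: "case_prod (k2 n) \<in> borel_measurable (unit_interval \<Otimes>\<^sub>M unit_interval)" for n
    by (rule measurable_pair_unit_interval) (simp add: k2_def J_def split_beta')
  have m2': "(\<lambda>p. (k2 n (fst p) (snd p))\<^sup>2) \<in> borel_measurable (unit_interval \<Otimes>\<^sub>M unit_interval)" for n
    using m2[of n] by (simp add: split_beta')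
  have n1: "unit_interval.knorm (k1 n) \<le> ennreal (\<epsilon> / 2)" if "0 < n" for n
  proof -
    have "unit_interval.knorm (k1 n) \<le> ennreal (4 * C * \<delta> powr \<alpha> / \<alpha>)"
    proof (rule knorm_near_diagonal[OF \<alpha>(1) _ C m1])
      fix x y :: real assume "x \<in> {0<..<1}" "y \<in> {0<..<1}" "x \<noteq> y"
      then have "ennreal (d n x y) \<le> ennreal C * ennreal (\<bar>y - x\<bar> powr (\<alpha> - 1))"
        using bound[OF that] C by (simp add: ennreal_mult[symmetric] ennreal_leI)
      then show "k1 n x y \<le> ennreal C * near_kernel \<alpha> \<delta> x y"
        by (simp add: k1_def I_def near_kernel_def mult.assoc[symmetric] mult_right_mono)
    qed (use \<delta> in simp)
    also have "\<dots> \<le> ennreal (\<epsilon> / 2)" using \<delta>\<epsilon> by (rule ennreal_leI)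
    finally show ?thesis .
  qed
  define B where "B = C * \<delta> powr (\<alpha> - 1)"
  have "0 \<le> B" using C by (simp add: B_def)
  have k2B: "k2 n x y \<le> ennreal B" if "0 < n" "x \<in> {0<..<1}" "y \<in> {0<..<1}" for n x y
  proof (cases "\<delta> \<le> \<bar>y - x\<bar>")
    case True
    then have "x \<noteq> y" using \<delta> by auto
    have "d n x y \<le> C * \<bar>y - x\<bar> powr (\<alpha> - 1)" using bound that \<open>x \<noteq> y\<close> by blast
    also have "\<dots> \<le> B" unfolding B_def using True \<delta> \<alpha> C by (intro mult_left_mono powr_mono2') auto
    finally show ?thesis by (simp add: k2_def J_def ennreal_leI mult_le_one split: split_indicator)
  next
    case False
    then show ?thesis by (simp add: k2_def J_def)
  qed
  \<comment> \<open>Shifted to \<open>Suc n\<close>, since \<open>bound\<close> speaks of positive n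
    only and domination is required at every index.\<close>
  have "(\<lambda>n. \<integral>\<^sup>+p. (k2 (Suc n) (fst p) (snd p))\<^sup>2 \<partial>(unit_interval \<Otimes>\<^sub>M unit_interval)) \<longlonglongrightarrow>
      (\<integral>\<^sup>+p. 0 \<partial>(unit_interval \<Otimes>\<^sub>M unit_interval))"
  proof (rule nn_integral_dominated_convergence[where w = "\<lambda>_. ennreal (B\<^sup>2)"])
    have "emeasure (unit_interval \<Otimes>\<^sub>M unit_interval) (space (unit_interval \<Otimes>\<^sub>M unit_interval)) = 1"
      unfolding space_pair_measure
      using sets.top[of unit_interval]
      by (subst unit_interval.emeasure_pair_measure_Times) (simp_all add: emeasure_unit_interval)
    then show "(\<integral>\<^sup>+p. ennreal (B\<^sup>2) \<partial>(unit_interval \<Otimes>\<^sub>M unit_interval)) < \<infinity>" by simp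
    show "AE p in unit_interval \<Otimes>\<^sub>M unit_interval. (k2 (Suc n) (fst p) (snd p))\<^sup>2 \<le> ennreal (B\<^sup>2)" for n
    proof (rule AE_I2)
      fix p assume "p \<in> space (unit_interval \<Otimes>\<^sub>M unit_interval)"
      then have "k2 (Suc n) (fst p) (snd p) \<le> ennreal B" by (intro k2B) (auto simp: space_pair_measure)
      then have "(k2 (Suc n) (fst p) (snd p))\<^sup>2 \<le> (ennreal B)\<^sup>2" by (rule power_mono) simp
      then show "(k2 (Suc n) (fst p) (snd p))\<^sup>2 \<le> ennreal (B\<^sup>2)" using \<open>0 \<le> B\<close> by (simp add: ennreal_power)
    qed
    show "AE p in unit_interval \<Otimes>\<^sub>M unit_interval. (\<lambda>n. (k2 (Suc n) (fst p) (snd p))\<^sup>2) \<longlonglongrightarrow> 0"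
    proof (rule AE_I2)
      fix p assume "p \<in> space (unit_interval \<Otimes>\<^sub>M unit_interval)"
      then obtain x y where p: "p = (x, y)" "x \<in> {0<..<1}" "y \<in> {0<..<1}" by (auto simp: space_pair_measure)
      show "(\<lambda>n. (k2 (Suc n) (fst p) (snd p))\<^sup>2) \<longlonglongrightarrow> 0"
      proof (cases "\<delta> \<le> \<bar>y - x\<bar>")
        case True
        then have "x \<noteq> y" using \<delta> by auto
        then have "(\<lambda>n. d (Suc n) x y) \<longlonglongrightarrow> 0" using lim p by (intro LIMSEQ_Suc) auto
        then have "(\<lambda>n. (d (Suc n) x y)\<^sup>2) \<longlonglongrightarrow> 0\<^sup>2" by (intro tendsto_power)
        then have "(\<lambda>n. ennreal ((d (Suc n) x y)\<^sup>2)) \<longlonglongrightarrow> ennreal 0" by (intro tendsto_ennrealI) simp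
        then show ?thesis using True nonneg by (simp add: k2_def J_def p ennreal_power)
      next
        case False
        then show ?thesis by (simp add: k2_def J_def p)
      qed
    qed
  qed (use m2' in auto)
  then have "(\<lambda>n. \<integral>\<^sup>+p. (k2 n (fst p) (snd p))\<^sup>2 \<partial>(unit_interval \<Otimes>\<^sub>M unit_interval)) \<longlonglongrightarrow> 0"
    by (subst filterlim_sequentially_Suc[symmetric]) simp
  moreover have "0 < ennreal ((\<epsilon> / 2)\<^sup>2)" using \<epsilon> by simp
  ultimately have "\<forall>\<^sub>F n in sequentially. (\<integral>\<^sup>+p. (k2 n (fst p) (snd p))\<^sup>2 \<partial>(unit_interval \<Otimes>\<^sub>M unit_interval)) < ennreal ((\<epsilon> / 2)\<^sup>2)"
    by (rule order_tendstoD(2))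
  then show ?thesis using eventually_gt_at_top[of 0]
  proof eventually_elim
    case (elim n)
    have "unit_interval.knorm (k2 n) \<le> ennreal (\<epsilon> / 2)"
    proof (rule unit_interval.knorm_hilbert_schmidt[OF m2])
      have "ennreal ((\<epsilon> / 2)\<^sup>2) = (ennreal (\<epsilon> / 2))\<^sup>2" using \<epsilon> by (intro ennreal_power[symmetric]) simp
      then show "(\<integral>\<^sup>+p. (k2 n (fst p) (snd p))\<^sup>2 \<partial>(unit_interval \<Otimes>\<^sub>M unit_interval)) \<le> (ennreal (\<epsilon> / 2))\<^sup>2"
        using elim(1) by simp
    qed
    moreover have "unit_interval.knorm (\<lambda>x y. ennreal (d n x y)) \<le> unit_interval.knorm (k1 n) + unit_interval.knorm (k2 n)"
      by (rule unit_interval.knorm_triangle[OF m1 m2]) (auto simp: k1_def k2_def I_def J_def split: split_indicator)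
    ultimately have "unit_interval.knorm (\<lambda>x y. ennreal (d n x y)) \<le> ennreal (\<epsilon> / 2) + ennreal (\<epsilon> / 2)"
      using n1[OF elim(2)] by (meson add_mono order_trans)
    then show ?case using \<epsilon> by (simp add: ennreal_plus[symmetric] del: ennreal_plus)
  qed
qed

section \<open>Convergence of the norms of the step kernels\<close>

abbreviation chol_knorm :: "real \<Rightarrow> nat \<Rightarrow> ennreal" where
  "chol_knorm \<alpha> n \<equiv> unit_interval.knorm (\<lambda>x y. ennreal (chol_kernel \<alpha> n x y))"

abbreviation limit_knorm :: "real \<Rightarrow> ennreal" where
  "limit_knorm \<alpha> \<equiv> unit_interval.knorm (\<lambda>x y. ennreal (limit_kernel \<alpha> x y))"

lemma kernels_measurable:
  "(\<lambda>(x, y). ennreal (chol_kernel \<alpha> n x y)) \<in> borel_measurable (unit_interval \<Otimes>\<^sub>M unit_interval)"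
  "(\<lambda>(x, y). ennreal (limit_kernel \<alpha> x y)) \<in> borel_measurable (unit_interval \<Otimes>\<^sub>M unit_interval)"
  using measurable_compose[OF measurable_pair_unit_interval[OF chol_kernel_measurable] measurable_ennreal]
    measurable_compose[OF measurable_pair_unit_interval[OF limit_kernel_measurable] measurable_ennreal]
  by (simp_all add: split_beta')

text \<open>Width 1 covers the whole square, so the Schur bound alone gives finiteness.\<close>

lemma knorm_weakly_singular_finite:
  assumes \<alpha>: "0 < \<alpha>" "\<alpha> < 1" and C: "0 \<le> C"
    and m: "(\<lambda>(x, y). ennreal (k x y)) \<in> borel_measurable (unit_interval \<Otimes>\<^sub>M unit_interval)"
    and bound: "\<And>x y. x \<in> {0<..<1} \<Longrightarrow> y \<in> {0<..<1} \<Longrightarrow> x \<noteq> y \<Longrightarrow> k x y \<le> C * \<bar>y - x\<bar> powr (\<alpha> - 1)"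
  shows "unit_interval.knorm (\<lambda>x y. ennreal (k x y)) < top_class.top"
proof -
  have "unit_interval.knorm (\<lambda>x y. ennreal (k x y)) \<le> ennreal (4 * C * 1 powr \<alpha> / \<alpha>)"
  proof (rule knorm_near_diagonal[OF \<alpha>(1) _ C])
    fix x y :: real assume xy: "x \<in> {0<..<1}" "y \<in> {0<..<1}" "x \<noteq> y"
    then have "\<bar>y - x\<bar> < 1" by auto
    then show "ennreal (k x y) \<le> ennreal C * near_kernel \<alpha> 1 x y"
      using bound[OF xy] C by (simp add: near_kernel_def ennreal_mult[symmetric] ennreal_leI)
  qed (use m in auto)
  then show ?thesis by (meson ennreal_less_top order_le_less_trans)
qed

lemma limit_knorm_finite:
  assumes "0 < \<alpha>" "\<alpha> < 1"
  shows "limit_knorm \<alpha> < top_class.top"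
proof (rule knorm_weakly_singular_finite[OF assms, of "1 / Gamma \<alpha>"])
  show "0 \<le> 1 / Gamma \<alpha>" using assms by simp
  show "limit_kernel \<alpha> x y \<le> 1 / Gamma \<alpha> * \<bar>y - x\<bar> powr (\<alpha> - 1)" if "x \<in> {0<..<1}" "y \<in> {0<..<1}" "x \<noteq> y" for x y
    using limit_kernel_bound[OF assms(1), of x y] that by auto
qed (rule kernels_measurable)

lemma chol_knorm_finite:
  assumes "0 < \<alpha>" "\<alpha> < 1" "0 < n"
  shows "chol_knorm \<alpha> n < top_class.top"
proof -
  obtain C where "C > 0" "\<And>M x s. 0 < M \<Longrightarrow> 0 < x \<Longrightarrow> 0 < s \<Longrightarrow> x \<noteq> s \<Longrightarrow>
    chol_kernel \<alpha> M x s \<le> C * \<bar>s - x\<bar> powr (\<alpha> - 1)"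
    using chol_kernel_bound[OF assms(1,2)] by blast
  then show ?thesis using assms
    by (intro knorm_weakly_singular_finite[of _ C] kernels_measurable) auto
qed

text \<open>Tested on the constant 1. On the rectangle with x in [1/4, 1/2] and y in [3/4, 1) both y
  - x and y are below 1, so the two negative powers are at least 1 and \<open>c\<close> bounds the
  kernel from below.\<close>

lemma limit_knorm_pos:
  assumes "0 < \<alpha>" "\<alpha> < 1"
  shows "0 < limit_knorm \<alpha>"
proof -
  define c where "c = (1/4) powr \<alpha> / Gamma \<alpha>"
  have c: "c > 0" using assms by (simp add: c_def)
  have low: "c \<le> limit_kernel \<alpha> x y" if "x \<in> {1/4..1/2}" "y \<in> {3/4..<1}" for x y
  proof -
    have "(1/4) powr \<alpha> * 1 * 1 / Gamma \<alpha> \<le> x powr \<alpha> * (y - x) powr (\<alpha> - 1) * y powr (- \<alpha>) / Gamma \<alpha>"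
    proof (intro divide_right_mono mult_mono)
      show "(1/4) powr \<alpha> \<le> x powr \<alpha>" using that assms by (intro powr_mono2) auto
      show "1 \<le> (y - x) powr (\<alpha> - 1)" using that assms powr_mono2'[of "\<alpha> - 1" "y - x" 1] by auto
      show "1 \<le> y powr (- \<alpha>)" using that assms powr_mono2'[of "- \<alpha>" y 1] by auto
    qed (use assms in auto)
    then show ?thesis using that by (simp add: limit_kernel_def c_def)
  qed
  have em: "emeasure unit_interval {1/4..1/2} = ennreal (1/4)" "emeasure unit_interval {3/4..<1} = ennreal (1/4)"
    by (subst emeasure_unit_interval; auto)+
  have [measurable]: "{1/4..1/2::real} \<in> sets unit_interval" "{3/4..<1::real} \<in> sets unit_interval"
    by (auto simp: unit_interval_def sets_restrict_space_iff)
  have "0 < ennreal c * ennreal (1/4) * ennreal (1/4)"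
    using c by (simp add: ennreal_zero_less_mult_iff)
  also have "\<dots> = (\<integral>\<^sup>+x. \<integral>\<^sup>+y. ennreal c * indicator {1/4..1/2} x * indicator {3/4..<1} y \<partial>unit_interval \<partial>unit_interval)"
    by (simp add: nn_integral_cmult em nn_integral_multc mult_ac)
  also have "\<dots> \<le> (\<integral>\<^sup>+x. \<integral>\<^sup>+y. ennreal (limit_kernel \<alpha> x y) * 1 * 1 \<partial>unit_interval \<partial>unit_interval)"
    by (intro nn_integral_mono) (auto split: split_indicator intro!: ennreal_leI low)
  also have "\<dots> = unit_interval.kbil (\<lambda>x y. ennreal (limit_kernel \<alpha> x y)) (\<lambda>_. 1) (\<lambda>_. 1)"
    by (simp add: unit_interval.kbil_def)
  also have "\<dots> \<le> limit_knorm \<alpha>"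
    by (intro unit_interval.kbil_le_knorm unit_interval.unit_ballI) (auto simp: emeasure_unit_interval)
  finally show ?thesis .
qed

text \<open>Each kernel is dominated by the other plus their absolute difference, so the norms
  differ by at most the norm of that difference, which is weakly singular and tends to 0 off the
  diagonal.\<close>

lemma chol_knorm_tendsto:
  assumes \<alpha>: "0 < \<alpha>" "\<alpha> < 1"
  shows "(\<lambda>n. enn2real (chol_knorm \<alpha> n)) \<longlonglongrightarrow> enn2real (limit_knorm \<alpha>)"
proof (rule LIMSEQ_I)
  fix r :: real assume r: "0 < r"
  obtain C where C: "C > 0" "\<And>M x s. 0 < M \<Longrightarrow> 0 < x \<Longrightarrow> 0 < s \<Longrightarrow> x \<noteq> s \<Longrightarrow>
    chol_kernel \<alpha> M x s \<le> C * \<bar>s - x\<bar> powr (\<alpha> - 1)"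
    using chol_kernel_bound[OF \<alpha>] by blast
  define d where "d n x y = \<bar>chol_kernel \<alpha> n x y - limit_kernel \<alpha> x y\<bar>" for n x y
  have [measurable]: "(\<lambda>p. chol_kernel \<alpha> n (fst p) (snd p)) \<in> borel_measurable (borel \<Otimes>\<^sub>M borel)"
    "(\<lambda>p. limit_kernel \<alpha> (fst p) (snd p)) \<in> borel_measurable (borel \<Otimes>\<^sub>M borel)" for n
    using chol_kernel_measurable[of \<alpha> n] limit_kernel_measurable[of \<alpha>] by (simp_all add: split_beta')
  have dm: "case_prod (d n) \<in> borel_measurable (borel \<Otimes>\<^sub>M borel)" for n
    unfolding d_def by (simp add: split_beta')
  have dm': "(\<lambda>(x, y). ennreal (d n x y)) \<in> borel_measurable (unit_interval \<Otimes>\<^sub>M unit_interval)" for n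
    using dm[of n] by (intro measurable_pair_unit_interval) (simp add: split_beta')
  have "\<forall>\<^sub>F n in sequentially. unit_interval.knorm (\<lambda>x y. ennreal (d n x y)) \<le> ennreal (r / 2)"
  proof (rule knorm_weakly_singular_tendsto_0[OF \<alpha>, of "C + 1 / Gamma \<alpha>"])
    show "0 \<le> C + 1 / Gamma \<alpha>" using C \<alpha> by simp
    show "d n x y \<le> (C + 1 / Gamma \<alpha>) * \<bar>y - x\<bar> powr (\<alpha> - 1)"
      if "0 < n" "x \<in> {0<..<1}" "y \<in> {0<..<1}" "x \<noteq> y" for n x y
    proof -
      have "d n x y \<le> chol_kernel \<alpha> n x y + limit_kernel \<alpha> x y"
        using limit_kernel_nonneg[OF \<alpha>(1), of x y] chol_factor_nonneg[OF \<alpha>(1)]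
        by (simp add: d_def chol_kernel_def abs_le_iff)
      also have "\<dots> \<le> C * \<bar>y - x\<bar> powr (\<alpha> - 1) + 1 / Gamma \<alpha> * \<bar>y - x\<bar> powr (\<alpha> - 1)"
        using that by (intro add_mono C limit_kernel_bound \<alpha>) auto
      finally show ?thesis by (simp add: distrib_right)
    qed
    show "(\<lambda>n. d n x y) \<longlonglongrightarrow> 0" if "x \<in> {0<..<1}" "y \<in> {0<..<1}" "x \<noteq> y" for x y
      unfolding d_def using chol_kernel_limit[OF \<alpha>(1), of x y] that
      by (intro tendsto_rabs_zero LIM_zero) auto
  qed (use dm r in \<open>auto simp: d_def\<close>)
  then have "\<forall>\<^sub>F n in sequentially. norm (enn2real (chol_knorm \<alpha> n) - enn2real (limit_knorm \<alpha>)) < r"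
    using eventually_gt_at_top[of 0]
  proof eventually_elim
    case (elim n)
    have le: "enn2real a \<le> enn2real b + r / 2" if "a \<le> b + ennreal (r / 2)" "b < top_class.top" for a b
    proof -
      have "enn2real a \<le> enn2real (b + ennreal (r / 2))" using that r by (intro enn2real_mono) auto
      also have "\<dots> = enn2real b + r / 2" using that r by (subst enn2real_plus) auto
      finally show ?thesis .
    qed
    have 1: "chol_knorm \<alpha> n \<le> limit_knorm \<alpha> + unit_interval.knorm (\<lambda>x y. ennreal (d n x y))"
      by (rule unit_interval.knorm_triangle[OF kernels_measurable(2) dm'])
        (auto simp: d_def ennreal_plus[symmetric] limit_kernel_nonneg[OF \<alpha>(1)] simp del: ennreal_plus intro!: ennreal_leI)
    have 2: "limit_knorm \<alpha> \<le> chol_knorm \<alpha> n + unit_interval.knorm (\<lambda>x y. ennreal (d n x y))"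
      by (rule unit_interval.knorm_triangle[OF kernels_measurable(1) dm'])
        (auto simp: d_def ennreal_plus[symmetric] chol_kernel_def chol_factor_nonneg[OF \<alpha>(1)] simp del: ennreal_plus intro!: ennreal_leI)
    have "chol_knorm \<alpha> n \<le> limit_knorm \<alpha> + ennreal (r / 2)" "limit_knorm \<alpha> \<le> chol_knorm \<alpha> n + ennreal (r / 2)"
      using 1 2 elim(1) by (meson add_left_mono order_trans)+
    from le[OF this(1) limit_knorm_finite[OF \<alpha>]] le[OF this(2) chol_knorm_finite[OF \<alpha> elim(2)]] r
    show ?case by (simp add: abs_le_iff abs_less_iff)
  qed
  then show "\<exists>no. \<forall>n\<ge>no. norm (enn2real (chol_knorm \<alpha> n) - enn2real (limit_knorm \<alpha>)) < r"
    by (simp add: eventually_sequentially)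
qed

section \<open>Discretisation\<close>

lemma cell_less: "0 < n \<Longrightarrow> x \<in> {0<..<1} \<Longrightarrow> cell n x < n"
proof -
  assume n: "0 < n" and x: "x \<in> {0<..<1}"
  have "real (cell n x) \<le> real n * x" using x by (intro cell_bounds) simp
  also have "\<dots> < real n * 1" using n x by (intro mult_strict_left_mono) auto
  finally show "cell n x < n" by simp
qed

definition cell_integral :: "nat \<Rightarrow> (real \<Rightarrow> ennreal) \<Rightarrow> nat \<Rightarrow> ennreal" where
  "cell_integral n h k = (\<integral>\<^sup>+x. h x * indicator {x. cell n x = k} x \<partial>unit_interval)"

lemma cell_set_measurable [measurable]: "{x. cell n x = k} \<in> sets borel"
proof -
  have "cell n -` {k} \<inter> space borel \<in> sets borel" by (rule measurable_sets[OF cell_measurable]) auto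
  then show ?thesis by (simp add: vimage_def)
qed

lemma cell_indicator_measurable [measurable]:
  "(\<lambda>x. indicator {x. cell n x = k} x :: ennreal) \<in> borel_measurable unit_interval"
  by (rule measurable_unit_interval) simp

lemma nn_integral_cell:
  assumes n: "0 < n" and [measurable]: "h \<in> borel_measurable unit_interval"
  shows "(\<integral>\<^sup>+x. c (cell n x) * h x \<partial>unit_interval) = (\<Sum>k<n. c k * cell_integral n h k)"
proof -
  have "(\<integral>\<^sup>+x. c (cell n x) * h x \<partial>unit_interval)
      = (\<integral>\<^sup>+x. (\<Sum>k<n. c k * (h x * indicator {x. cell n x = k} x)) \<partial>unit_interval)"
  proof (rule nn_integral_cong)
    fix x assume "x \<in> space unit_interval"
    then have "cell n x \<in> {..<n}" using n by (simp add: cell_less)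
    then have "(\<Sum>k<n. c k * (h x * indicator {x. cell n x = k} x))
        = (\<Sum>k\<in>{cell n x}. c k * (h x * indicator {x. cell n x = k} x))"
      by (intro sum.mono_neutral_right) auto
    then show "c (cell n x) * h x = (\<Sum>k<n. c k * (h x * indicator {x. cell n x = k} x))" by simp
  qed
  also have "\<dots> = (\<Sum>k<n. c k * cell_integral n h k)"
    unfolding cell_integral_def by (subst nn_integral_sum) (auto intro!: sum.cong nn_integral_cmult)
  finally show ?thesis .
qed

text \<open>A kernel that is constant on cells sees f and g only through their integrals over the
  cells, so its norm is a finite-dimensional one.\<close>

lemma kbil_cell:
  assumes n: "0 < n" and [measurable]: "f \<in> borel_measurable unit_interval" "g \<in> borel_measurable unit_interval"
  shows "unit_interval.kbil (\<lambda>x y. c (cell n x) (cell n y)) f g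
    = (\<Sum>k<n. \<Sum>t<n. c k t * cell_integral n f k * cell_integral n g t)"
proof -
  have "(\<integral>\<^sup>+y. c (cell n x) (cell n y) * f x * g y \<partial>unit_interval)
      = (\<Sum>t<n. c (cell n x) t * cell_integral n g t) * f x" for x
    using nn_integral_cell[OF n, of g "\<lambda>t. c (cell n x) t * f x"]
    by (simp add: sum_distrib_left sum_distrib_right mult_ac)
  then have "unit_interval.kbil (\<lambda>x y. c (cell n x) (cell n y)) f g
      = (\<Sum>k<n. (\<Sum>t<n. c k t * cell_integral n g t) * cell_integral n f k)"
    unfolding unit_interval.kbil_def
    using nn_integral_cell[OF n, of f "\<lambda>k. \<Sum>t<n. c k t * cell_integral n g t"] by simp
  then show ?thesis by (simp add: sum_distrib_left sum_distrib_right mult_ac)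
qed

lemma cell_integral_1:
  assumes n: "0 < n" and k: "k < n"
  shows "cell_integral n (\<lambda>_. 1) k = ennreal (1 / real n)"
proof -
  have iff: "cell n x = k \<longleftrightarrow> real k / real n \<le> x \<and> x < (real k + 1) / real n" if "0 < x" for x
  proof
    assume "cell n x = k"
    then show "real k / real n \<le> x \<and> x < (real k + 1) / real n"
      using cell_bounds[of x n] that n by (auto simp: field_simps)
  next
    assume "real k / real n \<le> x \<and> x < (real k + 1) / real n"
    then have "real k \<le> real n * x" "real n * x < real k + 1" using n by (auto simp: field_simps)
    then have "\<lfloor>real n * x\<rfloor> = int k" by (intro floor_unique) auto
    then show "cell n x = k" by (simp add: cell_def)
  qed
  have "(real k + 1) / real n \<le> 1" using k n by (simp add: field_simps)
  have "cell_integral n (\<lambda>_. 1) k = (\<integral>\<^sup>+x. indicator {x. cell n x = k} x * indicator {0<..<1} x \<partial>lborel)"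
    by (simp add: cell_integral_def nn_integral_unit_interval)
  also have "\<dots> = (\<integral>\<^sup>+x. indicator {real k / real n..<(real k + 1) / real n} x \<partial>lborel)"
  proof (rule nn_integral_cong_AE)
    \<comment> \<open>The point 0 lies in the first half-open cell but not in the open unit
      interval.\<close>
    show "AE x in lborel. indicator {x. cell n x = k} x * indicator {0<..<1} x
        = (indicator {real k / real n..<(real k + 1) / real n} x :: ennreal)"
      using AE_lborel_singleton[of "0::real"]
    proof eventually_elim
      case (elim x)
      have nn: "0 \<le> real k / real n" by simp
      show ?case
      proof (cases "0 < x")
        case True
        then show ?thesis using iff[OF True] \<open>(real k + 1) / real n \<le> 1\<close> by (auto simp: indicator_def)
      next
        case False
        then have "x < real k / real n" using elim nn by linarith
        then show ?thesis using False by (auto simp: indicator_def)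
      qed
    qed
  qed
  also have "\<dots> = ennreal (1 / real n)"
    using n by (simp add: diff_divide_distrib[symmetric] divide_right_mono)
  finally show ?thesis .
qed

lemma cell_integral_step:
  assumes "0 < n" "k < n"
  shows "cell_integral n (\<lambda>x. v (cell n x)) k = v k * ennreal (1 / real n)"
proof -
  have "cell_integral n (\<lambda>x. v (cell n x)) k = (\<integral>\<^sup>+x. v k * (1 * indicator {x. cell n x = k} x) \<partial>unit_interval)"
    unfolding cell_integral_def by (intro nn_integral_cong) (auto split: split_indicator)
  also have "\<dots> = v k * cell_integral n (\<lambda>_. 1) k"
    unfolding cell_integral_def by (rule nn_integral_cmult) simp
  finally show ?thesis using assms by (simp add: cell_integral_1)
qed

text \<open>Cauchy--Schwarz against the indicator of the cell: averaging over cells does not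
  increase the norm.\<close>

lemma cell_integral_square_le:
  assumes n: "0 < n" "k < n" and [measurable]: "f \<in> borel_measurable unit_interval"
  shows "(cell_integral n f k)\<^sup>2 \<le> cell_integral n (\<lambda>x. (f x)\<^sup>2) k * ennreal (1 / real n)"
proof -
  let ?I = "\<lambda>x. indicator {x. cell n x = k} x :: ennreal"
  have I: "?I x * ?I x = ?I x" for x by (auto split: split_indicator)
  have "(cell_integral n f k)\<^sup>2 = (\<integral>\<^sup>+x. (f x * ?I x) * ?I x \<partial>unit_interval)\<^sup>2"
    unfolding cell_integral_def mult.assoc I ..
  also have "\<dots> \<le> (\<integral>\<^sup>+x. (f x * ?I x)\<^sup>2 \<partial>unit_interval) * (\<integral>\<^sup>+x. (?I x)\<^sup>2 \<partial>unit_interval)"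
    by (rule Cauchy_Schwarz_nn_integral) simp_all
  also have "\<dots> = cell_integral n (\<lambda>x. (f x)\<^sup>2) k * cell_integral n (\<lambda>_. 1) k"
  proof -
    have "(f x * ?I x)\<^sup>2 = (f x)\<^sup>2 * ?I x" "(?I x)\<^sup>2 = 1 * ?I x" for x
      by (auto split: split_indicator)
    then show ?thesis unfolding cell_integral_def by simp
  qed
  finally show ?thesis using n by (simp add: cell_integral_1)
qed

lemma step_unit_ball:
  assumes n: "0 < n" and v: "\<And>k. 0 \<le> v k" and le: "(\<Sum>k<n. (v k)\<^sup>2) \<le> real n"
  shows "(\<lambda>x. ennreal (v (cell n x))) \<in> unit_interval.unit_ball"
proof (rule unit_interval.unit_ballI)
  show "(\<lambda>x. ennreal (v (cell n x))) \<in> borel_measurable unit_interval"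
    by (rule measurable_unit_interval, rule measurable_compose[OF cell_measurable]) simp
  have "(\<integral>\<^sup>+x. (ennreal (v (cell n x)))\<^sup>2 \<partial>unit_interval) = (\<integral>\<^sup>+x. (ennreal (v (cell n x)))\<^sup>2 * 1 \<partial>unit_interval)"
    by simp
  also have "\<dots> = (\<Sum>k<n. (ennreal (v k))\<^sup>2 * cell_integral n (\<lambda>_. 1) k)"
    by (rule nn_integral_cell[OF n]) simp
  also have "\<dots> = (\<Sum>k<n. ennreal ((v k)\<^sup>2 / real n))"
    using n v by (intro sum.cong refl) (simp add: cell_integral_1 ennreal_power ennreal_mult[symmetric])
  also have "\<dots> = ennreal ((\<Sum>k<n. (v k)\<^sup>2) / real n)"
    by (subst sum_ennreal) (auto simp: sum_divide_distrib)
  also have "\<dots> \<le> 1" using le n by (simp add: ennreal_le_1)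
  finally show "(\<integral>\<^sup>+x. (ennreal (v (cell n x)))\<^sup>2 \<partial>unit_interval) \<le> 1" .
qed

text \<open>One half of the equality of the matrix norm with n^\<alpha> times the kernel norm, by
  testing the kernel on step functions. As A has nonnegative entries, w may be replaced by its
  moduli; the test pair is A|w| and |w|, each scaled to norm 1.\<close>

lemma chol_factor_opnorm_le:
  assumes \<alpha>: "0 < \<alpha>" "\<alpha> < 1" and n: "0 < n"
  shows "sqnorm n (\<lambda>k. \<Sum>t<n. of_real (chol_factor \<alpha> k t) * w t)
    \<le> real n powr (2 * \<alpha>) * (enn2real (chol_knorm \<alpha> n))\<^sup>2 * sqnorm n w"
proof -
  define b where "b = enn2real (chol_knorm \<alpha> n)"
  have b: "chol_knorm \<alpha> n = ennreal b" "0 \<le> b"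
    using chol_knorm_finite[OF \<alpha> n] by (simp_all add: b_def)
  define v where "v k = (\<Sum>t<n. chol_factor \<alpha> k t * cmod (w t))" for k
  have v0: "0 \<le> v k" for k unfolding v_def using chol_factor_nonneg[OF \<alpha>(1)] by (intro sum_nonneg) auto
  define V where "V = (\<Sum>k<n. (v k)\<^sup>2)"
  define W where "W = sqnorm n w"
  have VW0: "0 \<le> V" "0 \<le> W" by (simp_all add: V_def W_def sum_nonneg sqnorm_nonneg)
  have "sqnorm n (\<lambda>k. \<Sum>t<n. of_real (chol_factor \<alpha> k t) * w t) \<le> V"
    unfolding sqnorm_def V_def
  proof (intro sum_mono power_mono)
    show "cmod (\<Sum>t<n. of_real (chol_factor \<alpha> k t) * w t) \<le> v k" for k
      unfolding v_def using chol_factor_nonneg[OF \<alpha>(1)]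
      by (intro order.trans[OF norm_sum]) (simp add: norm_mult)
  qed auto
  also have "V \<le> real n powr (2 * \<alpha>) * b\<^sup>2 * W"
  proof (cases "V = 0 \<or> W = 0")
    \<comment> \<open>The normalisations of the other case divide by V and W; if W = 0, then w
      vanishes and V with it.\<close>
    case True
    moreover have "V = 0" if "W = 0"
    proof -
      have "\<forall>t<n. w t = 0" using that sqnorm_eq_0_iff[of n w] by (simp add: W_def)
      then show ?thesis by (simp add: V_def v_def)
    qed
    ultimately have "V = 0" by blast
    then show ?thesis using VW0 by simp
  next
    case False
    then have pos: "0 < V" "0 < W" using VW0 by auto
    \<comment> \<open>A step function has as squared norm the sum of squares divided by n, hence the
      normalisation to total n.\<close>
    define p where "p k = sqrt (real n / V) * v k" for k
    define q where "q t = sqrt (real n / W) * cmod (w t)" for t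
    have pq0: "0 \<le> p k" "0 \<le> q k" for k using v0 pos by (simp_all add: p_def q_def)
    have "(\<Sum>k<n. (p k)\<^sup>2) = real n / V * V"
      using pos by (simp add: p_def V_def power_mult_distrib sum_distrib_left)
    then have P: "(\<Sum>k<n. (p k)\<^sup>2) \<le> real n" using pos by simp
    have "(\<Sum>k<n. (q k)\<^sup>2) = real n / W * W"
      using pos by (simp add: q_def W_def sqnorm_def power_mult_distrib sum_distrib_left)
    then have Q: "(\<Sum>k<n. (q k)\<^sup>2) \<le> real n" using pos by simp
    let ?f = "\<lambda>x. ennreal (p (cell n x))" and ?g = "\<lambda>x. ennreal (q (cell n x))"
    have fg: "?f \<in> unit_interval.unit_ball" "?g \<in> unit_interval.unit_ball"
      by (intro step_unit_ball n pq0 P Q)+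
    have "unit_interval.kbil (\<lambda>x y. ennreal (chol_kernel \<alpha> n x y)) ?f ?g
        = (\<Sum>k<n. \<Sum>t<n. ennreal (real n powr (1 - \<alpha>) * chol_factor \<alpha> k t) * cell_integral n ?f k * cell_integral n ?g t)"
      unfolding chol_kernel_def
      using kbil_cell[OF n unit_interval.unit_ballD(1)[OF fg(1)] unit_interval.unit_ballD(1)[OF fg(2)],
          of "\<lambda>k t. ennreal (real n powr (1 - \<alpha>) * chol_factor \<alpha> k t)"] .
    also have "\<dots> = (\<Sum>k<n. \<Sum>t<n. ennreal (real n powr (1 - \<alpha>) * chol_factor \<alpha> k t * (p k / n) * (q t / n)))"
      using n pq0 chol_factor_nonneg[OF \<alpha>(1)]
      by (intro sum.cong refl)
        (simp add: cell_integral_step[where v = "\<lambda>k. ennreal (p k)"] cell_integral_step[where v = "\<lambda>k. ennreal (q k)"] ennreal_mult[symmetric])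
    also have "\<dots> = ennreal (\<Sum>k<n. \<Sum>t<n. real n powr (1 - \<alpha>) * chol_factor \<alpha> k t * (p k / n) * (q t / n))"
      using pq0 chol_factor_nonneg[OF \<alpha>(1)] by (simp add: sum_ennreal sum_nonneg)
    also have "(\<Sum>k<n. \<Sum>t<n. real n powr (1 - \<alpha>) * chol_factor \<alpha> k t * (p k / n) * (q t / n))
        = real n powr (1 - \<alpha>) * sqrt (real n / V) * sqrt (real n / W) / (real n)\<^sup>2 * V"
    proof -
      define K where "K = real n powr (1 - \<alpha>) * sqrt (real n / V) * sqrt (real n / W) / (real n)\<^sup>2"
      have "(\<Sum>t<n. real n powr (1 - \<alpha>) * chol_factor \<alpha> k t * (p k / n) * (q t / n)) = K * (v k)\<^sup>2" for k
      proof -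
        have "(\<Sum>t<n. real n powr (1 - \<alpha>) * chol_factor \<alpha> k t * (p k / n) * (q t / n))
            = (\<Sum>t<n. K * v k * (chol_factor \<alpha> k t * cmod (w t)))"
          by (intro sum.cong refl) (simp add: K_def p_def q_def power2_eq_square)
        also have "\<dots> = K * v k * v k" by (simp only: sum_distrib_left[symmetric] v_def)
        finally show ?thesis by (simp add: power2_eq_square)
      qed
      then have "(\<Sum>k<n. \<Sum>t<n. real n powr (1 - \<alpha>) * chol_factor \<alpha> k t * (p k / n) * (q t / n))
          = (\<Sum>k<n. K * (v k)\<^sup>2)"
        by (intro sum.cong refl)
      also have "\<dots> = K * V" by (simp only: V_def sum_distrib_left)
      finally show ?thesis unfolding K_def .
    qed
    also have "\<dots> = real n powr (- \<alpha>) * sqrt (V / W)"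
    proof -
      have "real n powr (1 - \<alpha>) = real n * real n powr (- \<alpha>)" using n by (simp add: powr_diff powr_minus divide_inverse)
      \<comment> \<open>Stated with m, s, r in place of the square roots of n, V and W, so that the
        cancellation is free of roots.\<close>
      moreover have "(m * m * P) * (m / s) * (m / r) / (m * m)\<^sup>2 * (s * s) = P * (s / r)"
        if "0 < m" "0 < s" "0 < r" for m s r P :: real
        using that by (simp add: field_simps power2_eq_square)
      from this[of "sqrt (real n)" "sqrt V" "sqrt W"]
      have "(real n * P) * (sqrt (real n) / sqrt V) * (sqrt (real n) / sqrt W) / (real n)\<^sup>2 * V
          = P * (sqrt V / sqrt W)" for P
        using pos n by simp
      ultimately show ?thesis by (simp only: real_sqrt_divide)
    qed
    finally have "ennreal (real n powr (- \<alpha>) * sqrt (V / W)) \<le> ennreal b"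
      using unit_interval.kbil_le_knorm[OF fg, of "\<lambda>x y. ennreal (chol_kernel \<alpha> n x y)"] b by simp
    then have "real n powr (- \<alpha>) * sqrt (V / W) \<le> b" using b by simp
    then have "(real n powr (- \<alpha>) * sqrt (V / W))\<^sup>2 \<le> b\<^sup>2" using pos by (intro power_mono) auto
    moreover have "(real n powr (- \<alpha>))\<^sup>2 = real n powr (- 2 * \<alpha>)"
      by (simp add: power2_eq_square powr_add[symmetric])
    ultimately have "real n powr (- 2 * \<alpha>) * (V / W) \<le> b\<^sup>2"
      using pos by (simp add: power_mult_distrib)
    then have "real n powr (2 * \<alpha>) * (real n powr (- 2 * \<alpha>) * (V / W)) \<le> real n powr (2 * \<alpha>) * b\<^sup>2"
      by (intro mult_left_mono) auto
    also have "real n powr (2 * \<alpha>) * (real n powr (- 2 * \<alpha>) * (V / W)) = V / W"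
    proof -
      have "real n powr (2 * \<alpha>) * real n powr (- 2 * \<alpha>) = 1" using n by (simp add: powr_add[symmetric])
      then show ?thesis by (metis mult.assoc mult_1)
    qed
    finally show ?thesis using pos by (simp add: pos_divide_le_eq)
  qed
  finally show ?thesis by (simp add: b_def W_def)
qed

text \<open>The other half: the cell integrals of f and g are vectors of norm at most 1 / sqrt n, to
  which the matrix bound \<rho> and Cauchy--Schwarz apply.\<close>

lemma chol_knorm_le:
  assumes \<alpha>: "0 < \<alpha>" "\<alpha> < 1" and n: "0 < n" and \<rho>: "0 \<le> \<rho>"
    and le: "\<And>w. sqnorm n (\<lambda>k. \<Sum>t<n. of_real (chol_factor \<alpha> k t) * w t) \<le> \<rho>\<^sup>2 * sqnorm n w"
  shows "chol_knorm \<alpha> n \<le> ennreal (real n powr (- \<alpha>) * \<rho>)"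
proof (rule unit_interval.knorm_least)
  fix f g assume fg: "f \<in> unit_interval.unit_ball" "g \<in> unit_interval.unit_ball"
  have avg: "\<exists>p. (\<forall>k<n. 0 \<le> p k \<and> cell_integral n f k = ennreal (p k)) \<and> (\<Sum>k<n. (p k)\<^sup>2) \<le> 1 / real n"
    if "f \<in> unit_interval.unit_ball" for f
  proof -
    note fm[measurable] = unit_interval.unit_ballD(1)[OF that]
    have "(\<Sum>k<n. (cell_integral n f k)\<^sup>2) \<le> (\<Sum>k<n. ennreal (1 / real n) * cell_integral n (\<lambda>x. (f x)\<^sup>2) k)"
      using cell_integral_square_le[OF n _ fm] by (intro sum_mono) (simp add: mult.commute)
    also have "\<dots> = (\<integral>\<^sup>+x. ennreal (1 / real n) * (f x)\<^sup>2 \<partial>unit_interval)"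
      using nn_integral_cell[OF n, of "\<lambda>x. (f x)\<^sup>2" "\<lambda>_. ennreal (1 / real n)"] by simp
    also have "\<dots> \<le> ennreal (1 / real n) * 1"
      by (subst nn_integral_cmult) (simp, rule mult_left_mono[OF unit_interval.unit_ballD(2)[OF that]], simp)
    finally have S: "(\<Sum>k<n. (cell_integral n f k)\<^sup>2) \<le> ennreal (1 / real n)" by simp
    define p where "p k = enn2real (cell_integral n f k)" for k
    have p0: "0 \<le> p k" for k by (simp add: p_def)
    have fin: "cell_integral n f k = ennreal (p k)" if "k < n" for k
    proof -
      have "(cell_integral n f k)\<^sup>2 \<le> ennreal (1 / real n)"
        using that S by (intro order_trans[OF member_le_sum S]) auto
      then have "(cell_integral n f k)\<^sup>2 < top_class.top" by (meson ennreal_less_top order_le_less_trans)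
      then have "cell_integral n f k < top_class.top" by (simp add: power_less_top_ennreal)
      then show ?thesis unfolding p_def by simp
    qed
    have "(\<Sum>k<n. (cell_integral n f k)\<^sup>2) = ennreal (\<Sum>k<n. (p k)\<^sup>2)"
      by (subst sum_ennreal[symmetric]) (auto simp: fin p0 ennreal_power intro!: sum.cong)
    with S have "(\<Sum>k<n. (p k)\<^sup>2) \<le> 1 / real n" by simp
    then show ?thesis using fin p0 by (intro exI[of _ p]) auto
  qed
  obtain p where p: "\<And>k. k < n \<Longrightarrow> 0 \<le> p k" "\<And>k. k < n \<Longrightarrow> cell_integral n f k = ennreal (p k)"
    "(\<Sum>k<n. (p k)\<^sup>2) \<le> 1 / real n" using avg[OF fg(1)] by blast
  obtain q where q: "\<And>k. k < n \<Longrightarrow> 0 \<le> q k" "\<And>k. k < n \<Longrightarrow> cell_integral n g k = ennreal (q k)"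
    "(\<Sum>k<n. (q k)\<^sup>2) \<le> 1 / real n" using avg[OF fg(2)] by blast
  define z where "z k = (\<Sum>t<n. chol_factor \<alpha> k t * q t)" for k
  have "unit_interval.kbil (\<lambda>x y. ennreal (chol_kernel \<alpha> n x y)) f g
      = (\<Sum>k<n. \<Sum>t<n. ennreal (real n powr (1 - \<alpha>) * chol_factor \<alpha> k t) * cell_integral n f k * cell_integral n g t)"
    unfolding chol_kernel_def
    using kbil_cell[OF n unit_interval.unit_ballD(1)[OF fg(1)] unit_interval.unit_ballD(1)[OF fg(2)],
        of "\<lambda>k t. ennreal (real n powr (1 - \<alpha>) * chol_factor \<alpha> k t)"] .
  also have "\<dots> = (\<Sum>k<n. \<Sum>t<n. ennreal (real n powr (1 - \<alpha>) * chol_factor \<alpha> k t * p k * q t))"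
    using p q chol_factor_nonneg[OF \<alpha>(1)]
    by (intro sum.cong refl) (simp add: ennreal_mult[symmetric])
  also have "\<dots> = (\<Sum>k<n. ennreal (\<Sum>t<n. real n powr (1 - \<alpha>) * chol_factor \<alpha> k t * p k * q t))"
    using p q chol_factor_nonneg[OF \<alpha>(1)] by (intro sum.cong refl sum_ennreal) auto
  also have "\<dots> = ennreal (\<Sum>k<n. \<Sum>t<n. real n powr (1 - \<alpha>) * chol_factor \<alpha> k t * p k * q t)"
    using p q chol_factor_nonneg[OF \<alpha>(1)] by (intro sum_ennreal sum_nonneg) auto
  also have "\<dots> \<le> ennreal (real n powr (- \<alpha>) * \<rho>)"
  proof (rule ennreal_leI)
    have "(\<Sum>k<n. \<Sum>t<n. real n powr (1 - \<alpha>) * chol_factor \<alpha> k t * p k * q t)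
        = real n powr (1 - \<alpha>) * (\<Sum>k<n. p k * z k)"
      by (simp add: z_def sum_distrib_left mult_ac)
    also have "(\<Sum>k<n. p k * z k) \<le> \<rho> / real n"
    proof -
      have "(\<Sum>k<n. p k * z k)\<^sup>2 \<le> (\<Sum>k<n. (p k)\<^sup>2) * (\<Sum>k<n. (z k)\<^sup>2)"
        by (rule Cauchy_Schwarz_ineq_sum)
      also have "\<dots> \<le> (1 / real n) * (\<rho>\<^sup>2 * (1 / real n))"
      proof (intro mult_mono p)
        have "(\<Sum>k<n. (z k)\<^sup>2) = sqnorm n (\<lambda>k. \<Sum>t<n. of_real (chol_factor \<alpha> k t) * of_real (q t))"
          unfolding sqnorm_def z_def of_real_mult[symmetric] of_real_sum[symmetric] norm_of_real by simp
        also have "\<dots> \<le> \<rho>\<^sup>2 * sqnorm n (\<lambda>t. of_real (q t))" by (rule le)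
        also have "\<dots> \<le> \<rho>\<^sup>2 * (1 / real n)" using q(3) by (intro mult_left_mono) (auto simp: sqnorm_def)
        finally show "(\<Sum>k<n. (z k)\<^sup>2) \<le> \<rho>\<^sup>2 * (1 / real n)" .
      qed (auto intro: sum_nonneg)
      also have "\<dots> = (\<rho> / real n)\<^sup>2" by (simp add: power2_eq_square)
      finally show ?thesis by (rule power2_le_imp_le) (use \<rho> in simp)
    qed
    then have "real n powr (1 - \<alpha>) * (\<Sum>k<n. p k * z k) \<le> real n powr (1 - \<alpha>) * (\<rho> / real n)"
      by (intro mult_left_mono) auto
    also have "\<dots> = real n powr (- \<alpha>) * \<rho>"
      using n by (simp add: powr_diff powr_minus divide_inverse)
    finally show "(\<Sum>k<n. \<Sum>t<n. real n powr (1 - \<alpha>) * chol_factor \<alpha> k t * p k * q t) \<le> real n powr (- \<alpha>) * \<rho>"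
      by (simp add: z_def sum_distrib_left mult_ac)
  qed
  finally show "unit_interval.kbil (\<lambda>x y. ennreal (chol_kernel \<alpha> n x y)) f g \<le> ennreal (real n powr (- \<alpha>) * \<rho>)" .
qed

section \<open>The least eigenvalue of the pure symbol\<close>

definition pure_min :: "real \<Rightarrow> nat \<Rightarrow> real" where
  "pure_min \<alpha> n = min_eigenvalue (mat n n (\<lambda>(k, l). of_real (pure_coeff \<alpha> (int l - int k))))"

text \<open>A minimiser written as A w has |w|^2 = \<mu> and |A w| = 1, so |A|^2 \<ge> 1 / \<mu>; in
  particular \<mu> cannot be 0. Conversely the Rayleigh bound at A w gives |A w|^2 \<le> |w|^2 /
  \<mu> for every w. The two halves of the discretisation translate |A| into n^\<alpha> times
  \<open>chol_knorm\<close>.\<close>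

lemma pure_min_eq:
  assumes \<alpha>: "0 < \<alpha>" "\<alpha> < 1" and n: "0 < n"
  shows "0 < pure_min \<alpha> n" and "real n powr (2 * \<alpha>) * pure_min \<alpha> n * (enn2real (chol_knorm \<alpha> n))\<^sup>2 = 1"
proof -
  define b where "b = enn2real (chol_knorm \<alpha> n)"
  define \<mu> where "\<mu> = pure_min \<alpha> n"
  let ?T = "\<lambda>k l. complex_of_real (pure_coeff \<alpha> (int l - int k))"
  let ?A = "\<lambda>w k. \<Sum>t<n. of_real (chol_factor \<alpha> k t) * w t"
  have herm: "?T j i = cnj (?T i j)" for i j
    using pure_coeff_uminus[of \<alpha> "int i - int j"] by simp
  note ray = min_eigenvalue_rayleigh[of n ?T, OF n herm, folded pure_min_def \<mu>_def]
  have low: "\<mu> * sqnorm n u \<le> qform n ?T u" for u by (rule ray)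
  obtain u where u: "sqnorm n u = 1" "qform n ?T u = \<mu>" using ray(2) by blast
  obtain w where w: "\<And>k. k < n \<Longrightarrow> ?A w k = u k" using chol_factor_surj[OF \<alpha>(1), of n u] by blast
  have "qform n ?T u = qform n ?T (?A w)" "sqnorm n u = sqnorm n (?A w)"
    unfolding qform_def sqnorm_def by (auto simp: w)
  then have \<mu>: "\<mu> = sqnorm n w" and 1: "sqnorm n (?A w) = 1"
    using u qform_pure_chol[OF \<alpha>, of n w] by auto
  have le1: "1 \<le> real n powr (2 * \<alpha>) * b\<^sup>2 * \<mu>"
    using chol_factor_opnorm_le[OF \<alpha> n, of w] 1 \<mu> by (simp add: b_def)
  have "\<mu> \<ge> 0" using \<mu> sqnorm_nonneg by simp
  moreover have "\<mu> \<noteq> 0" using le1 by (intro notI) simp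
  ultimately show pos: "0 < pure_min \<alpha> n" unfolding \<mu>_def[symmetric] by simp
  have "chol_knorm \<alpha> n \<le> ennreal (real n powr (- \<alpha>) * sqrt (1 / \<mu>))"
  proof (rule chol_knorm_le[OF \<alpha> n])
    show "sqnorm n (?A w) \<le> (sqrt (1 / \<mu>))\<^sup>2 * sqnorm n w" for w
      using low[of "?A w"] qform_pure_chol[OF \<alpha>, of n w] pos
      by (simp add: \<mu>_def[symmetric] field_simps)
  qed (use pos in \<open>simp add: \<mu>_def[symmetric]\<close>)
  then have "b \<le> real n powr (- \<alpha>) * sqrt (1 / \<mu>)"
    unfolding b_def using pos by (intro enn2real_leI) (auto simp: \<mu>_def[symmetric])
  then have "b\<^sup>2 \<le> (real n powr (- \<alpha>) * sqrt (1 / \<mu>))\<^sup>2" by (intro power_mono) (simp_all add: b_def)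
  also have "\<dots> = real n powr (- 2 * \<alpha>) * (1 / \<mu>)"
  proof -
    have "(real n powr (- \<alpha>))\<^sup>2 = real n powr (- 2 * \<alpha>)"
      by (simp add: power2_eq_square powr_add[symmetric])
    then show ?thesis using pos by (simp add: \<mu>_def[symmetric] power_mult_distrib)
  qed
  finally have "real n powr (2 * \<alpha>) * \<mu> * b\<^sup>2 \<le> real n powr (2 * \<alpha>) * \<mu> * (real n powr (- 2 * \<alpha>) * (1 / \<mu>))"
    using pos by (intro mult_left_mono) (auto simp: \<mu>_def[symmetric])
  also have "\<dots> = (real n powr (2 * \<alpha>) * real n powr (- 2 * \<alpha>)) * (\<mu> * (1 / \<mu>))"
    by (simp only: mult_ac)
  also have "\<dots> = 1"
  proof -
    have "real n powr (2 * \<alpha>) * real n powr (- 2 * \<alpha>) = 1" using n by (simp add: powr_add[symmetric])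
    moreover have "\<mu> * (1 / \<mu>) = 1" using pos by (simp add: \<mu>_def)
    ultimately show ?thesis by simp
  qed
  finally have "real n powr (2 * \<alpha>) * \<mu> * b\<^sup>2 \<le> 1" .
  moreover have "1 \<le> real n powr (2 * \<alpha>) * \<mu> * b\<^sup>2" using le1 by (simp only: mult_ac)
  ultimately show "real n powr (2 * \<alpha>) * pure_min \<alpha> n * (enn2real (chol_knorm \<alpha> n))\<^sup>2 = 1"
    unfolding b_def \<mu>_def by (rule antisym)
qed

lemma pure_min_tendsto:
  assumes \<alpha>: "0 < \<alpha>" "\<alpha> < 1"
  shows "(\<lambda>n. real n powr (2 * \<alpha>) * pure_min \<alpha> n) \<longlonglongrightarrow> 1 / (enn2real (limit_knorm \<alpha>))\<^sup>2"
proof -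
  have b: "enn2real (limit_knorm \<alpha>) > 0"
    using limit_knorm_pos[OF \<alpha>] limit_knorm_finite[OF \<alpha>] by (simp add: enn2real_positive_iff)
  have "(\<lambda>n. 1 / (enn2real (chol_knorm \<alpha> n))\<^sup>2) \<longlonglongrightarrow> 1 / (enn2real (limit_knorm \<alpha>))\<^sup>2"
    using b by (intro tendsto_divide tendsto_const tendsto_power chol_knorm_tendsto \<alpha>) auto
  moreover have "\<forall>\<^sub>F n in sequentially. 1 / (enn2real (chol_knorm \<alpha> n))\<^sup>2 = real n powr (2 * \<alpha>) * pure_min \<alpha> n"
    using eventually_gt_at_top[of 0]
  proof eventually_elim
    case (elim n)
    have "1 / x = y" if "y * x = 1" for x y :: real
    proof -
      have "x \<noteq> 0" using that by auto
      then show ?thesis using that by (simp add: nonzero_divide_eq_eq)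
    qed
    from this[OF pure_min_eq(2)[OF \<alpha> elim]] show ?case .
  qed
  ultimately show ?thesis by (simp add: tendsto_cong)
qed

section \<open>The Green operator\<close>

text \<open>Extended-valued, since for \<alpha> \<le> 1/2 the integral diverges on the
  diagonal.\<close>

definition green_kernel :: "real \<Rightarrow> real \<Rightarrow> real \<Rightarrow> ennreal" where
  "green_kernel \<alpha> x y =
     (\<integral>\<^sup>+s. ennreal (limit_kernel \<alpha> x s) * ennreal (limit_kernel \<alpha> y s) \<partial>unit_interval)"

lemma limit_kernel_measurable_unit [measurable]:
  "(\<lambda>p. limit_kernel \<alpha> (fst p) (snd p)) \<in> borel_measurable (borel \<Otimes>\<^sub>M borel)"
  using limit_kernel_measurable[of \<alpha>] by (simp add: split_beta')

text \<open>Valid on the diagonal too: a divergent Lebesgue integral and \<open>enn2real\<close> of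
  infinity are both 0. The closed and the open range of integration differ by a null set.\<close>

lemma G_kernel_eq:
  assumes \<alpha>: "0 < \<alpha>" and xy: "x \<in> {0<..<1}" "y \<in> {0<..<1}"
  shows "G_kernel \<alpha> x y = enn2real (green_kernel \<alpha> x y)"
proof -
  define c where "c = 1 / (Gamma \<alpha>)\<^sup>2 * x powr \<alpha> * y powr \<alpha>"
  have c: "0 \<le> c" unfolding c_def by simp
  define h where "h t = (t - x) powr (\<alpha> - 1) * (t - y) powr (\<alpha> - 1) / t powr (2 * \<alpha>)" for t
  have "G_kernel \<alpha> x y = (LINT t|lborel. c * (indicator {max x y..1} t * h t))"
    unfolding G_kernel_def set_lebesgue_integral_def c_def[symmetric] h_def[symmetric] real_scaleR_def
    by (rule integral_mult_right_zero[symmetric])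
  also have "\<dots> = enn2real (\<integral>\<^sup>+t. ennreal (c * (indicator {max x y..1} t * h t)) \<partial>lborel)"
    unfolding h_def using c by (intro integral_eq_nn_integral) auto
  also have "(\<integral>\<^sup>+t. ennreal (c * (indicator {max x y..1} t * h t)) \<partial>lborel)
      = (\<integral>\<^sup>+s. ennreal (limit_kernel \<alpha> x s) * ennreal (limit_kernel \<alpha> y s) * indicator {0<..<1} s \<partial>lborel)"
  proof (rule nn_integral_cong_AE)
    show "AE t in lborel. ennreal (c * (indicator {max x y..1} t * h t))
        = ennreal (limit_kernel \<alpha> x t) * ennreal (limit_kernel \<alpha> y t) * indicator {0<..<1} t"
      using AE_lborel_singleton[of "1::real"] AE_lborel_singleton[of "max x y"]
    proof eventually_elim
      case (elim t)
      show ?case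
      proof (cases "max x y < t \<and> t < 1")
        case True
        have "t powr (- \<alpha>) * t powr (- \<alpha>) = t powr (- (2 * \<alpha>))"
          by (simp add: powr_add[symmetric])
        moreover have "limit_kernel \<alpha> x t * limit_kernel \<alpha> y t
            = c * ((t - x) powr (\<alpha> - 1) * (t - y) powr (\<alpha> - 1) * (t powr (- \<alpha>) * t powr (- \<alpha>)))"
          using True by (simp add: limit_kernel_def c_def power2_eq_square)
        ultimately have e: "limit_kernel \<alpha> x t * limit_kernel \<alpha> y t = c * h t"
          by (simp add: h_def powr_minus divide_inverse)
        show ?thesis using True xy limit_kernel_nonneg[OF \<alpha>]
          by (simp add: ennreal_mult[symmetric] e)
      next
        case False
        then show ?thesis using elim xy by (auto simp: limit_kernel_def indicator_def)
      qed
    qed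
  qed
  finally show ?thesis by (simp add: green_kernel_def nn_integral_unit_interval)
qed

lemma green_kernel_measurable:
  "(\<lambda>p. green_kernel \<alpha> (fst p) (snd p)) \<in> borel_measurable (unit_interval \<Otimes>\<^sub>M unit_interval)"
proof -
  have m: "(\<lambda>q. ennreal (limit_kernel \<alpha> (fst q) (snd q))) \<in> borel_measurable (unit_interval \<Otimes>\<^sub>M unit_interval)"
    using kernels_measurable(2)[of \<alpha>] by (simp add: split_beta')
  have "(\<lambda>q. ennreal (limit_kernel \<alpha> (fst (fst q)) (snd q)) * ennreal (limit_kernel \<alpha> (snd (fst q)) (snd q)))
      \<in> borel_measurable ((unit_interval \<Otimes>\<^sub>M unit_interval) \<Otimes>\<^sub>M unit_interval)"
  proof (intro borel_measurable_times_ennreal)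
    have "(\<lambda>q. (fst (fst q), snd q)) \<in> (unit_interval \<Otimes>\<^sub>M unit_interval) \<Otimes>\<^sub>M unit_interval \<rightarrow>\<^sub>M unit_interval \<Otimes>\<^sub>M unit_interval"
      "(\<lambda>q. (snd (fst q), snd q)) \<in> (unit_interval \<Otimes>\<^sub>M unit_interval) \<Otimes>\<^sub>M unit_interval \<rightarrow>\<^sub>M unit_interval \<Otimes>\<^sub>M unit_interval"
      by measurable
    from this[THEN measurable_compose, OF m] show
      "(\<lambda>q. ennreal (limit_kernel \<alpha> (fst (fst q)) (snd q))) \<in> borel_measurable ((unit_interval \<Otimes>\<^sub>M unit_interval) \<Otimes>\<^sub>M unit_interval)"
      "(\<lambda>q. ennreal (limit_kernel \<alpha> (snd (fst q)) (snd q))) \<in> borel_measurable ((unit_interval \<Otimes>\<^sub>M unit_interval) \<Otimes>\<^sub>M unit_interval)"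
      by simp_all
  qed
  then show ?thesis unfolding green_kernel_def
    by (intro unit_interval.borel_measurable_nn_integral) (simp add: split_beta')
qed

lemma green_kernel_measurable_section:
  "x \<in> {0<..<1} \<Longrightarrow> green_kernel \<alpha> x \<in> borel_measurable unit_interval"
  using measurable_compose[OF measurable_Pair1'[of x unit_interval unit_interval] green_kernel_measurable] by simp

definition green_apply :: "real \<Rightarrow> (real \<Rightarrow> ennreal) \<Rightarrow> real \<Rightarrow> ennreal" where
  "green_apply \<alpha> f x = (\<integral>\<^sup>+y. green_kernel \<alpha> x y * f y \<partial>unit_interval)"

definition adj_apply :: "real \<Rightarrow> (real \<Rightarrow> ennreal) \<Rightarrow> real \<Rightarrow> ennreal" where
  "adj_apply \<alpha> f s = (\<integral>\<^sup>+y. ennreal (limit_kernel \<alpha> y s) * f y \<partial>unit_interval)"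

lemma kernel_unit_measurable [measurable]:
  "(\<lambda>p. ennreal (limit_kernel \<alpha> (fst p) (snd p))) \<in> borel_measurable (unit_interval \<Otimes>\<^sub>M unit_interval)"
  "(\<lambda>p. ennreal (limit_kernel \<alpha> (snd p) (fst p))) \<in> borel_measurable (unit_interval \<Otimes>\<^sub>M unit_interval)"
proof -
  show m: "(\<lambda>p. ennreal (limit_kernel \<alpha> (fst p) (snd p))) \<in> borel_measurable (unit_interval \<Otimes>\<^sub>M unit_interval)"
    using kernels_measurable(2)[of \<alpha>] by (simp add: split_beta')
  show "(\<lambda>p. ennreal (limit_kernel \<alpha> (snd p) (fst p))) \<in> borel_measurable (unit_interval \<Otimes>\<^sub>M unit_interval)"
    using measurable_compose[OF measurable_pair_swap' m] by (simp add: split_beta')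
qed

lemma limit_kernel_section_measurable [measurable]:
  "(\<lambda>s. ennreal (limit_kernel \<alpha> x s)) \<in> borel_measurable unit_interval"
  "(\<lambda>y. ennreal (limit_kernel \<alpha> y s)) \<in> borel_measurable unit_interval"
  unfolding limit_kernel_def by measurable

lemma adj_apply_measurable [measurable]:
  "f \<in> borel_measurable unit_interval \<Longrightarrow> adj_apply \<alpha> f \<in> borel_measurable unit_interval"
  unfolding adj_apply_def
  by (rule unit_interval.borel_measurable_nn_integral) (simp add: split_beta')

text \<open>Tonelli gives G f = K (K^T f), the factorisation on which both norm estimates
  rest.\<close>

lemma green_apply_eq:
  assumes x: "x \<in> {0<..<1}" and [measurable]: "f \<in> borel_measurable unit_interval"
  shows "green_apply \<alpha> f x = (\<integral>\<^sup>+s. ennreal (limit_kernel \<alpha> x s) * adj_apply \<alpha> f s \<partial>unit_interval)"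
proof -
  have "green_apply \<alpha> f x = (\<integral>\<^sup>+y. \<integral>\<^sup>+s. ennreal (limit_kernel \<alpha> x s) * ennreal (limit_kernel \<alpha> y s) * f y \<partial>unit_interval \<partial>unit_interval)"
    unfolding green_apply_def green_kernel_def
    by (intro nn_integral_cong nn_integral_multc[symmetric]) simp
  also have "\<dots> = (\<integral>\<^sup>+s. \<integral>\<^sup>+y. ennreal (limit_kernel \<alpha> x s) * ennreal (limit_kernel \<alpha> y s) * f y \<partial>unit_interval \<partial>unit_interval)"
    by (rule unit_interval.nn_integral_swap) (simp add: split_beta')
  also have "\<dots> = (\<integral>\<^sup>+s. ennreal (limit_kernel \<alpha> x s) * adj_apply \<alpha> f s \<partial>unit_interval)"
    unfolding adj_apply_def mult.assoc by (intro nn_integral_cong nn_integral_cmult) simp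
  finally show ?thesis .
qed

lemma green_apply_measurable [measurable]:
  "f \<in> borel_measurable unit_interval \<Longrightarrow> green_apply \<alpha> f \<in> borel_measurable unit_interval"
  unfolding green_apply_def
  using green_kernel_measurable[of \<alpha>]
  by (intro unit_interval.borel_measurable_nn_integral) (simp add: split_beta')

lemma adj_apply_bound:
  assumes "f \<in> unit_interval.unit_ball"
  shows "(\<integral>\<^sup>+s. (adj_apply \<alpha> f s)\<^sup>2 \<partial>unit_interval) \<le> (limit_knorm \<alpha>)\<^sup>2"
  unfolding adj_apply_def by (rule unit_interval.adjoint_bound[OF kernels_measurable(2) assms])

text \<open>\<open>adjoint_bound\<close> is used twice: for K, giving |K^T f| \<le> b, and for the
  transposed kernel at the normalised function g = K^T f / b. Hence |G f| \<le> b^2, here in squared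
  form.\<close>

lemma green_apply_bound:
  assumes \<alpha>: "0 < \<alpha>" "\<alpha> < 1" and f: "f \<in> unit_interval.unit_ball"
  shows "(\<integral>\<^sup>+x. (green_apply \<alpha> f x)\<^sup>2 \<partial>unit_interval) \<le> ennreal ((enn2real (limit_knorm \<alpha>)) ^ 4)"
proof -
  note [measurable] = unit_interval.unit_ballD(1)[OF f]
  define b where "b = enn2real (limit_knorm \<alpha>)"
  have b: "limit_knorm \<alpha> = ennreal b" using limit_knorm_finite[OF \<alpha>] by (simp add: b_def)
  have b0: "0 < b" using limit_knorm_pos[OF \<alpha>] limit_knorm_finite[OF \<alpha>] by (simp add: b_def enn2real_positive_iff)
  define g where "g s = ennreal (1 / b) * adj_apply \<alpha> f s" for s
  have g: "g \<in> unit_interval.unit_ball" unfolding g_def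
    using adj_apply_bound[OF f, of \<alpha>] b0 b
    by (intro unit_interval.unit_ball_scale) (auto simp: ennreal_power)
  have km: "(\<lambda>(s, x). ennreal (limit_kernel \<alpha> x s)) \<in> borel_measurable (unit_interval \<Otimes>\<^sub>M unit_interval)"
    using kernel_unit_measurable(2)[of \<alpha>] by (simp add: split_beta')
  have gm [measurable]: "g \<in> borel_measurable unit_interval" by (rule unit_interval.unit_ballD[OF g])
  have e: "green_apply \<alpha> f x = ennreal b * (\<integral>\<^sup>+s. ennreal (limit_kernel \<alpha> x s) * g s \<partial>unit_interval)"
    if "x \<in> space unit_interval" for x
  proof -
    have "adj_apply \<alpha> f s = ennreal b * g s" for s
      using b0 by (simp add: g_def mult.assoc[symmetric] ennreal_mult[symmetric])
    then have "green_apply \<alpha> f x = (\<integral>\<^sup>+s. ennreal b * (ennreal (limit_kernel \<alpha> x s) * g s) \<partial>unit_interval)"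
      using that by (subst green_apply_eq) (auto simp: mult_ac)
    then show ?thesis by (simp add: nn_integral_cmult)
  qed
  have "(\<integral>\<^sup>+x. (green_apply \<alpha> f x)\<^sup>2 \<partial>unit_interval)
      = (\<integral>\<^sup>+x. (ennreal b)\<^sup>2 * (\<integral>\<^sup>+s. ennreal (limit_kernel \<alpha> x s) * g s \<partial>unit_interval)\<^sup>2 \<partial>unit_interval)"
    by (intro nn_integral_cong) (simp add: e power_mult_distrib)
  also have "\<dots> = (ennreal b)\<^sup>2 * (\<integral>\<^sup>+x. (\<integral>\<^sup>+s. ennreal (limit_kernel \<alpha> x s) * g s \<partial>unit_interval)\<^sup>2 \<partial>unit_interval)"
  proof (rule nn_integral_cmult)
    have "(\<lambda>x. \<integral>\<^sup>+s. ennreal (limit_kernel \<alpha> x s) * g s \<partial>unit_interval) \<in> borel_measurable unit_interval"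
      by (rule unit_interval.borel_measurable_nn_integral) (simp add: split_beta')
    then show "(\<lambda>x. (\<integral>\<^sup>+s. ennreal (limit_kernel \<alpha> x s) * g s \<partial>unit_interval)\<^sup>2) \<in> borel_measurable unit_interval"
      by simp
  qed
  also have "\<dots> \<le> (ennreal b)\<^sup>2 * (ennreal b)\<^sup>2"
    using unit_interval.adjoint_bound[OF km g] unit_interval.knorm_swap[OF kernels_measurable(2), of \<alpha>] b
    by (intro mult_left_mono) auto
  also have "\<dots> = ennreal (b ^ 4)" using b0
    by (simp add: ennreal_power ennreal_mult[symmetric] power_add[symmetric])
  finally show ?thesis by (simp add: b_def)
qed

text \<open>Cauchy--Schwarz twice: the square of (K^T f, g) is at most |K^T f|^2 = (f, G f), and the
  square of this is at most |G f|^2. Fourth powers are kept instead of taking roots.\<close>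

lemma kbil_le_green_apply:
  assumes f: "f \<in> unit_interval.unit_ball" and g: "g \<in> unit_interval.unit_ball"
  shows "((unit_interval.kbil (\<lambda>x y. ennreal (limit_kernel \<alpha> x y)) f g)\<^sup>2)\<^sup>2
    \<le> (\<integral>\<^sup>+x. (green_apply \<alpha> f x)\<^sup>2 \<partial>unit_interval)"
proof -
  note [measurable] = unit_interval.unit_ballD(1)[OF f] unit_interval.unit_ballD(1)[OF g]
  have k: "unit_interval.kbil (\<lambda>x y. ennreal (limit_kernel \<alpha> x y)) f g = (\<integral>\<^sup>+s. adj_apply \<alpha> f s * g s \<partial>unit_interval)"
    unfolding adj_apply_def by (rule unit_interval.kbil_eq_adjoint[OF kernels_measurable(2)]) simp_all
  have "(\<integral>\<^sup>+s. adj_apply \<alpha> f s * g s \<partial>unit_interval)\<^sup>2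
      \<le> (\<integral>\<^sup>+s. (adj_apply \<alpha> f s)\<^sup>2 \<partial>unit_interval) * (\<integral>\<^sup>+s. (g s)\<^sup>2 \<partial>unit_interval)"
    by (rule Cauchy_Schwarz_nn_integral) simp_all
  from order_trans[OF this mult_left_mono[OF unit_interval.unit_ballD(2)[OF g]]]
  have 1: "(\<integral>\<^sup>+s. adj_apply \<alpha> f s * g s \<partial>unit_interval)\<^sup>2 \<le> (\<integral>\<^sup>+s. (adj_apply \<alpha> f s)\<^sup>2 \<partial>unit_interval)"
    by simp
  have "(\<integral>\<^sup>+s. (adj_apply \<alpha> f s)\<^sup>2 \<partial>unit_interval)
      = (\<integral>\<^sup>+s. \<integral>\<^sup>+x. ennreal (limit_kernel \<alpha> x s) * f x * adj_apply \<alpha> f s \<partial>unit_interval \<partial>unit_interval)"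
    unfolding power2_eq_square
    by (subst (1) adj_apply_def) (intro nn_integral_cong nn_integral_multc[symmetric], simp)
  also have "\<dots> = (\<integral>\<^sup>+x. \<integral>\<^sup>+s. ennreal (limit_kernel \<alpha> x s) * f x * adj_apply \<alpha> f s \<partial>unit_interval \<partial>unit_interval)"
    by (rule unit_interval.nn_integral_swap) (simp add: split_beta')
  also have "\<dots> = (\<integral>\<^sup>+x. f x * green_apply \<alpha> f x \<partial>unit_interval)"
  proof (rule nn_integral_cong)
    fix x assume "x \<in> space unit_interval"
    then have "f x * green_apply \<alpha> f x = (\<integral>\<^sup>+s. f x * (ennreal (limit_kernel \<alpha> x s) * adj_apply \<alpha> f s) \<partial>unit_interval)"
      by (subst green_apply_eq) (simp_all add: nn_integral_cmult)
    then show "(\<integral>\<^sup>+s. ennreal (limit_kernel \<alpha> x s) * f x * adj_apply \<alpha> f s \<partial>unit_interval) = f x * green_apply \<alpha> f x"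
      by (simp add: mult_ac)
  qed
  finally have 2: "(\<integral>\<^sup>+s. (adj_apply \<alpha> f s)\<^sup>2 \<partial>unit_interval) = (\<integral>\<^sup>+x. f x * green_apply \<alpha> f x \<partial>unit_interval)" .
  have "(\<integral>\<^sup>+x. f x * green_apply \<alpha> f x \<partial>unit_interval)\<^sup>2
      \<le> (\<integral>\<^sup>+x. (f x)\<^sup>2 \<partial>unit_interval) * (\<integral>\<^sup>+x. (green_apply \<alpha> f x)\<^sup>2 \<partial>unit_interval)"
    by (rule Cauchy_Schwarz_nn_integral) simp_all
  from order_trans[OF this mult_right_mono[OF unit_interval.unit_ballD(2)[OF f]]]
  have 3: "(\<integral>\<^sup>+x. f x * green_apply \<alpha> f x \<partial>unit_interval)\<^sup>2 \<le> (\<integral>\<^sup>+x. (green_apply \<alpha> f x)\<^sup>2 \<partial>unit_interval)"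
    by simp
  show ?thesis unfolding k using power_mono[OF 1[unfolded 2], of 2] 3 by (rule order_trans) simp
qed

section \<open>The operator norm of \<open>G_operator\<close>\<close>

lemma ennreal_enn2real_le: "ennreal (enn2real x) \<le> x"
  by (cases x) auto

lemma set_integral_unit_interval:
  fixes f :: "real \<Rightarrow> 'a::{banach, second_countable_topology}"
  shows "(LINT x:{0<..<1}|lborel. f x) = (LINT x|unit_interval. f x)"
  by (simp add: unit_interval_def set_lebesgue_integral_def integral_restrict_space)

lemma G_operator_eq:
  assumes \<alpha>: "0 < \<alpha>" and x: "x \<in> {0<..<1}"
  shows "G_operator \<alpha> f x = (LINT y|unit_interval. of_real (enn2real (green_kernel \<alpha> x y)) * f y)"
  unfolding G_operator_def set_integral_unit_interval
  using x by (intro Bochner_Integration.integral_cong refl) (simp add: G_kernel_eq[OF \<alpha>])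

lemma L2_on_unit_interval:
  assumes "f \<in> L2_on {0<..<1}" and "L2_norm_on {0<..<1} f \<le> 1"
  shows "f \<in> borel_measurable unit_interval" "(\<lambda>x. ennreal (cmod (f x))) \<in> unit_interval.unit_ball"
proof -
  have f: "set_borel_measurable lborel {0<..<1} f" "set_integrable lborel {0<..<1} (\<lambda>x. (cmod (f x))\<^sup>2)"
    using assms(1) by (auto simp: L2_on_def)
  show m [measurable]: "f \<in> borel_measurable unit_interval"
    using f(1) unfolding unit_interval_def set_borel_measurable_def
    by (subst borel_measurable_restrict_space_iff) auto
  have int: "integrable unit_interval (\<lambda>x. (cmod (f x))\<^sup>2)"
    using f(2) by (simp add: unit_interval_def set_integrable_def integrable_restrict_space)
  have "(LINT x|unit_interval. (cmod (f x))\<^sup>2) \<le> 1"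
    using assms(2) unfolding L2_norm_on_def set_integral_unit_interval by simp
  then have "(\<integral>\<^sup>+x. ennreal ((cmod (f x))\<^sup>2) \<partial>unit_interval) \<le> ennreal 1"
    by (subst nn_integral_eq_integral[OF int]) (auto intro: ennreal_leI)
  then show "(\<lambda>x. ennreal (cmod (f x))) \<in> unit_interval.unit_ball"
    by (intro unit_interval.unit_ballI) (simp_all add: ennreal_power)
qed

lemma G_operator_norm_le:
  assumes \<alpha>: "0 < \<alpha>" "\<alpha> < 1" and f: "f \<in> L2_on {0<..<1}" "L2_norm_on {0<..<1} f \<le> 1"
  shows "L2_norm_on {0<..<1} (G_operator \<alpha> f) \<le> (enn2real (limit_knorm \<alpha>))\<^sup>2"
proof -
  define F where "F x = ennreal (cmod (f x))" for x
  have F: "F \<in> unit_interval.unit_ball" unfolding F_def by (rule L2_on_unit_interval[OF f])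
  note [measurable] = L2_on_unit_interval(1)[OF f]
  have pt: "ennreal ((cmod (G_operator \<alpha> f x))\<^sup>2) \<le> (green_apply \<alpha> F x)\<^sup>2" if "x \<in> space unit_interval" for x
  proof -
    have "ennreal (cmod (G_operator \<alpha> f x)) \<le> green_apply \<alpha> F x"
    proof (cases "integrable unit_interval (\<lambda>y. of_real (enn2real (green_kernel \<alpha> x y)) * f y)")
      case True
      have "ennreal (cmod (G_operator \<alpha> f x)) \<le> (\<integral>\<^sup>+y. ennreal (cmod (of_real (enn2real (green_kernel \<alpha> x y)) * f y)) \<partial>unit_interval)"
        using that by (subst G_operator_eq[OF \<alpha>(1)]) (auto intro: integral_norm_bound_ennreal[OF True])
      also have "\<dots> \<le> green_apply \<alpha> F x"
        unfolding green_apply_def F_def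
        by (intro nn_integral_mono) (auto simp: norm_mult ennreal_mult intro!: mult_right_mono ennreal_enn2real_le)
      finally show ?thesis .
    next
      \<comment> \<open>An integral that does not exist is 0 by default, and the bound is
        trivial.\<close>
      case False
      then have "G_operator \<alpha> f x = 0" using that
        by (subst G_operator_eq[OF \<alpha>(1)]) (auto intro: not_integrable_integral_eq)
      then show ?thesis by simp
    qed
    from power_mono[OF this, of 2] show ?thesis by (simp add: ennreal_power)
  qed
  have "(LINT x|unit_interval. (cmod (G_operator \<alpha> f x))\<^sup>2) \<le> (enn2real (limit_knorm \<alpha>)) ^ 4"
  proof (rule integral_real_bounded)
    have "(\<integral>\<^sup>+x. ennreal ((cmod (G_operator \<alpha> f x))\<^sup>2) \<partial>unit_interval) \<le> (\<integral>\<^sup>+x. (green_apply \<alpha> F x)\<^sup>2 \<partial>unit_interval)"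
      by (intro nn_integral_mono pt)
    also have "\<dots> \<le> ennreal ((enn2real (limit_knorm \<alpha>)) ^ 4)" by (rule green_apply_bound[OF \<alpha> F])
    finally show "(\<integral>\<^sup>+x. ennreal ((cmod (G_operator \<alpha> f x))\<^sup>2) \<partial>unit_interval) \<le> ennreal ((enn2real (limit_knorm \<alpha>)) ^ 4)" .
  qed simp
  then have "L2_norm_on {0<..<1} (G_operator \<alpha> f) \<le> sqrt ((enn2real (limit_knorm \<alpha>)) ^ 4)"
    unfolding L2_norm_on_def set_integral_unit_interval by (rule real_sqrt_le_mono)
  also have "\<dots> = (enn2real (limit_knorm \<alpha>))\<^sup>2"
    by (rule real_sqrt_unique) (simp_all add: power_mult[symmetric])
  finally show ?thesis .
qed

text \<open>The finite norm of G applied to the constant 1 already forces this, without any estimate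
  of the kernel.\<close>

lemma green_kernel_AE_finite:
  assumes \<alpha>: "0 < \<alpha>" "\<alpha> < 1"
  shows "AE x in unit_interval. AE y in unit_interval. green_kernel \<alpha> x y \<noteq> \<infinity>"
proof -
  have one: "(\<lambda>_. 1) \<in> unit_interval.unit_ball"
    by (intro unit_interval.unit_ballI) (auto simp: emeasure_unit_interval)
  have "(\<integral>\<^sup>+x. (green_apply \<alpha> (\<lambda>_. 1) x)\<^sup>2 \<partial>unit_interval) < \<infinity>"
    using order_le_less_trans[OF green_apply_bound[OF \<alpha> one] ennreal_less_top] by simp
  then have "AE x in unit_interval. (green_apply \<alpha> (\<lambda>_. 1) x)\<^sup>2 \<noteq> \<infinity>"
    by (intro nn_integral_PInf_AE) auto
  then show ?thesis
    using AE_space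
  proof eventually_elim
    case (elim x)
    then have "(\<integral>\<^sup>+y. green_kernel \<alpha> x y \<partial>unit_interval) \<noteq> \<infinity>"
      by (auto simp: green_apply_def)
    then show ?case using elim(2) by (intro nn_integral_PInf_AE green_kernel_measurable_section) auto
  qed
qed

text \<open>Carries test functions over from \<open>ennreal\<close> to square integrable ones: f and
  G f are finite almost everywhere, and so are almost all sections of the kernel, so
  \<open>enn2real\<close> loses nothing outside null sets.\<close>

lemma G_operator_norm_ge:
  assumes \<alpha>: "0 < \<alpha>" "\<alpha> < 1" and f: "f \<in> unit_interval.unit_ball"
  defines "F \<equiv> \<lambda>x. if x \<in> {0<..<1} then complex_of_real (enn2real (f x)) else 0"
  shows "F \<in> L2_on {0<..<1}" "L2_norm_on {0<..<1} F \<le> 1"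
    "(\<integral>\<^sup>+x. (green_apply \<alpha> f x)\<^sup>2 \<partial>unit_interval) = ennreal ((L2_norm_on {0<..<1} (G_operator \<alpha> F))\<^sup>2)"
proof -
  note fm [measurable] = unit_interval.unit_ballD(1)[OF f]
  have Fe: "F x = complex_of_real (enn2real (f x))" if "x \<in> space unit_interval" for x
    using that by (simp add: F_def)
  have Fm: "F \<in> borel_measurable unit_interval"
    by (subst measurable_cong[OF Fe]) simp_all
  have "(\<integral>\<^sup>+x. (f x)\<^sup>2 \<partial>unit_interval) \<noteq> \<infinity>"
    using unit_interval.unit_ballD(2)[OF f] by (auto simp: top_unique)
  then have "AE x in unit_interval. (f x)\<^sup>2 \<noteq> \<infinity>" by (intro nn_integral_PInf_AE) auto
  then have ffin: "AE x in unit_interval. f x \<noteq> \<infinity>" by eventually_elim auto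
  have nF: "(\<integral>\<^sup>+x. ennreal ((cmod (F x))\<^sup>2) \<partial>unit_interval) \<le> ennreal 1"
  proof -
    have "(\<integral>\<^sup>+x. ennreal ((cmod (F x))\<^sup>2) \<partial>unit_interval) \<le> (\<integral>\<^sup>+x. (f x)\<^sup>2 \<partial>unit_interval)"
      by (intro nn_integral_mono) (auto simp: Fe ennreal_power[symmetric] intro!: power_mono ennreal_enn2real_le)
    then show ?thesis using unit_interval.unit_ballD(2)[OF f] by simp
  qed
  have int: "integrable unit_interval (\<lambda>x. (cmod (F x))\<^sup>2)"
    using Fm nF by (intro integrableI_bounded) (auto simp: order_le_less_trans)
  show "F \<in> L2_on {0<..<1}"
    using int Fm unfolding L2_on_def unit_interval_def set_integrable_def set_borel_measurable_def
    by (simp add: integrable_restrict_space borel_measurable_restrict_space_iff)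
  have "(LINT x|unit_interval. (cmod (F x))\<^sup>2) \<le> 1" by (rule integral_real_bounded[OF _ nF]) simp
  then show "L2_norm_on {0<..<1} F \<le> 1"
    unfolding L2_norm_on_def set_integral_unit_interval by (simp add: real_le_lsqrt)
  have Gm: "(\<lambda>x. LINT y|unit_interval. complex_of_real (enn2real (green_kernel \<alpha> x y)) * F y) \<in> borel_measurable unit_interval"
  proof (rule unit_interval.borel_measurable_lebesgue_integral)
    have "(\<lambda>p. F (snd p)) \<in> borel_measurable (unit_interval \<Otimes>\<^sub>M unit_interval)"
      by (rule measurable_compose[OF measurable_snd Fm])
    then show "(\<lambda>(x, y). complex_of_real (enn2real (green_kernel \<alpha> x y)) * F y) \<in> borel_measurable (unit_interval \<Otimes>\<^sub>M unit_interval)"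
      using green_kernel_measurable[of \<alpha>] by (simp add: split_beta')
  qed
  have Gm': "G_operator \<alpha> F \<in> borel_measurable unit_interval"
    by (subst measurable_cong[OF G_operator_eq[OF \<alpha>(1)]]) (use Gm in simp_all)
  have fin: "(\<integral>\<^sup>+x. (green_apply \<alpha> f x)\<^sup>2 \<partial>unit_interval) < \<infinity>"
    using order_le_less_trans[OF green_apply_bound[OF \<alpha> f] ennreal_less_top] by simp
  then have Hfin: "AE x in unit_interval. (green_apply \<alpha> f x)\<^sup>2 \<noteq> \<infinity>"
    by (intro nn_integral_PInf_AE) auto
  have AEeq: "AE x in unit_interval. ennreal ((cmod (G_operator \<alpha> F x))\<^sup>2) = (green_apply \<alpha> f x)\<^sup>2"
    using green_kernel_AE_finite[OF \<alpha>] Hfin AE_space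
  proof eventually_elim
    case (elim x)
    have x: "x \<in> {0<..<1}" using elim by simp
    note gm [measurable] = green_kernel_measurable_section[OF x]
    have "G_operator \<alpha> F x = (LINT y|unit_interval. complex_of_real (enn2real (green_kernel \<alpha> x y) * enn2real (f y)))"
      unfolding G_operator_eq[OF \<alpha>(1) x] by (intro Bochner_Integration.integral_cong refl) (simp add: Fe)
    also have "\<dots> = of_real (LINT y|unit_interval. enn2real (green_kernel \<alpha> x y) * enn2real (f y))"
      by (rule integral_complex_of_real)
    also have "(LINT y|unit_interval. enn2real (green_kernel \<alpha> x y) * enn2real (f y))
        = enn2real (\<integral>\<^sup>+y. ennreal (enn2real (green_kernel \<alpha> x y) * enn2real (f y)) \<partial>unit_interval)"
      by (intro integral_eq_nn_integral) auto
    also have "(\<integral>\<^sup>+y. ennreal (enn2real (green_kernel \<alpha> x y) * enn2real (f y)) \<partial>unit_interval) = green_apply \<alpha> f x"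
      unfolding green_apply_def
    proof (rule nn_integral_cong_AE)
      show "AE y in unit_interval. ennreal (enn2real (green_kernel \<alpha> x y) * enn2real (f y)) = green_kernel \<alpha> x y * f y"
        using elim(1) ffin by eventually_elim (simp add: ennreal_mult less_top)
    qed
    finally have "G_operator \<alpha> F x = of_real (enn2real (green_apply \<alpha> f x))" .
    moreover have "green_apply \<alpha> f x \<noteq> \<infinity>" using elim(2) by auto
    ultimately show ?case by (simp add: ennreal_power[symmetric] less_top)
  qed
  have "(L2_norm_on {0<..<1} (G_operator \<alpha> F))\<^sup>2 = (LINT x|unit_interval. (cmod (G_operator \<alpha> F x))\<^sup>2)"
    unfolding L2_norm_on_def set_integral_unit_interval by (simp add: integral_nonneg_AE)
  also have "\<dots> = enn2real (\<integral>\<^sup>+x. ennreal ((cmod (G_operator \<alpha> F x))\<^sup>2) \<partial>unit_interval)"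
    using Gm' by (intro integral_eq_nn_integral) auto
  also have "(\<integral>\<^sup>+x. ennreal ((cmod (G_operator \<alpha> F x))\<^sup>2) \<partial>unit_interval) = (\<integral>\<^sup>+x. (green_apply \<alpha> f x)\<^sup>2 \<partial>unit_interval)"
    by (rule nn_integral_cong_AE[OF AEeq])
  finally show "(\<integral>\<^sup>+x. (green_apply \<alpha> f x)\<^sup>2 \<partial>unit_interval) = ennreal ((L2_norm_on {0<..<1} (G_operator \<alpha> F))\<^sup>2)"
    using fin by simp
qed

text \<open>This is |K K^T| = |K|^2. The lower bound comes from \<open>kbil_le_green_apply\<close>,
  which bounds the fourth power of |K| by the square of the norm of G.\<close>

lemma L2_opnorm_G_operator:
  assumes \<alpha>: "0 < \<alpha>" "\<alpha> < 1"
  shows "L2_opnorm_on {0<..<1} (G_operator \<alpha>) = (enn2real (limit_knorm \<alpha>))\<^sup>2"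
proof (rule antisym)
  let ?S = "{f \<in> L2_on {0<..<1}. L2_norm_on {0<..<1} f \<le> 1}"
  define L where "L = L2_opnorm_on {0<..<1} (G_operator \<alpha>)"
  have zero: "(\<lambda>_. 0) \<in> ?S"
    by (simp add: L2_on_def L2_norm_on_def set_borel_measurable_def set_integrable_def set_lebesgue_integral_def)
  show "L2_opnorm_on {0<..<1} (G_operator \<alpha>) \<le> (enn2real (limit_knorm \<alpha>))\<^sup>2"
    unfolding L2_opnorm_on_def using zero by (intro cSUP_least) (auto intro: G_operator_norm_le[OF \<alpha>])
  \<comment> \<open>A supremum of reals is known to be an upper bound only for a set that is bounded
    above.\<close>
  have bdd: "bdd_above ((\<lambda>f. L2_norm_on {0<..<1} (G_operator \<alpha> f)) ` ?S)"
    using G_operator_norm_le[OF \<alpha>] by (intro bdd_aboveI[of _ "(enn2real (limit_knorm \<alpha>))\<^sup>2"]) auto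
  have up: "L2_norm_on {0<..<1} (G_operator \<alpha> f) \<le> L" if "f \<in> ?S" for f
    unfolding L_def L2_opnorm_on_def by (rule cSUP_upper[OF that bdd])
  have nn: "0 \<le> L2_norm_on {0<..<1} h" for h
    by (simp add: L2_norm_on_def set_lebesgue_integral_def)
  have L0: "0 \<le> L" using up[OF zero] nn by (meson order_trans)
  have "limit_knorm \<alpha> \<le> ennreal (sqrt L)"
  proof (rule unit_interval.knorm_least)
    fix f g assume fg: "f \<in> unit_interval.unit_ball" "g \<in> unit_interval.unit_ball"
    define F where "F = (\<lambda>x. if x \<in> {0<..<1} then complex_of_real (enn2real (f x)) else 0)"
    note F = G_operator_norm_ge[OF \<alpha> fg(1), folded F_def]
    let ?k = "unit_interval.kbil (\<lambda>x y. ennreal (limit_kernel \<alpha> x y)) f g"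
    have "(?k\<^sup>2)\<^sup>2 \<le> ennreal ((L2_norm_on {0<..<1} (G_operator \<alpha> F))\<^sup>2)"
      using kbil_le_green_apply[OF fg, of \<alpha>] F(3) by simp
    also have "\<dots> \<le> ennreal (L\<^sup>2)" using up[of F] F nn by (intro ennreal_leI power_mono) auto
    also have "\<dots> = ((ennreal (sqrt L))\<^sup>2)\<^sup>2" using L0 by (simp add: ennreal_power)
    finally show "?k \<le> ennreal (sqrt L)" unfolding ennreal_power2_le_iff .
  qed
  then have "enn2real (limit_knorm \<alpha>) \<le> sqrt L" using L0 by (intro enn2real_leI) auto
  then have "(enn2real (limit_knorm \<alpha>))\<^sup>2 \<le> (sqrt L)\<^sup>2" by (intro power_mono) auto
  then show "(enn2real (limit_knorm \<alpha>))\<^sup>2 \<le> L2_opnorm_on {0<..<1} (G_operator \<alpha>)"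
    using L0 by (simp add: L_def)
qed

section \<open>Trigonometric polynomials\<close>

text \<open>The conjugate point \<open>cis (- \<theta>)\<close> appears because \<^const>\<open>toeplitz\<close> has the coefficient
  of index \<open>l - k\<close>, not \<open>k - l\<close>, at position \<open>(k, l)\<close>.\<close>

definition energy :: "(real \<Rightarrow> real) \<Rightarrow> complex poly \<Rightarrow> real" where
  "energy \<phi> p = (LINT \<theta>:{0..2*pi}|lborel. \<phi> \<theta> * (cmod (poly p (cis (- \<theta>))))\<^sup>2) / (2 * pi)"

lemma energy_integrable:
  assumes "continuous_on {0..2*pi} \<phi>"
  shows "set_integrable lborel {0..2*pi} (\<lambda>\<theta>. \<phi> \<theta> * (cmod (poly p (cis (- \<theta>))))\<^sup>2)"
  by (intro borel_integrable_atLeastAtMost' continuous_intros assms)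

lemma energy_mono:
  assumes "continuous_on {0..2*pi} \<phi>" "continuous_on {0..2*pi} \<psi>"
    and "\<And>\<theta>. \<theta> \<in> {0..2*pi} \<Longrightarrow>
      \<phi> \<theta> * (cmod (poly p (cis (- \<theta>))))\<^sup>2 \<le> \<psi> \<theta> * (cmod (poly q (cis (- \<theta>))))\<^sup>2"
  shows "energy \<phi> p \<le> energy \<psi> q"
  unfolding energy_def
  by (intro divide_right_mono set_integral_mono energy_integrable assms) auto

lemma energy_cmult: "energy (\<lambda>\<theta>. c * \<phi> \<theta>) p = c * energy \<phi> p"
  unfolding energy_def by (simp add: mult.assoc)

lemma energy_diff:
  assumes "continuous_on {0..2*pi} \<phi>" "continuous_on {0..2*pi} \<psi>"
  shows "energy (\<lambda>\<theta>. \<phi> \<theta> - \<psi> \<theta>) p = energy \<phi> p - energy \<psi> p"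
  unfolding energy_def left_diff_distrib
  by (subst set_integral_diff(2)) (auto intro: energy_integrable assms simp: diff_divide_distrib)

lemma poly_eq_sum_lessThan: "degree p < n \<Longrightarrow> poly p z = (\<Sum>l<n. coeff p l * z ^ l)"
  for p :: "'a::comm_semiring_1 poly"
  unfolding poly_altdef
  by (rule sum.mono_neutral_left) (auto simp: coeff_eq_0)

lemma set_integral_sum2:
  fixes g :: "nat \<Rightarrow> nat \<Rightarrow> real \<Rightarrow> complex"
  assumes "\<And>k l. set_integrable lborel S (g k l)"
  shows "(LINT x:S|lborel. (\<Sum>k<n. \<Sum>l<n. g k l x)) = (\<Sum>k<n. \<Sum>l<n. LINT x:S|lborel. g k l x)"
  using assms unfolding set_integrable_def set_lebesgue_integral_def scaleR_sum_right
  by (simp only: Bochner_Integration.integral_sum Bochner_Integration.integrable_sum)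

text \<open>Expansion of |p|^2 into a double sum; at the conjugate point the term (k, l) carries the
  exponent -(l - k), as in \<open>fourier_coeff\<close>.\<close>

lemma qform_fourier_coeff:
  assumes \<phi>: "continuous_on {0..2*pi} \<phi>" and f: "\<And>\<theta>. f (exp (\<i> * of_real \<theta>)) = complex_of_real (\<phi> \<theta>)"
    and n: "degree p < n"
  shows "qform n (\<lambda>k l. fourier_coeff f (int l - int k)) (coeff p) = energy \<phi> p"
proof -
  define e where "e k l \<theta> = exp (- \<i> * of_int (int l - int k) * of_real \<theta>)" for k l :: nat and \<theta> :: real
  have pt: "complex_of_real (\<phi> \<theta> * (cmod (poly p (cis (- \<theta>))))\<^sup>2)
      = (\<Sum>k<n. \<Sum>l<n. cnj (coeff p k) * coeff p l * (of_real (\<phi> \<theta>) * e k l \<theta>))" for \<theta>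
  proof -
    define z where "z = cis (- \<theta>)"
    have e: "cnj (z ^ k) * z ^ l = e k l \<theta>" for k l
    proof -
      have "cnj (z ^ k) * z ^ l = cis (real k * \<theta> - real l * \<theta>)"
        unfolding z_def complex_cnj_power cis_cnj Complex.DeMoivre cis_mult
        by (rule arg_cong[of _ _ cis]) simp
      then show ?thesis by (simp add: e_def cis_conv_exp algebra_simps)
    qed
    have "of_real ((cmod (poly p z))\<^sup>2) = cnj (poly p z) * poly p z"
      by (simp add: complex_norm_square mult.commute del: of_real_power)
    also have "\<dots> = (\<Sum>k<n. \<Sum>l<n. cnj (coeff p k * z ^ k) * (coeff p l * z ^ l))"
      unfolding poly_eq_sum_lessThan[OF n] cnj_sum sum_product ..
    also have "\<dots> = (\<Sum>k<n. \<Sum>l<n. cnj (coeff p k) * coeff p l * e k l \<theta>)"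
      by (intro sum.cong refl) (simp add: e[symmetric])
    finally have "complex_of_real (\<phi> \<theta> * (cmod (poly p z))\<^sup>2)
        = of_real (\<phi> \<theta>) * (\<Sum>k<n. \<Sum>l<n. cnj (coeff p k) * coeff p l * e k l \<theta>)"
      by simp
    then show ?thesis unfolding z_def by (simp add: sum_distrib_left mult_ac)
  qed
  have int: "set_integrable lborel {0..2*pi} (\<lambda>\<theta>. of_real (\<phi> \<theta>) * e k l \<theta>)" for k l
    unfolding e_def by (intro borel_integrable_atLeastAtMost' continuous_intros \<phi>)
  have fc: "(LINT \<theta>:{0..2*pi}|lborel. of_real (\<phi> \<theta>) * e k l \<theta>) = 2 * of_real pi * fourier_coeff f (int l - int k)" for k l
    by (simp add: fourier_coeff_def f e_def)
  have "complex_of_real (LINT \<theta>:{0..2*pi}|lborel. \<phi> \<theta> * (cmod (poly p (cis (- \<theta>))))\<^sup>2)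
      = (LINT \<theta>:{0..2*pi}|lborel. complex_of_real (\<phi> \<theta> * (cmod (poly p (cis (- \<theta>))))\<^sup>2))"
    by (rule set_integral_complex_of_real[symmetric])
  also have "\<dots> = (\<Sum>k<n. \<Sum>l<n. LINT \<theta>:{0..2*pi}|lborel. cnj (coeff p k) * coeff p l * (of_real (\<phi> \<theta>) * e k l \<theta>))"
    unfolding pt by (rule set_integral_sum2) (intro set_integrable_mult_right int)
  also have "\<dots> = of_real (2 * pi) * (\<Sum>k<n. \<Sum>l<n. cnj (coeff p k) * fourier_coeff f (int l - int k) * coeff p l)"
    unfolding set_integral_mult_right fc by (simp add: sum_distrib_left mult_ac)
  finally have "Re (complex_of_real (LINT \<theta>:{0..2*pi}|lborel. \<phi> \<theta> * (cmod (poly p (cis (- \<theta>))))\<^sup>2))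
      = Re (of_real (2 * pi) * (\<Sum>k<n. \<Sum>l<n. cnj (coeff p k) * fourier_coeff f (int l - int k) * coeff p l))"
    by (rule arg_cong)
  then show ?thesis unfolding energy_def qform_def by simp
qed

lemma fourier_coeff_one: "fourier_coeff (\<lambda>_. 1) j = (if j = 0 then 1 else 0)"
proof (cases "j = 0")
  case True
  then show ?thesis by (simp add: fourier_coeff_def set_lebesgue_integral_def scaleR_conv_of_real)
next
  case False
  define g where "g \<theta> = exp (- \<i> * of_int j * of_real \<theta>) / (- \<i> * of_int j)" for \<theta> :: real
  have "((\<lambda>\<theta>. exp (- \<i> * of_int j * of_real \<theta>)) has_integral (g (2*pi) - g 0)) {0..2*pi}"
  proof (rule fundamental_theorem_of_calculus)
    show "(g has_vector_derivative exp (- \<i> * of_int j * of_real \<theta>)) (at \<theta> within {0..2*pi})" for \<theta>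
      unfolding g_def using False
      by (auto intro!: derivative_eq_intros has_vector_derivative_real_field)
  qed simp
  moreover have "exp (- \<i> * of_int j * of_real (2 * pi)) = 1"
    using exp_integer_2pi[of "of_int (- j)"] by (simp add: mult_ac)
  then have "g (2*pi) - g 0 = 0" by (simp add: g_def)
  ultimately have "integral {0..2*pi} (\<lambda>\<theta>. exp (- \<i> * of_int j * of_real \<theta>)) = 0"
    by (simp add: integral_unique)
  moreover have "set_integrable lborel {0..2*pi} (\<lambda>\<theta>. exp (- \<i> * of_int j * of_real \<theta>))"
    by (intro borel_integrable_atLeastAtMost' continuous_intros)
  ultimately have "(LINT \<theta>:{0..2*pi}|lborel. exp (- \<i> * of_int j * of_real \<theta>)) = 0"
    using set_borel_integral_eq_integral(2) by metis
  then show ?thesis using False by (simp add: fourier_coeff_def)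
qed

lemma energy_one:
  assumes "degree p < n"
  shows "energy (\<lambda>_. 1) p = sqnorm n (coeff p)"
proof -
  have "energy (\<lambda>_. 1) p = qform n (\<lambda>k l. fourier_coeff (\<lambda>_. 1) (int l - int k)) (coeff p)"
    by (rule qform_fourier_coeff[symmetric]) (use assms in auto)
  also have "\<dots> = Re (\<Sum>k<n. \<Sum>l<n. if l = k then of_real ((cmod (coeff p k))\<^sup>2) else 0)"
    unfolding qform_def fourier_coeff_one
    by (intro arg_cong[of _ _ Re] sum.cong refl) (auto simp: complex_norm_square mult.commute simp del: of_real_power)
  also have "\<dots> = sqnorm n (coeff p)" by (simp add: sqnorm_def)
  finally show ?thesis .
qed

lemma fourier_coeff_hermitian:
  assumes "\<And>\<theta>. f (exp (\<i> * of_real \<theta>)) = complex_of_real (\<phi> \<theta>)"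
  shows "fourier_coeff f (- j) = cnj (fourier_coeff f j)"
proof -
  have "cnj (LINT \<theta>:{0..2*pi}|lborel. f (exp (\<i> * of_real \<theta>)) * exp (- \<i> * of_int j * of_real \<theta>))
      = (LINT \<theta>:{0..2*pi}|lborel. f (exp (\<i> * of_real \<theta>)) * exp (- \<i> * of_int (- j) * of_real \<theta>))"
    unfolding set_lebesgue_integral_def
    by (subst Bochner_Integration.integral_cnj[symmetric], intro Bochner_Integration.integral_cong refl)
      (simp add: assms exp_cnj)
  then show ?thesis by (simp add: fourier_coeff_def)
qed

text \<open>Vectors of length n are read as coefficients of polynomials of degree below n, which can
  be multiplied by the averager.\<close>

lemma min_eigenvalue_energy:
  assumes \<phi>: "continuous_on {0..2*pi} \<phi>" and f: "\<And>\<theta>. f (exp (\<i> * of_real \<theta>)) = complex_of_real (\<phi> \<theta>)"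
    and n: "0 < n"
  defines "\<mu> \<equiv> min_eigenvalue (mat n n (\<lambda>(k, l). fourier_coeff f (int l - int k)))"
  shows "degree p < n \<Longrightarrow> \<mu> * energy (\<lambda>_. 1) p \<le> energy \<phi> p"
    and "\<exists>p. degree p < n \<and> energy (\<lambda>_. 1) p = 1 \<and> energy \<phi> p = \<mu>"
proof -
  let ?T = "\<lambda>k l. fourier_coeff f (int l - int k)"
  have herm: "?T j i = cnj (?T i j)" for i j
    using fourier_coeff_hermitian[of f \<phi> "int j - int i", OF f] by simp
  note ray = min_eigenvalue_rayleigh[of n ?T, OF n herm, folded \<mu>_def]
  show "\<mu> * energy (\<lambda>_. 1) p \<le> energy \<phi> p" if "degree p < n"
    using ray(1)[of "coeff p"] unfolding qform_fourier_coeff[OF \<phi> f that] energy_one[OF that] .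
  obtain u where u: "sqnorm n u = 1" "qform n ?T u = \<mu>" using ray(2) by blast
  define p where "p = (\<Sum>l<n. monom (u l) l)"
  have c: "coeff p l = u l" if "l < n" for l
    using that by (simp add: p_def coeff_sum)
  have "degree p \<le> n - 1" unfolding p_def
    by (intro degree_sum_le) (auto intro: order.trans[OF degree_monom_le])
  then have d: "degree p < n" using n by linarith
  have "sqnorm n (coeff p) = sqnorm n u" "qform n ?T (coeff p) = qform n ?T u"
    by (simp_all add: sqnorm_def qform_def c)
  then have "energy (\<lambda>_. 1) p = 1" "energy \<phi> p = \<mu>"
    using u energy_one[OF d] qform_fourier_coeff[OF \<phi> f d] by simp_all
  then show "\<exists>p. degree p < n \<and> energy (\<lambda>_. 1) p = 1 \<and> energy \<phi> p = \<mu>" using d by blast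
qed

section \<open>The averaging multiplier and its cost\<close>

definition averager :: "nat \<Rightarrow> complex poly" where
  "averager m = (\<Sum>j<m. monom (1 / of_nat m) j)"

lemma poly_averager: "poly (averager m) z = (\<Sum>j<m. z ^ j) / of_nat m"
  by (simp add: averager_def poly_sum poly_monom sum_divide_distrib)

lemma degree_averager: "0 < m \<Longrightarrow> degree (averager m) < m"
proof -
  assume m: "0 < m"
  have "degree (averager m) \<le> m - 1" unfolding averager_def
    by (intro degree_sum_le) (auto intro: order.trans[OF degree_monom_le])
  then show ?thesis using m by linarith
qed

lemma degree_mult_averager:
  assumes "degree p < n" "0 < m"
  shows "degree (p * averager m) < n + m"
  using degree_mult_le[of p "averager m"] degree_averager[OF assms(2)] assms(1) by linarith

lemma norm_averager_le_1:
  assumes "cmod z = 1" "0 < m"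
  shows "cmod (poly (averager m) z) \<le> 1"
proof -
  have "cmod (\<Sum>j<m. z ^ j) \<le> (\<Sum>j<m. cmod (z ^ j))" by (rule norm_sum)
  also have "\<dots> = m" using assms by (simp add: norm_power)
  finally show ?thesis using assms by (simp add: poly_averager norm_divide)
qed

lemma norm_averager_decay:
  assumes "cmod z = 1" "0 < m"
  shows "real m * cmod (1 - z) * cmod (poly (averager m) z) \<le> 2"
proof -
  have "(1 - z) * (\<Sum>j<m. z ^ j) = 1 - z ^ m" by (rule one_diff_power_eq[symmetric])
  then have "cmod (1 - z) * cmod (\<Sum>j<m. z ^ j) = cmod (1 - z ^ m)" by (metis norm_mult)
  also have "\<dots> \<le> 1 + 1" using norm_triangle_ineq4[of 1 "z ^ m"] assms by (simp add: norm_power)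
  finally show ?thesis using assms by (simp add: poly_averager norm_divide)
qed

lemma norm_one_minus_averager:
  assumes z: "cmod z = 1" and m: "0 < m"
  shows "cmod (1 - poly (averager m) z) \<le> real m * cmod (1 - z)"
proof -
  have pw: "cmod (1 - z ^ j) \<le> real j * cmod (1 - z)" for j
  proof (induction j)
    case (Suc j)
    have "1 - z ^ Suc j = (1 - z ^ j) + z ^ j * (1 - z)" by (simp add: algebra_simps)
    then have "cmod (1 - z ^ Suc j) \<le> cmod (1 - z ^ j) + cmod (z ^ j * (1 - z))"
      by (metis norm_triangle_ineq)
    also have "\<dots> \<le> real j * cmod (1 - z) + cmod (1 - z)" using Suc z by (simp add: norm_mult norm_power)
    finally show ?case by (simp add: algebra_simps)
  qed simp
  have "1 - poly (averager m) z = (\<Sum>j<m. 1 - z ^ j) / of_nat m"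
    using m by (simp add: poly_averager sum_subtractf diff_divide_distrib)
  then have "cmod (1 - poly (averager m) z) = cmod (\<Sum>j<m. 1 - z ^ j) / real m" by (simp add: norm_divide)
  also have "\<dots> \<le> (\<Sum>j<m. real m * cmod (1 - z)) / real m"
  proof (intro divide_right_mono order.trans[OF norm_sum] sum_mono)
    fix j assume "j \<in> {..<m}"
    then have "real j * cmod (1 - z) \<le> real m * cmod (1 - z)" by (intro mult_right_mono) auto
    with pw[of j] show "cmod (1 - z ^ j) \<le> real m * cmod (1 - z)" by linarith
  qed simp
  also have "\<dots> = real m * cmod (1 - z)" using m by simp
  finally show ?thesis .
qed

text \<open>With x = m |1 - z| the defect 1 - |a| is at most x and at most 1, hence at most
  x^\<beta> for \<beta> \<le> 1. For \<beta> = 2\<alpha> the right-hand side is a multiple of the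
  weight |1 - z|^(2\<alpha>).\<close>

lemma averager_loss:
  assumes z: "cmod z = 1" and m: "0 < m" and \<beta>: "0 < \<beta>" "\<beta> \<le> 1"
  shows "1 - (cmod (poly (averager m) z))\<^sup>2 \<le> 4 * (real m powr \<beta> * cmod (1 - z) powr \<beta>)"
proof -
  define a where "a = cmod (poly (averager m) z)"
  define x where "x = real m * cmod (1 - z)"
  have a: "0 \<le> a" "a \<le> 1" using norm_averager_le_1[OF z m] by (simp_all add: a_def)
  have x: "0 \<le> x" by (simp add: x_def)
  have "1 - a \<le> cmod (1 - poly (averager m) z)"
    using norm_triangle_ineq2[of 1 "poly (averager m) z"] by (simp add: a_def)
  then have ax: "1 - a \<le> x" using norm_one_minus_averager[OF z m] by (simp add: x_def)
  have "1 - a \<le> x powr \<beta>"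
  proof (cases "x \<le> 1")
    case True
    then have "x powr 1 \<le> x powr \<beta>" using x \<beta> by (intro powr_mono') auto
    then show ?thesis using ax x by simp
  next
    case False
    then have "1 \<le> x powr \<beta>" using \<beta> by (intro ge_one_powr_ge_zero) auto
    then show ?thesis using a by linarith
  qed
  moreover have "1 - a\<^sup>2 = (1 - a) * (1 + a)" by (simp add: power2_eq_square algebra_simps)
  moreover have "(1 - a) * (1 + a) \<le> (1 - a) * 2" using a by (intro mult_left_mono) auto
  moreover have "0 \<le> x powr \<beta>" by simp
  ultimately have "1 - a\<^sup>2 \<le> 4 * x powr \<beta>" by argo
  then show ?thesis by (simp add: a_def x_def powr_mult)
qed

definition wt :: "real \<Rightarrow> real \<Rightarrow> real" where
  "wt \<alpha> \<theta> = cmod (1 - cis (- \<theta>)) powr (2 * \<alpha>)"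

lemma wt_nonneg: "0 \<le> wt \<alpha> \<theta>"
  by (simp add: wt_def)

lemma continuous_wt: "0 < \<alpha> \<Longrightarrow> continuous_on S (wt \<alpha>)"
  unfolding wt_def by (intro continuous_on_powr' continuous_intros) auto

lemma wt_eq: "cmod (1 - exp (\<i> * of_real \<theta>)) powr (2 * \<alpha>) = wt \<alpha> \<theta>"
proof -
  have "cmod (1 - cis \<theta>) = cmod (cnj (1 - cis \<theta>))" by (rule complex_mod_cnj[symmetric])
  then show ?thesis by (simp add: wt_def cis_conv_exp[symmetric] cis_cnj)
qed

text \<open>\<open>averager_loss\<close> integrated against |p|^2. If p has norm 1 and energy of
  order n^(-2\<alpha>), the loss is of order (m / n)^(2\<alpha>).\<close>

lemma energy_averager_ge:
  assumes \<alpha>: "0 < \<alpha>" "\<alpha> < 1/2" and m: "0 < m"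
  shows "energy (\<lambda>_. 1) p - 4 * real m powr (2 * \<alpha>) * energy (wt \<alpha>) p \<le> energy (\<lambda>_. 1) (p * averager m)"
proof -
  have "energy (\<lambda>_. 1) p - 4 * real m powr (2 * \<alpha>) * energy (wt \<alpha>) p
      = energy (\<lambda>\<theta>. 1 - 4 * real m powr (2 * \<alpha>) * wt \<alpha> \<theta>) p"
    using \<alpha> by (subst energy_diff) (auto simp: energy_cmult intro!: continuous_intros continuous_wt)
  also have "\<dots> \<le> energy (\<lambda>_. 1) (p * averager m)"
  proof (rule energy_mono)
    fix \<theta>
    let ?z = "cis (- \<theta>)"
    have "1 - 4 * real m powr (2 * \<alpha>) * wt \<alpha> \<theta> \<le> (cmod (poly (averager m) ?z))\<^sup>2"
      using averager_loss[of ?z m "2 * \<alpha>"] \<alpha> m by (simp add: wt_def)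
    then show "(1 - 4 * real m powr (2 * \<alpha>) * wt \<alpha> \<theta>) * (cmod (poly p ?z))\<^sup>2
        \<le> 1 * (cmod (poly (p * averager m) ?z))\<^sup>2"
      by (simp add: norm_mult power_mult_distrib mult.commute mult_left_mono)
  qed (use \<alpha> in \<open>auto intro!: continuous_intros continuous_wt\<close>)
  finally show ?thesis .
qed

section \<open>Perturbation of the weight\<close>

text \<open>Here \<open>c\<close> is the factor c_1 as a function of the angle and
  \<open>c\<^sub>0\<close> its value at z = 1. Continuity at 1 is expressed through the distance on
  the circle, so both ends of the interval of angles count as near.\<close>

locale perturbed_weight =
  fixes \<alpha> c\<^sub>0 c_low c_up :: real and c :: "real \<Rightarrow> real"
  assumes \<alpha>: "0 < \<alpha>" "\<alpha> < 1/2"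
    and cont: "continuous_on {0..2*pi} c"
    and low: "0 < c_low" "\<And>\<theta>. \<theta> \<in> {0..2*pi} \<Longrightarrow> c_low \<le> c \<theta>"
    and up: "\<And>\<theta>. \<theta> \<in> {0..2*pi} \<Longrightarrow> c \<theta> \<le> c_up"
    and near: "\<And>\<eta>. 0 < \<eta> \<Longrightarrow> \<exists>\<delta>>0. \<forall>\<theta>\<in>{0..2*pi}. cmod (1 - cis (- \<theta>)) < \<delta> \<longrightarrow> \<bar>c \<theta> - c\<^sub>0\<bar> \<le> \<eta>"
begin

definition pw :: "real \<Rightarrow> real" where
  "pw \<theta> = wt \<alpha> \<theta> * c \<theta>"

lemma continuous_pw: "continuous_on {0..2*pi} pw"
  unfolding pw_def using \<alpha> by (intro continuous_intros continuous_wt cont) auto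

lemma c_up_pos: "0 < c_up"
  using low(1) up[of 0] low(2)[of 0] by auto

lemma c\<^sub>0_pos: "0 < c\<^sub>0"
proof -
  have "\<bar>c 0 - c\<^sub>0\<bar> \<le> c_low / 2" using near[of "c_low / 2"] low(1) by force
  moreover have "c_low \<le> c 0" by (rule low) auto
  ultimately show ?thesis using low(1) by linarith
qed

lemma averager_far:
  assumes m: "0 < m" and \<delta>: "0 < \<delta>" "\<delta> \<le> cmod (1 - cis (- \<theta>))"
  shows "(cmod (poly (averager m) (cis (- \<theta>))))\<^sup>2 \<le> 4 / (\<delta>\<^sup>2 * (real m)\<^sup>2)"
proof -
  let ?a = "cmod (poly (averager m) (cis (- \<theta>)))"
  have "real m * \<delta> * ?a \<le> real m * cmod (1 - cis (- \<theta>)) * ?a"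
    using \<delta> by (intro mult_right_mono mult_left_mono) auto
  also have "\<dots> \<le> 2" using m by (intro norm_averager_decay) auto
  finally have "(real m * \<delta> * ?a)\<^sup>2 \<le> 2\<^sup>2" using \<delta> by (intro power_mono) auto
  then have "?a\<^sup>2 * (\<delta>\<^sup>2 * (real m)\<^sup>2) \<le> 4" by (simp add: power_mult_distrib mult_ac)
  then show ?thesis using m \<delta> by (simp add: pos_le_divide_eq)
qed

lemma averager_near_le_1: "0 < m \<Longrightarrow> (cmod (poly (averager m) (cis (- \<theta>))))\<^sup>2 \<le> 1"
  using norm_averager_le_1[of "cis (- \<theta>)" m] by (simp add: power_le_one)

text \<open>A pointwise comparison. Within \<delta> of 1 the value of c is at least c_0 - \<eta> and
  the multiplier at most 1 in modulus; farther away its decay makes the left-hand side small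
  compared with c_low, and the error is absorbed into the factor 1 + K / m^2.\<close>

lemma energy_wt_averager_le:
  assumes "0 < \<eta>"
  shows "\<exists>K. \<forall>m>0. \<forall>p. (c\<^sub>0 - \<eta>) * energy (wt \<alpha>) (p * averager m) \<le> (1 + K / (real m)\<^sup>2) * energy pw p"
proof -
  obtain \<delta> where \<delta>: "0 < \<delta>" "\<And>\<theta>. \<theta> \<in> {0..2*pi} \<Longrightarrow> cmod (1 - cis (- \<theta>)) < \<delta> \<Longrightarrow> \<bar>c \<theta> - c\<^sub>0\<bar> \<le> \<eta>"
    using near[OF assms] by blast
  \<comment> \<open>Makes |c_0 - \<eta>| times the decay bound 4 / (\<delta>^2 m^2) equal to K / m^2
    times c_low.\<close>
  define K where "K = \<bar>c\<^sub>0 - \<eta>\<bar> * 4 / \<delta>\<^sup>2 / c_low"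
  have K: "0 \<le> K" using low by (simp add: K_def)
  have "(c\<^sub>0 - \<eta>) * energy (wt \<alpha>) (p * averager m) \<le> (1 + K / (real m)\<^sup>2) * energy pw p" if m: "0 < m" for m p
    unfolding energy_cmult[symmetric]
  proof (rule energy_mono)
    fix \<theta> :: real assume \<theta>: "\<theta> \<in> {0..2*pi}"
    let ?a = "(cmod (poly (averager m) (cis (- \<theta>))))\<^sup>2"
    have cl: "c_low \<le> c \<theta>" "0 < c \<theta>" using low(1) low(2)[OF \<theta>] by auto
    have "(c\<^sub>0 - \<eta>) * ?a \<le> (1 + K / (real m)\<^sup>2) * c \<theta>"
    proof (cases "cmod (1 - cis (- \<theta>)) < \<delta>")
      case True
      then have "c\<^sub>0 - \<eta> \<le> c \<theta>" using \<delta>(2)[OF \<theta>] by (simp add: abs_le_iff)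
      then have "(c\<^sub>0 - \<eta>) * ?a \<le> c \<theta> * ?a" by (intro mult_right_mono) auto
      also have "\<dots> \<le> c \<theta> * 1" using cl averager_near_le_1[OF m] by (intro mult_left_mono) auto
      also have "\<dots> \<le> (1 + K / (real m)\<^sup>2) * c \<theta>" using cl K by (simp add: distrib_right)
      finally show ?thesis .
    next
      case False
      have "(c\<^sub>0 - \<eta>) * ?a \<le> \<bar>c\<^sub>0 - \<eta>\<bar> * ?a" by (intro mult_right_mono) auto
      also have "\<dots> \<le> \<bar>c\<^sub>0 - \<eta>\<bar> * (4 / (\<delta>\<^sup>2 * (real m)\<^sup>2))"
        using False \<delta>(1) m by (intro mult_left_mono averager_far) auto
      also have "\<dots> = K / (real m)\<^sup>2 * c_low" using low by (simp add: K_def)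
      also have "\<dots> \<le> K / (real m)\<^sup>2 * c \<theta>" using cl K by (intro mult_left_mono) auto
      also have "\<dots> \<le> (1 + K / (real m)\<^sup>2) * c \<theta>" using cl by (simp add: distrib_right)
      finally show ?thesis .
    qed
    then have "(c\<^sub>0 - \<eta>) * ?a * (wt \<alpha> \<theta> * (cmod (poly p (cis (- \<theta>))))\<^sup>2)
        \<le> (1 + K / (real m)\<^sup>2) * c \<theta> * (wt \<alpha> \<theta> * (cmod (poly p (cis (- \<theta>))))\<^sup>2)"
      by (intro mult_right_mono) (auto simp: wt_nonneg)
    then show "(c\<^sub>0 - \<eta>) * wt \<alpha> \<theta> * (cmod (poly (p * averager m) (cis (- \<theta>))))\<^sup>2
        \<le> (1 + K / (real m)\<^sup>2) * pw \<theta> * (cmod (poly p (cis (- \<theta>))))\<^sup>2"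
      by (simp add: pw_def norm_mult power_mult_distrib mult_ac)
  qed (use \<alpha> in \<open>auto intro!: continuous_intros continuous_wt continuous_pw\<close>)
  then show ?thesis by blast
qed

text \<open>The same dichotomy for the converse comparison; far from 1 the decay of the multiplier
  now meets the upper bound c_up.\<close>

lemma energy_pw_averager_le:
  assumes "0 < \<eta>"
  shows "\<exists>K. \<forall>m>0. \<forall>p. energy pw (p * averager m) \<le> (c\<^sub>0 + \<eta> + K / (real m)\<^sup>2) * energy (wt \<alpha>) p"
proof -
  obtain \<delta> where \<delta>: "0 < \<delta>" "\<And>\<theta>. \<theta> \<in> {0..2*pi} \<Longrightarrow> cmod (1 - cis (- \<theta>)) < \<delta> \<Longrightarrow> \<bar>c \<theta> - c\<^sub>0\<bar> \<le> \<eta>"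
    using near[OF assms] by blast
  define K where "K = c_up * 4 / \<delta>\<^sup>2"
  have K: "0 \<le> K" using c_up_pos by (simp add: K_def)
  have c0: "0 < c\<^sub>0 + \<eta>"
  proof -
    have "\<bar>c 0 - c\<^sub>0\<bar> \<le> \<eta>" using \<delta>(1) by (intro \<delta>(2)) auto
    moreover have "0 < c 0" using low(1) low(2)[of 0] by auto
    ultimately show ?thesis by linarith
  qed
  have "energy pw (p * averager m) \<le> (c\<^sub>0 + \<eta> + K / (real m)\<^sup>2) * energy (wt \<alpha>) p" if m: "0 < m" for m p
    unfolding energy_cmult[symmetric]
  proof (rule energy_mono)
    fix \<theta> :: real assume \<theta>: "\<theta> \<in> {0..2*pi}"
    let ?a = "(cmod (poly (averager m) (cis (- \<theta>))))\<^sup>2"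
    have cl: "0 < c \<theta>" using low(1) low(2)[OF \<theta>] by auto
    have "c \<theta> * ?a \<le> c\<^sub>0 + \<eta> + K / (real m)\<^sup>2"
    proof (cases "cmod (1 - cis (- \<theta>)) < \<delta>")
      case True
      have "c \<theta> * ?a \<le> c \<theta> * 1" using cl averager_near_le_1[OF m] by (intro mult_left_mono) auto
      also have "\<dots> \<le> c\<^sub>0 + \<eta>" using \<delta>(2)[OF \<theta> True] by (simp add: abs_le_iff)
      also have "\<dots> \<le> c\<^sub>0 + \<eta> + K / (real m)\<^sup>2" using K by simp
      finally show ?thesis .
    next
      case False
      have "c \<theta> * ?a \<le> c_up * (4 / (\<delta>\<^sup>2 * (real m)\<^sup>2))"
        using False \<delta>(1) m up[OF \<theta>] c_up_pos by (intro mult_mono averager_far) auto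
      also have "\<dots> = K / (real m)\<^sup>2" by (simp add: K_def)
      also have "\<dots> \<le> c\<^sub>0 + \<eta> + K / (real m)\<^sup>2" using c0 by simp
      finally show ?thesis .
    qed
    then have "c \<theta> * ?a * (wt \<alpha> \<theta> * (cmod (poly p (cis (- \<theta>))))\<^sup>2)
        \<le> (c\<^sub>0 + \<eta> + K / (real m)\<^sup>2) * (wt \<alpha> \<theta> * (cmod (poly p (cis (- \<theta>))))\<^sup>2)"
      by (intro mult_right_mono) (auto simp: wt_nonneg)
    then show "pw \<theta> * (cmod (poly (p * averager m) (cis (- \<theta>))))\<^sup>2
        \<le> (c\<^sub>0 + \<eta> + K / (real m)\<^sup>2) * wt \<alpha> \<theta> * (cmod (poly p (cis (- \<theta>))))\<^sup>2"
      by (simp add: pw_def norm_mult power_mult_distrib mult_ac)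
  qed (use \<alpha> in \<open>auto intro!: continuous_intros continuous_wt continuous_pw\<close>)
  then show ?thesis by blast
qed

text \<open>Crude two-sided control, used for the a priori order n^(-2\<alpha>) and for bounding the
  loss of norm.\<close>

lemma energy_pw_bounds: "c_low * energy (wt \<alpha>) p \<le> energy pw p" "energy pw p \<le> c_up * energy (wt \<alpha>) p"
  unfolding energy_cmult[symmetric] using \<alpha> low up wt_nonneg
  by (auto intro!: energy_mono continuous_intros continuous_wt continuous_pw mult_right_mono
      simp: pw_def mult.commute mult_left_mono)

end

section \<open>Comparison of the two least eigenvalues\<close>

definition rayleigh_min :: "(real \<Rightarrow> real) \<Rightarrow> (nat \<Rightarrow> real) \<Rightarrow> bool" where
  "rayleigh_min \<phi> \<mu> \<longleftrightarrow> (\<forall>n>0. (\<forall>p. degree p < n \<longrightarrow> \<mu> n * energy (\<lambda>_. 1) p \<le> energy \<phi> p) \<and>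
     (\<exists>p. degree p < n \<and> energy (\<lambda>_. 1) p = 1 \<and> energy \<phi> p = \<mu> n))"

context perturbed_weight
begin

context
  fixes lam Lam :: "nat \<Rightarrow> real" and L :: real
  assumes lam: "rayleigh_min (wt \<alpha>) lam" and Lam: "rayleigh_min pw Lam"
    and lam_lim: "(\<lambda>n. real n powr (2 * \<alpha>) * lam n) \<longlonglongrightarrow> L"
    and lam_pos: "\<And>n. 0 < n \<Longrightarrow> 0 < lam n"
begin

lemma Lam_nonneg:
  assumes "0 < n"
  shows "0 \<le> Lam n"
proof -
  obtain q where q: "energy pw q = Lam n" using Lam assms unfolding rayleigh_min_def by blast
  have "0 \<le> c_low * energy (wt \<alpha>) q"
    using low unfolding energy_def set_lebesgue_integral_def
    by (auto intro!: mult_nonneg_nonneg divide_nonneg_nonneg Bochner_Integration.integral_nonneg simp: wt_nonneg)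
  then show ?thesis using energy_pw_bounds(1)[of q] q by linarith
qed

text \<open>An extremal polynomial of the perturbed weight, multiplied by the averager, competes for
  the pure weight at size n + m. Its loss of norm is controlled by its pure energy before averaging,
  which is at most \<open>Lam n / c_low\<close>.\<close>

lemma Lam_lower:
  assumes "0 < \<eta>" "\<eta> < c\<^sub>0"
  shows "\<exists>K. \<forall>n>0. \<forall>m>0. (c\<^sub>0 - \<eta>) * (lam (n + m) * (1 - 4 * real m powr (2 * \<alpha>) * (Lam n / c_low)))
    \<le> (1 + K / (real m)\<^sup>2) * Lam n"
proof -
  obtain K where K: "\<And>m p. 0 < m \<Longrightarrow> (c\<^sub>0 - \<eta>) * energy (wt \<alpha>) (p * averager m) \<le> (1 + K / (real m)\<^sup>2) * energy pw p"
    using energy_wt_averager_le[OF assms(1)] by blast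
  have "(c\<^sub>0 - \<eta>) * (lam (n + m) * (1 - 4 * real m powr (2 * \<alpha>) * (Lam n / c_low))) \<le> (1 + K / (real m)\<^sup>2) * Lam n"
    if n: "0 < n" and m: "0 < m" for n m
  proof -
    obtain p where p: "degree p < n" "energy (\<lambda>_. 1) p = 1" "energy pw p = Lam n"
      using Lam n unfolding rayleigh_min_def by blast
    have "energy (wt \<alpha>) p \<le> Lam n / c_low"
      using energy_pw_bounds(1)[of p] p low by (simp add: pos_le_divide_eq mult.commute)
    then have "4 * real m powr (2 * \<alpha>) * energy (wt \<alpha>) p \<le> 4 * real m powr (2 * \<alpha>) * (Lam n / c_low)"
      by (intro mult_left_mono) auto
    then have "1 - 4 * real m powr (2 * \<alpha>) * (Lam n / c_low) \<le> energy (\<lambda>_. 1) (p * averager m)"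
      using energy_averager_ge[OF \<alpha> m, of p] p by linarith
    then have "lam (n + m) * (1 - 4 * real m powr (2 * \<alpha>) * (Lam n / c_low)) \<le> lam (n + m) * energy (\<lambda>_. 1) (p * averager m)"
      using lam_pos[of "n + m"] n by (intro mult_left_mono) auto
    also have "\<dots> \<le> energy (wt \<alpha>) (p * averager m)"
      using lam n degree_mult_averager[OF p(1) m] unfolding rayleigh_min_def by auto
    finally have "(c\<^sub>0 - \<eta>) * (lam (n + m) * (1 - 4 * real m powr (2 * \<alpha>) * (Lam n / c_low)))
        \<le> (c\<^sub>0 - \<eta>) * energy (wt \<alpha>) (p * averager m)"
      using assms by (intro mult_left_mono) auto
    also have "\<dots> \<le> (1 + K / (real m)\<^sup>2) * Lam n" using K[OF m, of p] p by simp
    finally show ?thesis .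
  qed
  then show ?thesis by blast
qed

text \<open>The roles exchanged: an extremal polynomial of the pure weight competes for the
  perturbed one. The bracket on the left may be negative; the estimate of the norm is multiplied by
  \<open>Lam (n + m)\<close>, which is nonnegative.\<close>

lemma Lam_upper:
  assumes "0 < \<eta>"
  shows "\<exists>K. \<forall>n>0. \<forall>m>0. Lam (n + m) * (1 - 4 * real m powr (2 * \<alpha>) * lam n) \<le> (c\<^sub>0 + \<eta> + K / (real m)\<^sup>2) * lam n"
proof -
  obtain K where K: "\<And>m p. 0 < m \<Longrightarrow> energy pw (p * averager m) \<le> (c\<^sub>0 + \<eta> + K / (real m)\<^sup>2) * energy (wt \<alpha>) p"
    using energy_pw_averager_le[OF assms] by blast
  have "Lam (n + m) * (1 - 4 * real m powr (2 * \<alpha>) * lam n) \<le> (c\<^sub>0 + \<eta> + K / (real m)\<^sup>2) * lam n"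
    if n: "0 < n" and m: "0 < m" for n m
  proof -
    obtain p where p: "degree p < n" "energy (\<lambda>_. 1) p = 1" "energy (wt \<alpha>) p = lam n"
      using lam n unfolding rayleigh_min_def by blast

    have "0 \<le> Lam (n + m)" using n by (intro Lam_nonneg) simp
    moreover have "1 - 4 * real m powr (2 * \<alpha>) * lam n \<le> energy (\<lambda>_. 1) (p * averager m)"
      using energy_averager_ge[OF \<alpha> m, of p] p by simp
    ultimately have "Lam (n + m) * (1 - 4 * real m powr (2 * \<alpha>) * lam n) \<le> Lam (n + m) * energy (\<lambda>_. 1) (p * averager m)"
      by (intro mult_left_mono) auto
    also have "\<dots> \<le> energy pw (p * averager m)"
      using Lam n degree_mult_averager[OF p(1) m] unfolding rayleigh_min_def by auto
    also have "\<dots> \<le> (c\<^sub>0 + \<eta> + K / (real m)\<^sup>2) * lam n" using K[OF m, of p] p by simp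
    finally show ?thesis .
  qed
  then show ?thesis by blast
qed

lemma Lam_le: "0 < n \<Longrightarrow> Lam n \<le> c_up * lam n"
proof -
  assume n: "0 < n"
  obtain p where p: "degree p < n" "energy (\<lambda>_. 1) p = 1" "energy (wt \<alpha>) p = lam n"
    using lam n unfolding rayleigh_min_def by blast
  have "Lam n * energy (\<lambda>_. 1) p \<le> energy pw p" using Lam n p unfolding rayleigh_min_def by blast
  then show ?thesis using energy_pw_bounds(2)[of p] p by simp
qed

text \<open>An a priori bound of the right order; in \<open>Lam_liminf\<close> it turns the loss of
  norm into a multiple of \<epsilon>^(2\<alpha>).\<close>

lemma Lam_bounded: "\<exists>B>0. \<forall>n>0. real n powr (2 * \<alpha>) * Lam n \<le> B"
proof -
  obtain B where B: "0 < B" "\<And>n. norm (real n powr (2 * \<alpha>) * lam n) \<le> B"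
    using convergent_imp_Bseq[OF convergentI[OF lam_lim]] unfolding Bseq_def by blast
  have "real n powr (2 * \<alpha>) * Lam n \<le> c_up * B" if "0 < n" for n
  proof -
    have "real n powr (2 * \<alpha>) * Lam n \<le> real n powr (2 * \<alpha>) * (c_up * lam n)"
      using Lam_le[OF that] by (intro mult_left_mono) auto
    also have "\<dots> = c_up * (real n powr (2 * \<alpha>) * lam n)" by simp
    also have "\<dots> \<le> c_up * B" using B(2)[of n] c_up_pos by (intro mult_left_mono) (auto simp: abs_le_iff)
    finally show ?thesis .
  qed
  then show ?thesis using B c_up_pos by (intro exI[of _ "c_up * B"]) auto
qed

text \<open>The averaging length is floor(\<epsilon> n) + 1; the summand 1 keeps it positive and
  does not affect the limiting proportion.\<close>

lemma window_ratio: "0 < \<epsilon> \<Longrightarrow> (\<lambda>n. real (cell n \<epsilon> + 1) / real n) \<longlonglongrightarrow> \<epsilon>"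
proof -
  assume "0 < \<epsilon>"
  then have "(\<lambda>n. real (cell n \<epsilon>) / real n + 1 / real n) \<longlonglongrightarrow> \<epsilon> + 0"
    by (intro tendsto_add cell_limit lim_1_over_n) simp
  then show ?thesis by (simp add: add_divide_distrib add.commute)
qed

lemma window_correction: "0 < \<epsilon> \<Longrightarrow> (\<lambda>n. K / (real (cell n \<epsilon> + 1))\<^sup>2) \<longlonglongrightarrow> 0"
proof -
  assume \<epsilon>: "0 < \<epsilon>"
  have "(\<lambda>n. K / (real (cell n \<epsilon> + 1) / real n)\<^sup>2 * (1 / real n)\<^sup>2) \<longlonglongrightarrow> K / \<epsilon>\<^sup>2 * 0\<^sup>2"
    using \<epsilon> by (intro tendsto_mult tendsto_divide tendsto_power window_ratio tendsto_const lim_1_over_n) auto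
  moreover have "\<forall>\<^sub>F n in sequentially. K / (real (cell n \<epsilon> + 1) / real n)\<^sup>2 * (1 / real n)\<^sup>2 = K / (real (cell n \<epsilon> + 1))\<^sup>2"
    using eventually_gt_at_top[of 0] by eventually_elim (simp add: power_divide)
  ultimately show ?thesis by (simp add: tendsto_cong)
qed

text \<open>\<open>Lam_lower\<close> with \<eta> = \<epsilon> and m of order \<epsilon> n,
  multiplied by n^(2\<alpha>). The left-hand side is bounded below by a sequence with limit
  R(\<epsilon>), the correction K / m^2 disappears, and R(\<epsilon>) tends to c_0 L. So \<epsilon>
  is fixed first, with x < R(\<epsilon>).\<close>

lemma Lam_liminf:
  assumes x: "x < c\<^sub>0 * L"
  shows "\<forall>\<^sub>F n in sequentially. x < real n powr (2 * \<alpha>) * Lam n"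
proof -
  obtain B where B: "0 < B" "\<And>n. 0 < n \<Longrightarrow> real n powr (2 * \<alpha>) * Lam n \<le> B" using Lam_bounded by blast
  \<comment> \<open>The power of 1 / (1 + \<epsilon>) comes from rescaling size n + m to size n; the
    last factor bounds the remaining squared norm from below.\<close>
  define R where "R \<epsilon> = (c\<^sub>0 - \<epsilon>) * (L * (1 / (1 + \<epsilon>)) powr (2 * \<alpha>) * (1 - 4 * \<epsilon> powr (2 * \<alpha>) * (B / c_low)))" for \<epsilon>
  have 1: "((\<lambda>\<epsilon>. \<epsilon> powr (2 * \<alpha>)) \<longlongrightarrow> 0 powr (2 * \<alpha>)) (at_right 0)"
    using \<alpha> by (intro tendsto_powr' tendsto_ident_at tendsto_const) (auto simp: eventually_at_filter)
  have 2: "((\<lambda>\<epsilon>. (1 / (1 + \<epsilon>)) powr (2 * \<alpha>)) \<longlongrightarrow> (1 / (1 + 0)) powr (2 * \<alpha>)) (at_right 0)"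
    by (intro tendsto_powr tendsto_divide tendsto_add tendsto_const tendsto_ident_at) auto
  have "(R \<longlongrightarrow> (c\<^sub>0 - 0) * (L * (1 / (1 + 0)) powr (2 * \<alpha>) * (1 - 4 * 0 powr (2 * \<alpha>) * (B / c_low)))) (at_right 0)"
    unfolding R_def
    by (rule tendsto_mult[OF tendsto_diff[OF tendsto_const tendsto_ident_at]
        tendsto_mult[OF tendsto_mult[OF tendsto_const 2]
          tendsto_diff[OF tendsto_const tendsto_mult[OF tendsto_mult[OF tendsto_const 1] tendsto_const]]]])
  then have "\<forall>\<^sub>F \<epsilon> in at_right 0. x < R \<epsilon>"
    by (rule order_tendstoD(1)) (use x \<alpha> in simp)
  moreover have "\<forall>\<^sub>F \<epsilon> in at_right 0. 0 < \<epsilon> \<and> \<epsilon> < c\<^sub>0"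
    using c\<^sub>0_pos by (auto simp: eventually_at_right)
  ultimately have "\<forall>\<^sub>F \<epsilon> in at_right 0. x < R \<epsilon> \<and> 0 < \<epsilon> \<and> \<epsilon> < c\<^sub>0" by eventually_elim auto
  then obtain \<epsilon> where \<epsilon>: "x < R \<epsilon>" "0 < \<epsilon>" "\<epsilon> < c\<^sub>0"
    using eventually_happens'[OF trivial_limit_at_right_real] by blast
  obtain K where K: "\<And>n m. 0 < n \<Longrightarrow> 0 < m \<Longrightarrow> (c\<^sub>0 - \<epsilon>) * (lam (n + m) * (1 - 4 * real m powr (2 * \<alpha>) * (Lam n / c_low)))
    \<le> (1 + K / (real m)\<^sup>2) * Lam n"
    using Lam_lower[OF \<epsilon>(2,3)] by blast
  define m where "m n = cell n \<epsilon> + 1" for n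
  define a where "a n = real n powr (2 * \<alpha>) * lam n" for n
  \<comment> \<open>The absolute value covers a negative K, whose sign is unknown.\<close>
  define f where "f n = (c\<^sub>0 - \<epsilon>) * (a (n + m n) * (1 / (1 + real (m n) / real n)) powr (2 * \<alpha>)
      * (1 - 4 * (real (m n) / real n) powr (2 * \<alpha>) * (B / c_low))) - \<bar>K\<bar> / (real (m n))\<^sup>2 * B" for n
  have mr: "(\<lambda>n. real (m n) / real n) \<longlonglongrightarrow> \<epsilon>" unfolding m_def by (rule window_ratio[OF \<epsilon>(2)])
  have "filterlim (\<lambda>n. n + m n) at_top sequentially"
    by (rule filterlim_at_top_mono[OF filterlim_ident]) auto
  from filterlim_compose[OF lam_lim this] have al: "(\<lambda>n. a (n + m n)) \<longlonglongrightarrow> L"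
    unfolding a_def .
  have "f \<longlonglongrightarrow> R \<epsilon> - 0 * B" unfolding f_def R_def
    using \<epsilon> \<alpha> window_correction[OF \<epsilon>(2), of "\<bar>K\<bar>"]
    by (intro tendsto_intros al mr) (auto simp: m_def)
  then have "\<forall>\<^sub>F n in sequentially. x < f n" by (rule order_tendstoD(1)) (use \<epsilon> in simp)
  then show ?thesis using eventually_gt_at_top[of 0]
  proof eventually_elim
    case (elim n)
    have n: "0 < n" and m: "0 < m n" using elim by (auto simp: m_def)
    define N where "N = real n powr (2 * \<alpha>)"
    have N: "0 < N" using n by (simp add: N_def)
    have 1: "N * lam (n + m n) = a (n + m n) * (1 / (1 + real (m n) / real n)) powr (2 * \<alpha>)"
    proof -
      have "1 / (1 + real (m n) / real n) = real n / real (n + m n)" using n by (simp add: field_simps)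
      then show ?thesis using n by (simp add: a_def N_def powr_divide)
    qed
    have 2: "real (m n) powr (2 * \<alpha>) * (Lam n / c_low) \<le> (real (m n) / real n) powr (2 * \<alpha>) * (B / c_low)"
    proof -
      have "real (m n) powr (2 * \<alpha>) * (Lam n / c_low) = (real (m n) / real n) powr (2 * \<alpha>) * ((N * Lam n) / c_low)"
        using n by (simp add: N_def powr_divide)
      also have "\<dots> \<le> (real (m n) / real n) powr (2 * \<alpha>) * (B / c_low)"
        using B(2)[OF n] low(1) by (intro mult_left_mono divide_right_mono) (auto simp: N_def)
      finally show ?thesis .
    qed
    have "(c\<^sub>0 - \<epsilon>) * (N * lam (n + m n) * (1 - 4 * (real (m n) / real n) powr (2 * \<alpha>) * (B / c_low)))
        \<le> (c\<^sub>0 - \<epsilon>) * (N * lam (n + m n) * (1 - 4 * real (m n) powr (2 * \<alpha>) * (Lam n / c_low)))"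
      using \<epsilon> N lam_pos[of "n + m n"] n 2 by (intro mult_left_mono) auto
    also have "\<dots> = N * ((c\<^sub>0 - \<epsilon>) * (lam (n + m n) * (1 - 4 * real (m n) powr (2 * \<alpha>) * (Lam n / c_low))))"
      by simp
    also have "\<dots> \<le> N * ((1 + K / (real (m n))\<^sup>2) * Lam n)" using K[OF n m] N by (intro mult_left_mono) auto
    also have "\<dots> = N * Lam n + K / (real (m n))\<^sup>2 * (N * Lam n)" by (simp add: algebra_simps)
    also have "K / (real (m n))\<^sup>2 * (N * Lam n) \<le> \<bar>K\<bar> / (real (m n))\<^sup>2 * B"
    proof -
      have "0 \<le> Lam n" using Lam_nonneg[OF n] .
      then show ?thesis using B(2)[OF n] N by (intro mult_mono divide_right_mono) (auto simp: N_def)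
    qed
    finally have "f n \<le> N * Lam n" unfolding f_def 1 by simp
    with elim show ?case by (simp add: N_def)
  qed
qed

text \<open>The size N is prescribed here, so it is split as N = n + m with m of order \<epsilon> N,
  and the pure problem is taken at size n. The proportions m / n and N / n tend to \<epsilon> / (1 -
  \<epsilon>) and 1 / (1 - \<epsilon>). Dividing by the remaining norm needs D(\<epsilon>) > 0,
  which holds for small \<epsilon>.\<close>

lemma Lam_limsup:
  assumes x: "c\<^sub>0 * L < x"
  shows "\<forall>\<^sub>F N in sequentially. real N powr (2 * \<alpha>) * Lam N < x"
proof -
  define D where "D \<epsilon> = 1 - 4 * (L * (\<epsilon> / (1 - \<epsilon>)) powr (2 * \<alpha>))" for \<epsilon>
  \<comment> \<open>The \<open>+ 0\<close> stands for the limit of K / m^2.\<close>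
  define U where "U \<epsilon> = (c\<^sub>0 + \<epsilon> + 0) * (L * (1 / (1 - \<epsilon>)) powr (2 * \<alpha>))" for \<epsilon>
  have r: "((\<lambda>\<epsilon>::real. \<epsilon> / (1 - \<epsilon>)) \<longlongrightarrow> 0 / (1 - 0)) (at_right 0)"
    by (intro tendsto_intros) auto
  moreover have ev1: "\<forall>\<^sub>F \<epsilon>::real in at_right 0. 0 < \<epsilon> \<and> \<epsilon> < 1"
    using eventually_at_right_real[of 0 1] by simp
  then have "\<forall>\<^sub>F \<epsilon>::real in at_right 0. 0 \<le> \<epsilon> / (1 - \<epsilon>)" by eventually_elim auto
  ultimately have 1: "((\<lambda>\<epsilon>. (\<epsilon> / (1 - \<epsilon>)) powr (2 * \<alpha>)) \<longlongrightarrow> (0 / (1 - 0)) powr (2 * \<alpha>)) (at_right 0)"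
    using \<alpha> by (intro tendsto_powr' tendsto_const) auto
  have Dl: "(D \<longlongrightarrow> 1 - 4 * (L * (0 / (1 - 0)) powr (2 * \<alpha>))) (at_right 0)"
    unfolding D_def
    by (rule tendsto_diff[OF tendsto_const tendsto_mult[OF tendsto_const tendsto_mult[OF tendsto_const 1]]])
  have Ul: "(U \<longlongrightarrow> (c\<^sub>0 + 0 + 0) * (L * (1 / (1 - 0)) powr (2 * \<alpha>))) (at_right 0)"
    unfolding U_def
    by (intro tendsto_mult tendsto_add tendsto_powr tendsto_divide tendsto_diff tendsto_const tendsto_ident_at) auto
  have "((\<lambda>\<epsilon>. U \<epsilon> / D \<epsilon>) \<longlongrightarrow> c\<^sub>0 * L / 1) (at_right 0)"
    using tendsto_divide[OF Ul Dl] \<alpha> by simp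
  then have "\<forall>\<^sub>F \<epsilon> in at_right 0. U \<epsilon> / D \<epsilon> < x" by (rule order_tendstoD(2)) (use x in simp)
  moreover have "\<forall>\<^sub>F \<epsilon> in at_right 0. 0 < D \<epsilon>" using Dl by (rule order_tendstoD(1)) (use \<alpha> in simp)
  ultimately have "\<forall>\<^sub>F \<epsilon> in at_right 0. U \<epsilon> / D \<epsilon> < x \<and> 0 < D \<epsilon> \<and> 0 < \<epsilon> \<and> \<epsilon> < 1"
    using ev1 by eventually_elim auto
  then obtain \<epsilon> where \<epsilon>: "U \<epsilon> / D \<epsilon> < x" "0 < D \<epsilon>" "0 < \<epsilon>" "\<epsilon> < 1"
    using eventually_happens'[OF trivial_limit_at_right_real] by blast
  obtain K where K: "\<And>n m. 0 < n \<Longrightarrow> 0 < m \<Longrightarrow>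
      Lam (n + m) * (1 - 4 * real m powr (2 * \<alpha>) * lam n) \<le> (c\<^sub>0 + \<epsilon> + K / (real m)\<^sup>2) * lam n"
    using Lam_upper[OF \<epsilon>(3)] by blast
  define m where "m N = cell N \<epsilon> + 1" for N
  define a where "a n = real n powr (2 * \<alpha>) * lam n" for n
  define r where "r N = real (m N) / real N" for N
  have rl: "r \<longlonglongrightarrow> \<epsilon>" unfolding m_def r_def by (rule window_ratio[OF \<epsilon>(3)])
  have "\<forall>\<^sub>F N in sequentially. r N < 1" using rl by (rule order_tendstoD(2)) (use \<epsilon> in simp)
  then have evm: "\<forall>\<^sub>F N in sequentially. 0 < N \<and> m N < N"
    using eventually_gt_at_top[of 0] by eventually_elim (auto simp: r_def)
  have "filterlim (\<lambda>N. real (N - m N)) at_top sequentially"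
  proof -
    have "filterlim (\<lambda>N. (1 - r N) * real N) at_top sequentially"
      by (rule filterlim_tendsto_pos_mult_at_top[OF tendsto_diff[OF tendsto_const rl] _ filterlim_real_sequentially])
        (use \<epsilon> in simp)
    moreover have "\<forall>\<^sub>F N in sequentially. (1 - r N) * real N = real (N - m N)"
      using evm by eventually_elim (simp add: r_def left_diff_distrib of_nat_diff)
    ultimately show ?thesis by (simp cong: filterlim_cong)
  qed
  then have "filterlim (\<lambda>N. N - m N) at_top sequentially"
    using filterlim_sequentially_iff_filterlim_real by blast
  from filterlim_compose[OF lam_lim this] have al: "(\<lambda>N. a (N - m N)) \<longlonglongrightarrow> L" unfolding a_def .
  define Dn where "Dn N = 1 - 4 * (a (N - m N) * (r N / (1 - r N)) powr (2 * \<alpha>))" for N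
  define Up where "Up N = (c\<^sub>0 + \<epsilon> + K / (real (m N))\<^sup>2) * (a (N - m N) * (1 / (1 - r N)) powr (2 * \<alpha>))" for N
  have Dnl: "Dn \<longlonglongrightarrow> D \<epsilon>" unfolding Dn_def D_def
    using \<epsilon> by (intro tendsto_intros al rl) auto
  have Upl: "Up \<longlonglongrightarrow> U \<epsilon>" unfolding Up_def U_def
    using \<epsilon> window_correction[OF \<epsilon>(3), of K] by (intro tendsto_intros al rl) (auto simp: m_def)
  have "(\<lambda>N. Up N / Dn N) \<longlonglongrightarrow> U \<epsilon> / D \<epsilon>" using \<epsilon> by (intro tendsto_divide Upl Dnl) auto
  then have "\<forall>\<^sub>F N in sequentially. Up N / Dn N < x" by (rule order_tendstoD(2)) (use \<epsilon> in simp)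
  moreover have "\<forall>\<^sub>F N in sequentially. 0 < Dn N" using Dnl by (rule order_tendstoD(1)) (use \<epsilon> in simp)
  ultimately show ?thesis using evm
  proof eventually_elim
    case (elim N)
    define n where "n = N - m N"
    have n: "0 < n" "N = n + m N" and m: "0 < m N" using elim by (auto simp: n_def m_def)
    define P where "P = real N powr (2 * \<alpha>)"
    have P: "0 < P" using elim by (simp add: P_def)
    have q: "1 - r N = real n / real N"
    proof -
      have "real n = real N - real (m N)" using n(2) by linarith
      then show ?thesis using elim by (simp add: r_def diff_divide_distrib)
    qed
    have 1: "real (m N) powr (2 * \<alpha>) * lam n = a n * (r N / (1 - r N)) powr (2 * \<alpha>)"
    proof -
      have "r N / (1 - r N) = real (m N) / real n" unfolding q using elim n by (simp add: r_def)
      then show ?thesis using n by (simp add: a_def powr_divide)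
    qed
    have 2: "P * lam n = a n * (1 / (1 - r N)) powr (2 * \<alpha>)"
    proof -
      have "1 / (1 - r N) = real N / real n" unfolding q using elim n by simp
      then show ?thesis using n by (simp add: a_def P_def powr_divide)
    qed
    have "P * (Lam N * (1 - 4 * real (m N) powr (2 * \<alpha>) * lam n)) \<le> P * ((c\<^sub>0 + \<epsilon> + K / (real (m N))\<^sup>2) * lam n)"
      using K[OF n(1) m] P n(2) by (intro mult_left_mono) auto
    also have "\<dots> = Up N" unfolding Up_def n_def[symmetric] 2[symmetric] by simp
    also have "P * (Lam N * (1 - 4 * real (m N) powr (2 * \<alpha>) * lam n)) = P * Lam N * Dn N"
      unfolding Dn_def n_def[symmetric] 1[symmetric] by simp
    finally have "P * Lam N \<le> Up N / Dn N" using elim by (simp add: pos_le_divide_eq)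
    with elim show ?case by (simp add: P_def)
  qed
qed

lemma Lam_tendsto: "(\<lambda>n. real n powr (2 * \<alpha>) * Lam n) \<longlonglongrightarrow> c\<^sub>0 * L"
  by (rule order_tendstoI) (auto intro: Lam_liminf Lam_limsup)

end

end

section \<open>Transfer to the Toeplitz matrices\<close>

lemma rayleigh_min_min_eigenvalue:
  assumes "continuous_on {0..2*pi} \<phi>" and "\<And>\<theta>. f (exp (\<i> * of_real \<theta>)) = complex_of_real (\<phi> \<theta>)"
  shows "rayleigh_min \<phi> (\<lambda>n. min_eigenvalue (mat n n (\<lambda>(k, l). fourier_coeff f (int l - int k))))"
  unfolding rayleigh_min_def using min_eigenvalue_energy[of \<phi> f, OF assms] by blast

theorem mainTheorem2:
  fixes \<alpha> :: real and c\<^sub>1 :: "complex \<Rightarrow> real"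
  assumes "0 < \<alpha>" and "\<alpha> < 1/2"
    and "(\<lambda>z. complex_of_real (c\<^sub>1 z)) \<in> A_circle (3/2)"
    and "continuous_on (sphere 0 1) c\<^sub>1"
    and "\<And>z. z \<in> sphere 0 1 \<Longrightarrow> c\<^sub>1 z > 0"
  shows "(\<lambda>N::nat. min_eigenvalue (toeplitz N (phi_symbol \<alpha> c\<^sub>1))
            - real N powr (-2 * \<alpha>) * inverse (L2_opnorm_on {0<..<1} (G_operator \<alpha>)) * c\<^sub>1 1)
         \<in> o(\<lambda>N. real N powr (-2 * \<alpha>))"
proof -
  define c where "c \<theta> = c\<^sub>1 (exp (\<i> * of_real \<theta>))" for \<theta> :: real
  have circ: "exp (\<i> * of_real \<theta>) \<in> sphere (0::complex) 1" for \<theta> :: real by simp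
  have ccont: "continuous_on {0..2*pi} c" unfolding c_def
    by (rule continuous_on_compose2[OF assms(4)]) (auto intro!: continuous_intros)
  have ne: "sphere (0::complex) 1 \<noteq> {}" using circ by blast
  obtain z1 where z1: "z1 \<in> sphere 0 1" "\<And>z. z \<in> sphere 0 1 \<Longrightarrow> c\<^sub>1 z1 \<le> c\<^sub>1 z"
    using continuous_attains_inf[OF compact_sphere ne assms(4)] by blast
  obtain z2 where z2: "\<And>z. z \<in> sphere 0 1 \<Longrightarrow> c\<^sub>1 z \<le> c\<^sub>1 z2"
    using continuous_attains_sup[OF compact_sphere ne assms(4)] by blast
  have dist: "cmod (1 - cis (- \<theta>)) = dist (exp (\<i> * of_real \<theta>)) 1" for \<theta>
  proof -
    have "cmod (1 - cis (- \<theta>)) = cmod (cnj (1 - cis (- \<theta>)))" by (rule complex_mod_cnj[symmetric])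
    also have "\<dots> = cmod (1 - exp (\<i> * of_real \<theta>))"
      unfolding cis_conv_exp[symmetric] by (simp add: cis_cnj)
    finally show ?thesis by (simp add: dist_norm norm_minus_commute)
  qed
  \<comment> \<open>On the compact circle c_1 attains its minimum at z1 and its maximum at z2; these
    values are the two global bounds.\<close>
  interpret perturbed_weight \<alpha> "c\<^sub>1 1" "c\<^sub>1 z1" "c\<^sub>1 z2" c
  proof
    fix \<eta> :: real assume \<eta>: "0 < \<eta>"
    obtain \<delta> where "0 < \<delta>" "\<And>z. z \<in> sphere 0 1 \<Longrightarrow> dist z 1 < \<delta> \<Longrightarrow> dist (c\<^sub>1 z) (c\<^sub>1 1) < \<eta>"
      using assms(4) \<eta> unfolding continuous_on_iff by (metis mem_sphere dist_0_norm norm_one)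
    then show "\<exists>\<delta>>0. \<forall>\<theta>\<in>{0..2*pi}. cmod (1 - cis (- \<theta>)) < \<delta> \<longrightarrow> \<bar>c \<theta> - c\<^sub>1 1\<bar> \<le> \<eta>"
      unfolding dist c_def dist_real_def using circ by (meson less_imp_le)
  qed (use assms ccont z1 z2 circ in \<open>auto simp: c_def\<close>)
  have \<alpha>: "0 < \<alpha>" "\<alpha> < 1" using assms by auto
  define b where "b = enn2real (limit_knorm \<alpha>)"
  have b: "0 < b" using limit_knorm_pos[OF \<alpha>] limit_knorm_finite[OF \<alpha>] by (simp add: b_def enn2real_positive_iff)
  define Lam where "Lam n = min_eigenvalue (mat n n (\<lambda>(k, l). fourier_coeff (phi_symbol \<alpha> c\<^sub>1) (int l - int k)))" for n
  have lam: "rayleigh_min (wt \<alpha>) (pure_min \<alpha>)"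
    using rayleigh_min_min_eigenvalue[of "wt \<alpha>" "phi_symbol \<alpha> (\<lambda>_. 1)"] \<alpha>
    by (simp add: fourier_coeff_pure_eq pure_min_def[abs_def] phi_symbol_def wt_eq continuous_wt)
  have Lam: "rayleigh_min pw Lam"
    unfolding Lam_def by (rule rayleigh_min_min_eigenvalue[OF continuous_pw]) (simp add: phi_symbol_def pw_def c_def wt_eq)
  have A: "(\<lambda>n. real n powr (2 * \<alpha>) * Lam n) \<longlonglongrightarrow> c\<^sub>1 1 * (1 / b\<^sup>2)"
    by (rule Lam_tendsto[OF lam Lam]) (use pure_min_tendsto[OF \<alpha>] pure_min_eq(1)[OF \<alpha>] b in \<open>auto simp: b_def\<close>)
  \<comment> \<open>Order N means size N + 1; replacing the power of N + 1 by that of N costs a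
    factor tending to 1.\<close>
  have "(\<lambda>N. real N / real (N + 1)) \<longlonglongrightarrow> 1" using LIMSEQ_n_over_Suc_n by simp
  then have "(\<lambda>N. real (N + 1) powr (2 * \<alpha>) * Lam (N + 1) * (real N / real (N + 1)) powr (2 * \<alpha>))
      \<longlonglongrightarrow> c\<^sub>1 1 * (1 / b\<^sup>2) * 1 powr (2 * \<alpha>)"
    by (intro tendsto_mult LIMSEQ_ignore_initial_segment[OF A, of 1] tendsto_powr tendsto_const) auto
  moreover have "real (N + 1) powr (2 * \<alpha>) * Lam (N + 1) * (real N / real (N + 1)) powr (2 * \<alpha>)
      = real N powr (2 * \<alpha>) * Lam (N + 1)" for N
    by (simp add: powr_divide)
  ultimately have "(\<lambda>N. real N powr (2 * \<alpha>) * Lam (N + 1)) \<longlonglongrightarrow> c\<^sub>1 1 * (1 / b\<^sup>2) * 1 powr (2 * \<alpha>)"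
    by (simp only:)
  then have lim: "(\<lambda>N. real N powr (2 * \<alpha>) * Lam (N + 1) - c\<^sub>1 1 * (1 / b\<^sup>2)) \<longlonglongrightarrow> 0"
    by (intro LIM_zero) simp
  have op: "inverse (L2_opnorm_on {0<..<1} (G_operator \<alpha>)) = 1 / b\<^sup>2"
    by (simp add: L2_opnorm_G_operator[OF \<alpha>] b_def inverse_eq_divide)
  show ?thesis
  proof (rule smalloI_tendsto)
    show "\<forall>\<^sub>F N in sequentially. real N powr (-2 * \<alpha>) \<noteq> 0"
      using eventually_gt_at_top[of 0] by eventually_elim simp
    have "\<forall>\<^sub>F N in sequentially. real N powr (2 * \<alpha>) * Lam (N + 1) - c\<^sub>1 1 * (1 / b\<^sup>2) =
      (min_eigenvalue (toeplitz N (phi_symbol \<alpha> c\<^sub>1))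
            - real N powr (-2 * \<alpha>) * inverse (L2_opnorm_on {0<..<1} (G_operator \<alpha>)) * c\<^sub>1 1) / real N powr (-2 * \<alpha>)"
      using eventually_gt_at_top[of 0]
    proof eventually_elim
      case (elim N)
      have "min_eigenvalue (toeplitz N (phi_symbol \<alpha> c\<^sub>1)) = Lam (N + 1)"
        by (simp add: toeplitz_def Lam_def)
      moreover have "real N powr (-2 * \<alpha>) = 1 / real N powr (2 * \<alpha>)"
        by (simp add: powr_minus inverse_eq_divide)
      ultimately show ?case using elim unfolding op by (simp add: field_simps)
    qed
    then show "(\<lambda>N. (min_eigenvalue (toeplitz N (phi_symbol \<alpha> c\<^sub>1))
            - real N powr (-2 * \<alpha>) * inverse (L2_opnorm_on {0<..<1} (G_operator \<alpha>)) * c\<^sub>1 1) / real N powr (-2 * \<alpha>)) \<longlonglongrightarrow> 0"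
      using lim by (simp only: tendsto_cong)
  qed
qed

end
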